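(* Let $n \geq 1$ and $N_t \in \mathbb{Z}$ be integers. Suppose $g_0, g_1:[0,\infty)\to \mathbb{R}$ satisfy $$(1+t)^n\big(|g_0 - 2\pi N_t| + |g_{0t}|+|g_1|\big)\in L^1([0,\infty)).$$ Then the Volterra integral equations $$T(t,k) = I + \int_{\infty}^t e^{i\theta_2(t'-t)\hat{\sigma}_3} (\mathsf{V}T)(t',k)\, dt', \qquad U(t,k) = I + \int_{0}^t e^{i\theta_2(t'-t)\hat{\sigma}_3} (\mathsf{V}U)(t',k)\, dt'$$ uniquely define two $2 \times 2$-matrix valued solutions $T$ and $U$ of the differential equation $$T_t + i\theta_2[\sigma_3, T] = \mathsf{V} T \qquad (\ast)$$ with the following properties: (a) The function $T(t, k)$ is defined for $t \geq 0$ and $k \in (\bar{D}_-, \bar{D}_+) \setminus \{0\}$. For each $k \in (\bar{D}_-, \bar{D}_+)\setminus \{0\}$, $T(\cdot, k)$ is weakly differentiable and satisfies $(\ast)$. (b) The function $U(t, k)$ is defined for $t \geq 0$ and $k \in \mathbb{C}\setminus \{0\}$. For each $k \in \mathbb{C}\setminus \{0\}$, $U(\cdot, k)$ is weakly differentiable and satisfies $(\ast)$. (c) For each $t \geq 0$, the function $T(t,\cdot)$ is continuous for $k \in (\bar{D}_-, \bar{D}_+)\setminus \{0\}$ and analytic for $k \in (D_-, D_+)$. (d) For each $t \geq 0$, the function $U(t,\cdot)$ is analytic for $k \in \mathbb{C} \setminus \{0\}$. (e) For each $t \geq 0$ and each $j = 1, \dots, n$, the partial derivative $\frac{\partial^j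 T}{\partial k^j}(t, \cdot)$ has a continuous extension to $(\bar{D}_-, \bar{D}_+)\setminus \{0\}$. (f) There is a constant $C>0$ (independent of $t$ and $k$) such that $T$ and $U$ satisfy the following estimates for $t \geq 0$ and $j = 0, 1, \dots, n$: $$\bigg|\frac{\partial^j}{\partial k^j}\big(T(t,k) - I\big) \bigg| \leq \frac{C}{(1+t)^{n-j}}, \qquad k \in (\bar{D}_4, \bar{D}_1),$$ $$\bigg|\frac{\partial^j}{\partial k^j}\big(U(t,k) - I\big) \bigg| \leq C(1 + t)^j, \qquad k \in (\bar{D}_1, \bar{D}_4),$$ $$\bigg|\frac{\partial^j}{\partial k^j}\Big((U(t,k) - I)e^{-2i\theta_2t\sigma_3}\Big) \bigg| \leq C(1 + t)^j, \qquad k \in (\bar{D}_4, \bar{D}_1).$$ (g) $\det T(t,k) = 1$ for $t \geq 0$, $k \in (\bar{D}_+ \cap \bar{D}_-)\setminus \{0\}$, and $\det U(t,k) = 1$ for $t \geq 0$, $k \in \mathbb{C} \setminus \{0\}$. (h) $T$ and $U$ obey the following symmetries for each $t \geq 0$: $$T(t,k) = \sigma_2 T(t,-k) \sigma_2 = \sigma_2 \overline{T(t,\bar{k})} \sigma_2, \qquad k \in (\bar{D}_-, \bar{D}_+) \setminus \{0\},$$ $$U(t,k) = \sigma_2 U(t,-k) \sigma_2 = \sigma_2 \overline{U(t,\bar{k})} \sigma_2, \qquad k \in \mathbb{C} \setminus \{0\}.$$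
   Context: Pauli matrices: $\sigma_1=\begin{pmatrix}0&1\\1&0\end{pmatrix}$, $\sigma_2=\begin{pmatrix}0&-i\\i&0\end{pmatrix}$, $\sigma_3=\begin{pmatrix}1&0\\0&-1\end{pmatrix}$. $\hat\sigma_3A=[\sigma_3,A]$, so that $e^{\alpha\hat\sigma_3}A=e^{\alpha\sigma_3}Ae^{-\alpha\sigma_3}$ for $\alpha\in\mathbb{C}$. For a matrix $A$, $|A|^2=\sum_{i,j}|A_{ij}|^2$. For $k\in\mathbb{C}\setminus\{0\}$, $\theta_2=\theta_2(k)=\frac14\big(k+\frac1k\big)$, and $$\mathsf{V}(t,k)=-\frac{i(g_1(t)+g_{0t}(t))}{4}\sigma_2+\frac1k\Big(-\frac{i\sin g_0(t)}{4}\sigma_1-\frac{i(\cos g_0(t)-1)}{4}\sigma_3\Big),$$ where $g_{0t}$ is the (weak) derivative of $g_0$, which is implicitly assumed to exist. $D_1=\{\operatorname{Im}k>0,|k|>1\}$, $D_2=\{\operatorname{Im}k>0,|k|<1\}$, $D_3=\{\operatorname{Im}k<0,|k|<1\}$, $D_4=\{\operatorname{Im}k<0,|k|>1\}$, $D_+=D_1\cup D_3$, $D_-=D_2\cup D_4$; bars denote closures in $\mathbb{C}$. Column convention: for a statement about a $2\times2$ matrix, "$k\in(A,B)$" means that the statement holds for the first column when $k\in A$ and for the second column when $k\in B$; $(A,B)\setminus\{0\}$ means $(A\setminus\{0\},B\setminus\{0\})$. The integral equation for $T$ is likewise read columnwise. *)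

theory Defs
  imports "HOL-Analysis.Analysis"
begin

type_synonym cmat2 = "complex^2^2"

definition scale_mat :: "complex \<Rightarrow> cmat2 \<Rightarrow> cmat2" (infixr "*m" 75) where
  "a *m A = map_matrix ((*) a) A"

definition sigma1 :: cmat2 where
  "sigma1 = vector [vector [0, 1], vector [1, 0]]"

definition sigma2 :: cmat2 where
  "sigma2 = vector [vector [0, -\<i>], vector [\<i>, 0]]"

definition sigma3 :: cmat2 where
  "sigma3 = vector [vector [1, 0], vector [0, -1]]"

text \<open>
  \<open>A * B\<close> and \<open>A ^ m\<close> are componentwise on \<^typ>\<open>complex^2^2\<close>, so the exponential
  series has to be written with iterated matrix products \<open>**\<close>.
\<close>

definition mexp :: "cmat2 \<Rightarrow> cmat2" where
  "mexp A = (\<Sum>m. (1 / fact m) *\<^sub>R (((**) A ^^ m) (mat 1)))"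

text \<open>The exponential of \<open>\<alpha>\<close> times the operator \<open>A \<mapsto> [\<sigma>3, A]\<close>.\<close>

definition exp_hat_sigma3 :: "complex \<Rightarrow> cmat2 \<Rightarrow> cmat2" where
  "exp_hat_sigma3 \<alpha> A = mexp (\<alpha> *m sigma3) ** A ** mexp ((- \<alpha>) *m sigma3)"

definition cnj_mat :: "cmat2 \<Rightarrow> cmat2" where
  "cnj_mat A = map_matrix cnj A"

definition theta2 :: "complex \<Rightarrow> complex" where
  "theta2 k = (k + 1 / k) / 4"

text \<open>The argument \<open>g0t\<close> stands for the weak derivative of \<open>g0\<close>.\<close>

definition Vmat :: "(real \<Rightarrow> real) \<Rightarrow> (real \<Rightarrow> real) \<Rightarrow> (real \<Rightarrow> real) \<Rightarrow> real \<Rightarrow> complex \<Rightarrow> cmat2" where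
  "Vmat g0 g0t g1 t k =
     (- \<i> * of_real (g1 t + g0t t) / 4) *m sigma2
     + (1 / k) *m ((- \<i> * of_real (sin (g0 t)) / 4) *m sigma1
                   + (- \<i> * of_real (cos (g0 t) - 1) / 4) *m sigma3)"

definition D1 :: "complex set" where "D1 = {k. Im k > 0 \<and> cmod k > 1}"
definition D2 :: "complex set" where "D2 = {k. Im k > 0 \<and> cmod k < 1}"
definition D3 :: "complex set" where "D3 = {k. Im k < 0 \<and> cmod k < 1}"
definition D4 :: "complex set" where "D4 = {k. Im k < 0 \<and> cmod k > 1}"
definition Dplus :: "complex set" where "Dplus = D1 \<union> D3"
definition Dminus :: "complex set" where "Dminus = D2 \<union> D4"

text \<open>
  \<open>k \<in> (A, B)\<close> for a statement about a matrix is expressed by stating it for each column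
  \<open>c\<close> and all \<open>k \<in> cols A B c\<close>.
\<close>

definition cols :: "complex set \<Rightarrow> complex set \<Rightarrow> 2 \<Rightarrow> complex set" where
  "cols A B c = (if c = 1 then A else B)"

text \<open>\<open>j\<close>-th complex derivative of column \<open>c\<close> of \<open>F\<close>, entrywise.\<close>

definition col_deriv :: "nat \<Rightarrow> (complex \<Rightarrow> cmat2) \<Rightarrow> 2 \<Rightarrow> complex \<Rightarrow> complex^2" where
  "col_deriv j F c k = (\<chi> i. (deriv ^^ j) (\<lambda>z. F z $ i $ c) k)"

definition col_analytic_on :: "(complex \<Rightarrow> cmat2) \<Rightarrow> 2 \<Rightarrow> complex set \<Rightarrow> bool" where
  "col_analytic_on F c S \<longleftrightarrow> (\<forall>i. (\<lambda>z. F z $ i $ c) analytic_on S)"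

definition continuous_extension ::
  "complex set \<Rightarrow> complex set \<Rightarrow> (complex \<Rightarrow> complex^2) \<Rightarrow> (complex \<Rightarrow> complex^2) \<Rightarrow> bool" where
  "continuous_extension D S f g \<longleftrightarrow> D \<subseteq> S \<and> continuous_on S g \<and> (\<forall>k\<in>D. g k = f k)"

definition test_function :: "(real \<Rightarrow> real) \<Rightarrow> bool" where
  "test_function \<phi> \<longleftrightarrow> (\<forall>m. ((deriv ^^ m) \<phi>) differentiable_on UNIV) \<and>
     (\<exists>K. compact K \<and> K \<subseteq> {0<..} \<and> (\<forall>x. x \<notin> K \<longrightarrow> \<phi> x = 0))"

definition locally_integrable :: "(real \<Rightarrow> 'a::euclidean_space) \<Rightarrow> bool" where
  "locally_integrable f \<longleftrightarrow> (\<forall>K. compact K \<and> K \<subseteq> {0<..} \<longrightarrow> f absolutely_integrable_on K)"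

definition has_weak_derivative ::
  "(real \<Rightarrow> 'a::euclidean_space) \<Rightarrow> (real \<Rightarrow> 'a) \<Rightarrow> bool" where
  "has_weak_derivative f f' \<longleftrightarrow> locally_integrable f \<and> locally_integrable f' \<and>
     (\<forall>\<phi>. test_function \<phi> \<longrightarrow>
        integral {0<..} (\<lambda>t. deriv \<phi> t *\<^sub>R f t) = - integral {0<..} (\<lambda>t. \<phi> t *\<^sub>R f' t))"

definition volterra_integrand ::
  "(real \<Rightarrow> real) \<Rightarrow> (real \<Rightarrow> real) \<Rightarrow> (real \<Rightarrow> real) \<Rightarrow> complex \<Rightarrow> (real \<Rightarrow> cmat2) \<Rightarrow> real \<Rightarrow> real \<Rightarrow> cmat2" where
  "volterra_integrand g0 g0t g1 k M t s =
     exp_hat_sigma3 (\<i> * theta2 k * of_real (s - t)) (Vmat g0 g0t g1 s k ** M s)"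

text \<open>
  The equations at a fixed \<open>k\<close>, for \<open>M = T(\<cdot>,k)\<close> resp. \<open>M = U(\<cdot>,k)\<close>. The integrals are
  Lebesgue integrals, whose existence is part of what it means to be a solution. The
  integral from \<open>\<infinity>\<close> to \<open>t\<close> is minus the integral over \<open>[t,\<infinity>)\<close>. Column \<open>c\<close> of
  the integrand depends only on column \<open>c\<close> of \<open>M\<close>, so that \<open>volterra_T\<close> is an
  equation for that column alone.
\<close>

definition volterra_T ::
  "(real \<Rightarrow> real) \<Rightarrow> (real \<Rightarrow> real) \<Rightarrow> (real \<Rightarrow> real) \<Rightarrow> 2 \<Rightarrow> complex \<Rightarrow> (real \<Rightarrow> cmat2) \<Rightarrow> bool" where
  "volterra_T g0 g0t g1 c k M \<longleftrightarrow> (\<forall>t\<ge>0.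
     (\<lambda>s. column c (volterra_integrand g0 g0t g1 k M t s)) absolutely_integrable_on {t..} \<and>
     column c (M t) = column c (mat 1)
       - integral {t..} (\<lambda>s. column c (volterra_integrand g0 g0t g1 k M t s)))"

definition volterra_U ::
  "(real \<Rightarrow> real) \<Rightarrow> (real \<Rightarrow> real) \<Rightarrow> (real \<Rightarrow> real) \<Rightarrow> complex \<Rightarrow> (real \<Rightarrow> cmat2) \<Rightarrow> bool" where
  "volterra_U g0 g0t g1 k M \<longleftrightarrow> (\<forall>t\<ge>0.
     volterra_integrand g0 g0t g1 k M t absolutely_integrable_on {0..t} \<and>
     M t = mat 1 + integral {0..t} (volterra_integrand g0 g0t g1 k M t))"

text \<open>
  The differential equation \<open>M_t + i \<theta>2 [\<sigma>3, M] = V M\<close> at a fixed \<open>k\<close>, for column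
  \<open>c\<close> of \<open>M\<close>, with a weak \<open>t\<close>-derivative.
\<close>

definition weak_solution ::
  "(real \<Rightarrow> real) \<Rightarrow> (real \<Rightarrow> real) \<Rightarrow> (real \<Rightarrow> real) \<Rightarrow> 2 \<Rightarrow> complex \<Rightarrow> (real \<Rightarrow> cmat2) \<Rightarrow> bool" where
  "weak_solution g0 g0t g1 c k M \<longleftrightarrow> (\<exists>M'.
     has_weak_derivative (\<lambda>t. column c (M t)) (\<lambda>t. column c (M' t)) \<and>
     (AE t in lebesgue_on {0<..}.
        column c (M' t + (\<i> * theta2 k) *m (sigma3 ** M t - M t ** sigma3))
          = column c (Vmat g0 g0t g1 t k ** M t)))"

end

theory Submission
  imports Defs "HOL-Complex_Analysis.Complex_Analysis"
begin

text \<open>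
  \<^bold>\<open>Idea of the proof.\<close> Column \<open>c\<close> of either Volterra equation reads
  \<open>X(t) = e\<^sub>c \<plusminus> \<integral> e\<^sup>\<alpha>\<^sup>(\<^sup>s\<^sup>-\<^sup>t\<^sup>) V X ds\<close> with a diagonal matrix \<open>\<alpha>\<close> (\<open>expn\<close>) of which
  one entry vanishes and the other has real part \<open>\<eta> = \<plusminus>2 Im \<theta>\<^sub>2(k)\<close> (\<open>eta\<close>). Let \<open>k \<noteq> 0\<close>. For
  \<open>\<eta> \<le> 0\<close>, which includes the closed domain of the column of \<open>T\<close>, the kernel of the equation from
  \<open>\<infinity>\<close> is dominated by an integrable function \<open>v\<close>, and for every \<open>\<eta>\<close> that of the equation from
  \<open>0\<close> is so up to exponential growth. A supremum norm weighted by a power of \<open>1 + \<integral>v\<close> turns the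
  Volterra operator into a contraction. This gives existence by Picard iteration, locally uniformly
  and holomorphically in \<open>k\<close> (\<open>vsol_exists_holomorphic\<close>), and a Gronwall inequality (\<open>gronwall\<close>).

  The \<open>k\<close>-derivatives of \<open>T\<close> up to the boundary of its domain are obtained without differentiating
  the integral equation. Cut the potential off at the times \<open>2\<^sup>m - 1\<close>. The solution \<open>T\<^sub>m\<close> of the
  cut-off equation is analytic in \<open>k \<noteq> 0\<close>. As the exponentials on \<open>[0, 2\<^sup>m]\<close> are bounded wherever
  \<open>\<eta> \<le> 2\<^sup>-\<^sup>m\<close>, Gronwall's inequality bounds \<open>T\<^sub>m\<^sub>+\<^sub>1 - T\<^sub>m\<close>, uniformly for \<open>|k| \<ge> \<delta>\<close>, by a multiple of
  the mass of \<open>v\<close> on the \<open>m\<close>-th dyadic shell, even at a distance of order \<open>2\<^sup>-\<^sup>m\<close> outside the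
  domain of \<open>T\<close>. Cauchy's inequality on discs of that radius costs a factor \<open>2\<^sup>m\<^sup>j\<close> for the \<open>j\<close>-th
  derivative, which the \<open>n\<close>-th moment of \<open>v\<close> absorbs for \<open>j \<le> n\<close>; the shells before time \<open>t\<close> do
  not contribute, whence the factor \<open>(1 + t)\<^sup>j\<^sup>-\<^sup>n\<close> (\<open>Delta_deriv_bound\<close>). So the series of
  derivatives converges locally uniformly on the closed domain without \<open>0\<close>, and its sum is the
  continuous extension. The estimates for \<open>U\<close> are Cauchy's inequality on discs of radius of order
  \<open>1 / (1 + t)\<close> applied to the Gronwall bound \<open>|U| \<le> C e\<^sup>m\<^sup>a\<^sup>x\<^sup>(\<^sup>0\<^sup>,\<^sup>-\<^sup>\<eta>\<^sup>)\<^sup>t\<close> (\<open>U_deriv_bound\<close>).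

  A solution of the equation from \<open>\<infinity>\<close> is not assumed to be bounded. Integrability of the integrand
  bounds its diagonal component and gives \<open>O(e\<^sup>-\<^sup>\<eta>\<^sup>t)\<close> for the other one; a Gronwall inequality on
  \<open>[t,\<infinity>)\<close> for the latter component alone removes the exponential (\<open>solT_bounded\<close>), and uniqueness
  follows. The symmetries follow from uniqueness. The weak differential equation and the constancy
  of the determinant come from the product rule for indefinite Lebesgue integrals
  (\<open>is_primitive_mult\<close>).
\<close>

no_notation fps_nth (infixl "$" 75)

section \<open>Indefinite Lebesgue integrals\<close>

text \<open>
  \<open>F\<close> is an indefinite integral of the locally integrable \<open>f\<close> on \<open>[0,\<infinity>)\<close>: the absolutely continuous
  functions, with a chosen version of the derivative.
\<close>

definition is_primitive :: "(real \<Rightarrow> 'a::euclidean_space) \<Rightarrow> (real \<Rightarrow> 'a) \<Rightarrow> bool" where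
  "is_primitive F f \<longleftrightarrow>
     (\<forall>t\<ge>0. f absolutely_integrable_on {0..t} \<and> F t = F 0 + integral {0..t} f)"

lemma is_primitive_absolutely_integrable:
  assumes "is_primitive F f" "0 \<le> a"
  shows "f absolutely_integrable_on {a..b}"
proof (cases "a \<le> b")
  case True
  then have "f absolutely_integrable_on {0..b}"
    using assms unfolding is_primitive_def by (meson order_trans)
  then show ?thesis
    by (rule absolutely_integrable_on_subinterval) (use assms in auto)
qed auto

lemma is_primitive_eq:
  assumes "is_primitive F f" "0 \<le> t"
  shows "F t = F 0 + integral {0..t} f"
  using assms unfolding is_primitive_def by blast

lemma is_primitive_integrable:
  assumes "is_primitive F f" "0 \<le> a"
  shows "f integrable_on {a..b}"
  using is_primitive_absolutely_integrable[OF assms] absolutely_integrable_on_def by blast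

lemma is_primitive_diff_eq:
  assumes "is_primitive F f" "0 \<le> a" "a \<le> b"
  shows "F b - F a = integral {a..b} f"
proof -
  have "integral {0..a} f + integral {a..b} f = integral {0..b} f"
    by (rule Henstock_Kurzweil_Integration.integral_combine)
       (use assms is_primitive_integrable[OF assms(1)] in auto)
  moreover have "F a = F 0 + integral {0..a} f" "F b = F 0 + integral {0..b} f"
    using assms by (intro is_primitive_eq; simp)+
  ultimately show ?thesis
    by (simp add: algebra_simps)
qed

lemma continuous_on_atLeastI:
  fixes F :: "real \<Rightarrow> 'a::topological_space"
  assumes "\<And>b. continuous_on {a..b} F"
  shows "continuous_on {a..} F"
  unfolding continuous_on_eq_continuous_within
proof
  fix x assume x: "x \<in> {a..}"
  have "continuous (at x within {a..x+1}) F"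
    using assms[of "x+1"] x by (auto simp: continuous_on_eq_continuous_within)
  moreover have "at x within {a..x+1} = at x within {a..}"
    by (rule at_within_nhd[of x "{..<x+1}"]) auto
  ultimately show "continuous (at x within {a..}) F"
    by simp
qed

lemma is_primitive_continuous:
  assumes "is_primitive F f"
  shows "continuous_on {0..} F"
proof (rule continuous_on_atLeastI)
  fix b :: real
  have "continuous_on {0..b} (\<lambda>t. F 0 + integral {0..t} f)"
    by (intro continuous_intros indefinite_integral_continuous_1 is_primitive_integrable[OF assms]) auto
  then show "continuous_on {0..b} F"
    by (rule continuous_on_eq) (simp add: is_primitive_eq[OF assms, symmetric])
qed

lemma is_primitive_cong:
  assumes "is_primitive F f" "\<And>t. t \<ge> 0 \<Longrightarrow> F t = G t" "\<And>t. t \<ge> 0 \<Longrightarrow> f t = g t"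
  shows "is_primitive G g"
  unfolding is_primitive_def
proof (intro allI impI)
  fix t :: real assume t: "t \<ge> 0"
  have "f absolutely_integrable_on {0..t} \<longleftrightarrow> g absolutely_integrable_on {0..t}"
    by (rule absolutely_integrable_spike_eq[of "{}"]) (use assms in auto)
  moreover have "integral {0..t} f = integral {0..t} g"
    by (rule integral_cong) (use assms in auto)
  ultimately show "g absolutely_integrable_on {0..t} \<and> G t = G 0 + integral {0..t} g"
    using is_primitive_absolutely_integrable[OF assms(1), of 0 t] is_primitive_eq[OF assms(1) t]
      t assms(2)[of t] assms(2)[of 0] by auto
qed

lemma is_primitive_const: "is_primitive (\<lambda>t. c) (\<lambda>t. 0)"
  by (auto simp: is_primitive_def)

lemma is_primitive_add:
  assumes "is_primitive F f" "is_primitive G g"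
  shows "is_primitive (\<lambda>t. F t + G t) (\<lambda>t. f t + g t)"
  unfolding is_primitive_def
proof (intro allI impI conjI)
  fix t :: real assume t: "t \<ge> 0"
  show "(\<lambda>t. f t + g t) absolutely_integrable_on {0..t}"
    using assms t by (intro set_integral_add is_primitive_absolutely_integrable) auto
  have "integral {0..t} (\<lambda>t. f t + g t) = integral {0..t} f + integral {0..t} g"
    using assms by (intro Henstock_Kurzweil_Integration.integral_add is_primitive_integrable) auto
  moreover note is_primitive_eq[OF assms(1) t] is_primitive_eq[OF assms(2) t]
  ultimately show "F t + G t = F 0 + G 0 + integral {0..t} (\<lambda>t. f t + g t)"
    by (simp add: algebra_simps)
qed

lemma is_primitive_linear:
  assumes "is_primitive F f" "bounded_linear h"
  shows "is_primitive (\<lambda>t. h (F t)) (\<lambda>t. h (f t))"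
  unfolding is_primitive_def
proof (intro allI impI conjI)
  fix t :: real assume t: "t \<ge> 0"
  have f: "f absolutely_integrable_on {0..t}"
    by (rule is_primitive_absolutely_integrable[OF assms(1)]) simp
  then show "(\<lambda>t. h (f t)) absolutely_integrable_on {0..t}"
    using absolutely_integrable_linear[OF f assms(2)] by (simp add: o_def)
  have "integral {0..t} (\<lambda>t. h (f t)) = h (integral {0..t} f)"
    using integral_linear[OF is_primitive_integrable[OF assms(1)] assms(2)] by (simp add: o_def)
  moreover have "h (F t) = h (F 0 + integral {0..t} f)"
    using is_primitive_eq[OF assms(1) t] by (rule arg_cong)
  ultimately show "h (F t) = h (F 0) + integral {0..t} (\<lambda>t. h (f t))"
    using assms(2) by (simp add: linear_simps)
qed

lemma is_primitive_C1:
  assumes "\<And>t. t \<ge> 0 \<Longrightarrow> (F has_vector_derivative f t) (at t within {0..})"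
    and "continuous_on {0..} f"
  shows "is_primitive F f"
  unfolding is_primitive_def
proof (intro allI impI conjI)
  fix t :: real assume t: "t \<ge> 0"
  show "f absolutely_integrable_on {0..t}"
    by (intro absolutely_integrable_continuous_real continuous_on_subset[OF assms(2)]) auto
  have "(f has_integral (F t - F 0)) {0..t}"
    by (intro fundamental_theorem_of_calculus t has_vector_derivative_within_subset[OF assms(1)]) auto
  then show "F t = F 0 + integral {0..t} f"
    by (simp add: integral_unique)
qed

text \<open>
  A continuous function is constant when its increments are quadratically small
  against those of a continuous monotone function.
\<close>

lemma eq_if_quadratic_increments:
  fixes D :: "real \<Rightarrow> 'a::real_normed_vector" and P :: "real \<Rightarrow> real"
  assumes "a \<le> b" and P: "continuous_on {a..b} P" "mono_on {a..b} P"
    and D: "\<And>x y. a \<le> x \<Longrightarrow> x \<le> y \<Longrightarrow> y \<le> b \<Longrightarrow> norm (D y - D x) \<le> (P y - P x)\<^sup>2"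
  shows "D b = D a"
proof -
  have "norm (D b - D a) \<le> e * (P b - P a)" if "e > 0" for e
  proof -
    have "uniformly_continuous_on {a..b} P"
      using P by (simp add: compact_uniformly_continuous)
    then obtain d where d: "d > 0"
      "\<And>x y. x \<in> {a..b} \<Longrightarrow> y \<in> {a..b} \<Longrightarrow> dist y x < d \<Longrightarrow> dist (P y) (P x) < e"
      using \<open>e > 0\<close> unfolding uniformly_continuous_on_def by metis
    obtain N :: nat where N: "real N > (b - a) / d"
      using reals_Archimedean2 by blast
    then have N0: "N > 0"
      using \<open>a \<le> b\<close> \<open>d > 0\<close> by (cases N) (auto simp: field_simps)
    define x where "x i = a + real i * ((b - a) / N)" for i
    have x_Suc: "x (Suc i) = x i + (b - a) / N" for i
      by (simp add: x_def distrib_right add_divide_distrib)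
    have step: "(b - a) / N \<ge> 0" "(b - a) / N < d"
      using N N0 \<open>a \<le> b\<close> \<open>d > 0\<close> by (auto simp: field_simps)
    have xN: "x N = b" and x0: "x 0 = a"
      using N0 by (auto simp: x_def)
    have x_in: "x i \<in> {a..b}" if "i \<le> N" for i
    proof -
      have "real i * ((b - a) / N) \<le> real N * ((b - a) / N)"
        using that step by (intro mult_right_mono) auto
      moreover have "0 \<le> real i * ((b - a) / N)"
        by (rule mult_nonneg_nonneg[OF _ step(1)]) simp
      moreover have "real N * ((b - a) / N) = b - a"
        using N0 by simp
      ultimately show ?thesis
        by (auto simp: x_def simp del: times_divide_eq_right)
    qed
    have piece: "norm (D (x (Suc i)) - D (x i)) \<le> e * (P (x (Suc i)) - P (x i))" if "i < N" for i
    proof -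
      have in': "x i \<in> {a..b}" "x (Suc i) \<in> {a..b}"
        using x_in[of i] x_in[of "Suc i"] that by simp_all
      have le: "x i \<le> x (Suc i)"
        unfolding x_Suc using step(1) by linarith
      have "dist (P (x (Suc i))) (P (x i)) < e"
        by (intro d in') (use step in \<open>simp add: x_Suc dist_norm\<close>)
      moreover have "P (x i) \<le> P (x (Suc i))"
        using P(2) in' le by (auto simp: mono_on_def)
      ultimately have "(P (x (Suc i)) - P (x i))\<^sup>2 \<le> e * (P (x (Suc i)) - P (x i))"
        unfolding power2_eq_square by (intro mult_right_mono) (auto simp: dist_norm)
      moreover have "norm (D (x (Suc i)) - D (x i)) \<le> (P (x (Suc i)) - P (x i))\<^sup>2"
        using in' le by (intro D) auto
      ultimately show ?thesis
        by linarith
    qed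
    have "norm (D b - D a) = norm (\<Sum>i<N. D (x (Suc i)) - D (x i))"
      using sum_lessThan_telescope[of "\<lambda>i. D (x i)" N] by (simp add: xN x0)
    also have "\<dots> \<le> (\<Sum>i<N. e * (P (x (Suc i)) - P (x i)))"
      by (intro order.trans[OF norm_sum] sum_mono piece) auto
    also have "\<dots> = e * (P b - P a)"
      using sum_lessThan_telescope[of "\<lambda>i. P (x i)" N] by (simp add: sum_distrib_left[symmetric] xN x0)
    finally show ?thesis .
  qed
  moreover have "P b - P a \<ge> 0"
    using P(2) \<open>a \<le> b\<close> by (auto simp: mono_on_def)
  ultimately have "norm (D b - D a) \<le> e" if "e > 0" for e
  proof -
    have "norm (D b - D a) \<le> e / (P b - P a + 1) * (P b - P a)"
      using \<open>P b - P a \<ge> 0\<close> that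
        \<open>\<And>e. e > 0 \<Longrightarrow> norm (D b - D a) \<le> e * (P b - P a)\<close>[of "e / (P b - P a + 1)"] by simp
    also have "\<dots> \<le> e"
      using \<open>P b - P a \<ge> 0\<close> that by (simp add: field_simps)
    finally show ?thesis .
  qed
  then show ?thesis
    using field_le_epsilon[of "norm (D b - D a)" 0] by simp
qed

lemma absolutely_integrable_mult_continuous:
  fixes p H :: "real \<Rightarrow> 'a::{euclidean_space, real_normed_field}"
  assumes p: "p absolutely_integrable_on {a..b}" and H: "continuous_on {a..b} H"
  shows "(\<lambda>t. p t * H t) absolutely_integrable_on {a..b}"
proof -
  have bdd: "bounded (H ` {a..b})"
    by (intro compact_imp_bounded compact_continuous_image H compact_Icc)
  have meas: "H \<in> borel_measurable (lebesgue_on {a..b})"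
    by (rule continuous_imp_measurable_on_sets_lebesgue[OF H]) simp
  have "bilinear (\<lambda>x y::'a. y * x)"
    unfolding bilinear_conv_bounded_bilinear
    by (rule bounded_bilinear.flip[OF bounded_bilinear_mult])
  then have "(\<lambda>t. (\<lambda>x y. y * x) (H t) (p t)) absolutely_integrable_on {a..b}"
    by (rule absolutely_integrable_bounded_measurable_product[OF _ meas _ bdd p]) simp
  then show ?thesis by simp
qed

text \<open>
  The product rule. The error \<open>FG(y) - FG(x) - \<integral>(fG + Fg)\<close> over \<open>[x,y]\<close> is additive in the
  interval and at most \<open>2 \<integral>|f| \<integral>|g|\<close>, hence zero.
\<close>

lemma is_primitive_mult:
  fixes F G :: "real \<Rightarrow> 'a::{euclidean_space, real_normed_field}"
  assumes F: "is_primitive F f" and G: "is_primitive G g"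
  shows "is_primitive (\<lambda>t. F t * G t) (\<lambda>t. f t * G t + F t * g t)"
proof -
  let ?h = "\<lambda>t. f t * G t + F t * g t"
  have cF: "continuous_on {0..} F" and cG: "continuous_on {0..} G"
    using F G by (auto intro: is_primitive_continuous)
  have fG: "(\<lambda>t. f t * (G t - c)) absolutely_integrable_on {a..b}" if "0 \<le> a" for a b c
    using that
    by (intro absolutely_integrable_mult_continuous continuous_on_diff continuous_on_const
        continuous_on_subset[OF cG] is_primitive_absolutely_integrable[OF F]) auto
  have gF: "(\<lambda>t. g t * (F t - c)) absolutely_integrable_on {a..b}" if "0 \<le> a" for a b c
    using that
    by (intro absolutely_integrable_mult_continuous continuous_on_diff continuous_on_const
        continuous_on_subset[OF cF] is_primitive_absolutely_integrable[OF G]) auto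
  have h_ai: "?h absolutely_integrable_on {a..b}" if "0 \<le> a" for a b
    using set_integral_add(1)[OF fG[OF that, where c=0 and b=b] gF[OF that, where c=0 and b=b]]
    by (simp add: mult.commute)
  have h_int: "?h integrable_on {a..b}" if "0 \<le> a" for a b
    using h_ai[OF that] absolutely_integrable_on_def by blast
  show ?thesis
    unfolding is_primitive_def
  proof (intro allI impI conjI h_ai)
    fix T :: real assume T: "T \<ge> 0"
    define P where "P t = integral {0..t} (\<lambda>s. norm (f s) + norm (g s))" for t
    have nf: "(\<lambda>s. norm (f s)) integrable_on {a..b}" and ng: "(\<lambda>s. norm (g s)) integrable_on {a..b}"
      if "0 \<le> a" for a b
      using is_primitive_absolutely_integrable[OF F that] is_primitive_absolutely_integrable[OF G that]
      by (auto simp: absolutely_integrable_on_def)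
    have P_diff: "P y - P x = integral {x..y} (\<lambda>s. norm (f s)) + integral {x..y} (\<lambda>s. norm (g s))"
      if "0 \<le> x" "x \<le> y" for x y
    proof -
      have "integral {0..x} (\<lambda>s. norm (f s) + norm (g s)) + integral {x..y} (\<lambda>s. norm (f s) + norm (g s)) =
        integral {0..y} (\<lambda>s. norm (f s) + norm (g s))"
        by (intro Henstock_Kurzweil_Integration.integral_combine)
           (use that in \<open>auto intro!: integrable_add nf ng\<close>)
      moreover have "integral {x..y} (\<lambda>s. norm (f s) + norm (g s)) =
         integral {x..y} (\<lambda>s. norm (f s)) + integral {x..y} (\<lambda>s. norm (g s))"
        by (intro Henstock_Kurzweil_Integration.integral_add nf ng that)
      ultimately show ?thesis
        by (simp add: P_def)
    qed
    define D where "D t = F t * G t - integral {0..t} ?h" for t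
    have "D T = D 0"
    proof (rule eq_if_quadratic_increments[OF T, where P = P])
      show "continuous_on {0..T} P"
        unfolding P_def by (intro indefinite_integral_continuous_1 integrable_add nf ng) auto
      show "mono_on {0..T} P"
      proof (rule mono_onI)
        fix x y assume "x \<in> {0..T}" "y \<in> {0..T}" "x \<le> y"
        then show "P x \<le> P y"
          using P_diff[of x y] integral_nonneg[OF nf[of x y]] integral_nonneg[OF ng[of x y]] by auto
      qed
      fix x y assume xy: "0 \<le> x" "x \<le> y" "y \<le> T"
      let ?If = "integral {x..y} (\<lambda>s. norm (f s))" and ?Ig = "integral {x..y} (\<lambda>s. norm (g s))"
      have pos: "?If \<ge> 0" "?Ig \<ge> 0"
        by (auto intro!: integral_nonneg nf ng xy)
      have osc: "norm (H s - H r) \<le> integral {x..y} (\<lambda>s. norm (h s))"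
        if "is_primitive H h" "(\<lambda>s. norm (h s)) integrable_on {x..y}" "x \<le> r" "r \<le> s" "s \<le> y"
        for H h :: "real \<Rightarrow> 'a" and r s
      proof -
        have sub: "(\<lambda>s. norm (h s)) integrable_on {r..s}"
          by (rule integrable_subinterval_real[OF that(2)]) (use that in auto)
        have "norm (H s - H r) = norm (integral {r..s} h)"
          using is_primitive_diff_eq[OF that(1), of r s] that xy by simp
        also have "\<dots> \<le> integral {r..s} (\<lambda>s. norm (h s))"
          using is_primitive_absolutely_integrable[OF that(1), of r s] that xy
          by (intro Henstock_Kurzweil_Integration.integral_norm_bound_integral sub)
             (auto simp: absolutely_integrable_on_def)
        also have "\<dots> \<le> integral {x..y} (\<lambda>s. norm (h s))"
          using that by (intro integral_subset_le sub) auto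
        finally show ?thesis .
      qed
      have "integral {0..x} ?h + integral {x..y} ?h = integral {0..y} ?h"
        by (intro Henstock_Kurzweil_Integration.integral_combine h_int) (use xy in auto)
      then have "D y - D x = (F y - F x) * G x + F y * (G y - G x) - integral {x..y} ?h"
        by (simp add: D_def algebra_simps)
      also have "integral {x..y} ?h = integral {x..y} (\<lambda>s. (f s * G x + F y * g s) +
          (f s * (G s - G x) + g s * (F s - F y)))"
        by (simp add: algebra_simps)
      also have "\<dots> = integral {x..y} (\<lambda>s. f s * G x + F y * g s) +
          integral {x..y} (\<lambda>s. f s * (G s - G x) + g s * (F s - F y))"
        using xy fG[of x y "G x"] gF[of x y "F y"] is_primitive_integrable[OF F, of x y]
          is_primitive_integrable[OF G, of x y]
        by (intro Henstock_Kurzweil_Integration.integral_add integrable_add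
            integrable_on_mult_right integrable_on_mult_left)
           (auto simp: absolutely_integrable_on_def)
      also have "integral {x..y} (\<lambda>s. f s * G x + F y * g s) = (F y - F x) * G x + F y * (G y - G x)"
        using xy is_primitive_integrable[OF F, of x y] is_primitive_integrable[OF G, of x y]
        by (subst Henstock_Kurzweil_Integration.integral_add)
           (auto intro!: integrable_on_mult_right integrable_on_mult_left
             simp: is_primitive_diff_eq[OF F] is_primitive_diff_eq[OF G])
      finally have "norm (D y - D x) = norm (integral {x..y} (\<lambda>s. f s * (G s - G x) + g s * (F s - F y)))"
        by simp
      also have "\<dots> \<le> integral {x..y} (\<lambda>s. norm (f s) * ?Ig + norm (g s) * ?If)"
      proof (intro Henstock_Kurzweil_Integration.integral_norm_bound_integral)
        show "(\<lambda>s. f s * (G s - G x) + g s * (F s - F y)) integrable_on {x..y}"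
          using xy fG[of x y "G x"] gF[of x y "F y"]
          by (intro integrable_add) (auto simp: absolutely_integrable_on_def)
        show "(\<lambda>s. norm (f s) * ?Ig + norm (g s) * ?If) integrable_on {x..y}"
          by (intro integrable_add integrable_on_mult_left nf ng xy)
        fix s assume s: "s \<in> {x..y}"
        have "norm (G s - G x) \<le> ?Ig"
          using s by (intro osc G ng xy) auto
        moreover have "norm (F y - F s) \<le> ?If"
          using s by (intro osc F nf xy) auto
        ultimately show "norm (f s * (G s - G x) + g s * (F s - F y))
            \<le> norm (f s) * ?Ig + norm (g s) * ?If"
          by (intro order.trans[OF norm_triangle_ineq] add_mono)
             (simp_all only: norm_mult norm_minus_commute[of "F s"] mult_left_mono norm_ge_zero)
      qed
      also have "\<dots> = ?If * ?Ig + ?Ig * ?If"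
        by (subst Henstock_Kurzweil_Integration.integral_add)
           (auto intro!: integrable_on_mult_left nf ng xy)
      also have "\<dots> \<le> (?If + ?Ig)\<^sup>2"
        by (simp add: power2_sum)
      also have "\<dots> = (P y - P x)\<^sup>2"
        using P_diff xy by simp
      finally show "norm (D y - D x) \<le> (P y - P x)\<^sup>2" .
    qed
    then show "F T * G T = F 0 * G 0 + integral {0..T} ?h"
      by (simp add: D_def algebra_simps)
  qed auto
qed

lemma is_primitive_power:
  fixes F :: "real \<Rightarrow> 'a::{euclidean_space, real_normed_field}"
  assumes "is_primitive F f"
  shows "is_primitive (\<lambda>t. F t ^ n) (\<lambda>t. of_nat n * F t ^ (n - 1) * f t)"
proof (induction n)
  case 0
  show ?case using is_primitive_const[of 1] by simp
next
  case (Suc n)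
  show ?case
  proof (rule is_primitive_cong[OF is_primitive_mult[OF assms Suc]])
    fix t :: real
    show "f t * F t ^ n + F t * (of_nat n * F t ^ (n - 1) * f t)
        = of_nat (Suc n) * F t ^ (Suc n - 1) * f t"
      by (cases n) (simp_all add: algebra_simps)
  qed simp
qed

section \<open>Integrals over half-lines and with parameters\<close>

lemma absolutely_integrable_on_vec_iff:
  fixes f :: "real \<Rightarrow> 'a::euclidean_space^'n"
  shows "f absolutely_integrable_on S \<longleftrightarrow> (\<forall>i. (\<lambda>s. f s $ i) absolutely_integrable_on S)"
proof
  assume "f absolutely_integrable_on S"
  then show "\<forall>i. (\<lambda>s. f s $ i) absolutely_integrable_on S"
    using absolutely_integrable_linear[OF _ bounded_linear_vec_nth] by (auto simp: o_def)
next
  assume *: "\<forall>i. (\<lambda>s. f s $ i) absolutely_integrable_on S"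
  have "bounded_linear (axis i :: 'a \<Rightarrow> 'a^'n)" for i
    by (rule bounded_linearI'[where 'b="'a^'n"])
       (auto simp: axis_def vec_eq_iff)
  then have "(\<lambda>s. axis i (f s $ i) :: 'a^'n) absolutely_integrable_on S" for i
    using absolutely_integrable_linear[OF *[rule_format, of i], of "axis i :: 'a \<Rightarrow> 'a^'n"]
    by (simp add: o_def)
  then have "(\<lambda>s. \<Sum>i\<in>UNIV. axis i (f s $ i) :: 'a^'n) absolutely_integrable_on S"
    by (intro absolutely_integrable_sum) auto
  moreover have "(\<Sum>i\<in>UNIV. axis i (f s $ i)) = f s" for s
    by (auto simp: vec_eq_iff axis_def sum.delta if_distrib cong: if_cong)
  ultimately show "f absolutely_integrable_on S"
    by simp
qed

lemma integral_vec_nth: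
  fixes f :: "real \<Rightarrow> 'a::euclidean_space^'n"
  assumes "f absolutely_integrable_on S"
  shows "integral S f $ i = integral S (\<lambda>s. f s $ i)"
  using integral_linear[OF _ bounded_linear_vec_nth, of f S i] assms
  by (simp add: o_def absolutely_integrable_on_def)

lemma norm_vec_le_sum: "norm x \<le> (\<Sum>i\<in>UNIV. norm (x $ i))"
  unfolding norm_vec_def by (rule L2_set_le_sum) auto

lemma integral_atLeast_split:
  fixes h :: "real \<Rightarrow> 'a::euclidean_space"
  assumes "h absolutely_integrable_on {a..}" "a \<le> t"
  shows "integral {a..} h = integral {a..t} h + integral {t..} h"
proof -
  have "h absolutely_integrable_on {a..t}" "h absolutely_integrable_on {t..}"
    using assms by (auto intro: set_integrable_subset)
  then have "(h has_integral (integral {a..t} h + integral {t..} h)) ({a..t} \<union> {t..})"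
    by (intro has_integral_Un) 
       (use assms(2) in \<open>auto simp: absolutely_integrable_on_def has_integral_integral[symmetric]
          intro: negligible_subset[of "{t}"]\<close>)
  moreover have "{a..t} \<union> {t..} = {a..}"
    using assms(2) by auto
  ultimately show ?thesis
    by (simp add: integral_unique)
qed

lemma tendsto_integral_atLeast:
  fixes h :: "real \<Rightarrow> 'a::euclidean_space"
  assumes "h absolutely_integrable_on {a..}"
  shows "((\<lambda>b. integral {a..b} h) \<longlongrightarrow> integral {a..} h) at_top"
proof -
  have sub: "h absolutely_integrable_on {a..b}" for b
    using assms by (rule set_integrable_subset) auto
  have "((\<lambda>b. LINT x:{a..b}|lebesgue. h x) \<longlongrightarrow> (LINT x:{a..}|lebesgue. h x)) at_top"
    by (intro tendsto_set_lebesgue_integral_at_top assms) auto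
  then show ?thesis
    using set_lebesgue_integral_eq_integral(2)[OF assms] set_lebesgue_integral_eq_integral(2)[OF sub]
    by simp
qed

lemma holomorphic_on_integral:
  fixes f :: "real \<Rightarrow> complex \<Rightarrow> complex"
  assumes S: "open S" and A: "A \<in> sets lebesgue"
    and meas: "\<And>z. z \<in> S \<Longrightarrow> (\<lambda>s. f s z) \<in> borel_measurable (lebesgue_on A)"
    and holo: "\<And>s. s \<in> A \<Longrightarrow> f s holomorphic_on S"
    and bound: "\<And>s z. s \<in> A \<Longrightarrow> z \<in> S \<Longrightarrow> norm (f s z) \<le> g s"
    and g: "g integrable_on A"
  shows "(\<lambda>z. integral A (\<lambda>s. f s z)) holomorphic_on S"
proof (rule holomorphic_onI)
  fix z assume z: "z \<in> S"
  obtain r0 where r0: "r0 > 0" "cball z r0 \<subseteq> S"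
    using S z by (auto simp: open_contains_cball)
  define r where "r = r0 / 2"
  have r: "r > 0" using r0 by (simp add: r_def)
  have sub: "cball w r \<subseteq> S" if "w \<in> ball z r" for w
  proof
    fix u assume "u \<in> cball w r"
    then have "dist z u \<le> r0"
      using that dist_triangle[of z u w] by (simp add: r_def dist_commute)
    then show "u \<in> S"
      using r0 by auto
  qed
  have ball_sub: "w \<in> S" if "w \<in> ball z r" for w
    using sub[OF that] r by auto
  have int: "(\<lambda>s. f s w) integrable_on A" if "w \<in> S" for w
    by (rule measurable_bounded_by_integrable_imp_integrable[OF meas[OF that] g bound[OF _ that] A])
  have deriv_bound: "norm (deriv (f s) w) \<le> g s / r" if "s \<in> A" "w \<in> ball z r" for s w
  proof -
    have "norm ((deriv ^^ 1) (f s) w) \<le> fact 1 * g s / r ^ 1"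
    proof (rule Cauchy_inequality)
      show "f s holomorphic_on ball w r" "continuous_on (cball w r) (f s)"
        using sub[OF that(2)] ball_subset_cball[of w r]
        by (meson holo[OF that(1)] holomorphic_on_subset holomorphic_on_imp_continuous_on subset_trans)+
      fix x assume "norm (w - x) = r"
      then have "x \<in> cball w r" by (simp add: dist_norm)
      then show "norm (f s x) \<le> g s"
        using sub[OF that(2)] that bound by auto
    qed (rule r)
    then show ?thesis by simp
  qed
  have lip: "norm (f s w - f s z) \<le> g s / r * norm (w - z)" if "s \<in> A" "w \<in> ball z r" for s w
  proof (rule field_differentiable_bound[of "ball z r" "f s" "deriv (f s)"])
    fix u assume u: "u \<in> ball z r"
    have "(f s has_field_derivative deriv (f s) u) (at u)"
      by (rule holomorphic_derivI[OF holo[OF that(1)] S ball_sub[OF u]])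
    then show "(f s has_field_derivative deriv (f s) u) (at u within ball z r)"
      by (rule has_field_derivative_at_within)
    show "norm (deriv (f s) u) \<le> g s / r"
      by (rule deriv_bound[OF that(1) u])
  qed (use that r in auto)
  have "((\<lambda>z. integral A (\<lambda>s. f s z)) has_field_derivative integral A (\<lambda>s. deriv (f s) z))
          (at z within ball z r)"
    unfolding has_field_derivative_iff tendsto_at_iff_sequentially
  proof (intro allI impI)
    fix X :: "nat \<Rightarrow> complex"
    assume X: "\<forall>i. X i \<in> ball z r - {z}" "X \<longlonglongrightarrow> z"
    have Xne: "X n - z \<noteq> 0" for n using X(1) by auto
    have XS: "X n \<in> S" for n using X(1) ball_sub by auto
    have "(\<lambda>n. integral A (\<lambda>s. (f s (X n) - f s z) / (X n - z))) \<longlonglongrightarrow> integral A (\<lambda>s. deriv (f s) z)"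
    proof (rule dominated_convergence(2))
      fix n
      show "(\<lambda>s. (f s (X n) - f s z) / (X n - z)) integrable_on A"
        by (intro integrable_on_divide Henstock_Kurzweil_Integration.integrable_diff int XS z)
      show "(\<lambda>s. g s / r) integrable_on A"
        using g by (rule integrable_on_divide)
      fix s assume s: "s \<in> A"
      show "norm ((f s (X n) - f s z) / (X n - z)) \<le> g s / r"
      proof -
        have "norm (f s (X n) - f s z) \<le> g s / r * norm (X n - z)"
          using X(1) s by (intro lip) auto
        then show ?thesis
          using Xne[of n] by (simp add: norm_divide pos_divide_le_eq)
      qed
    next
      fix s assume s: "s \<in> A"
      have "(f s has_field_derivative deriv (f s) z) (at z)"
        by (rule holomorphic_derivI[OF holo[OF s] S z])
      then have "((\<lambda>w. (f s w - f s z) / (w - z)) \<longlongrightarrow> deriv (f s) z) (at z)"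
        by (simp add: has_field_derivative_iff)
      moreover have "filterlim X (at z) sequentially"
        using X Xne by (auto simp: filterlim_at)
      ultimately show "(\<lambda>n. (f s (X n) - f s z) / (X n - z)) \<longlonglongrightarrow> deriv (f s) z"
        by (rule filterlim_compose)
    qed
    moreover have "integral A (\<lambda>s. (f s (X n) - f s z) / (X n - z)) =
       (integral A (\<lambda>s. f s (X n)) - integral A (\<lambda>s. f s z)) / (X n - z)" for n
      using int[OF XS, of n] int[OF z]
      by (simp add: integral_divide Henstock_Kurzweil_Integration.integral_diff)
    ultimately show "((\<lambda>y. (integral A (\<lambda>s. f s y) - integral A (\<lambda>s. f s z)) / (y - z)) \<circ> X)
        \<longlonglongrightarrow> integral A (\<lambda>s. deriv (f s) z)"
      by (simp only: o_def)
  qed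
  then show "(\<lambda>z. integral A (\<lambda>s. f s z)) field_differentiable at z within S"
    unfolding field_differentiable_def
    using r at_within_open[of z "ball z r"] has_field_derivative_at_within by fastforce
qed

lemma geometric_increments_limit:
  fixes P :: "nat \<Rightarrow> 'a::banach"
  assumes "\<And>m. norm (P (Suc m) - P m) \<le> (1/2) ^ Suc m * K"
  obtains x where "P \<longlonglongrightarrow> x" "\<And>m. norm (x - P m) \<le> (1/2) ^ m * K"
proof -
  have geo: "summable (\<lambda>k. (1/2::real) ^ Suc (k + m) * K)" for m
    using summable_mult2[OF summable_mult[OF summable_geometric[of "1/2::real"]], of "(1/2) ^ Suc m" K]
    by (simp add: power_add mult_ac)
  have sum1: "summable (\<lambda>k. P (Suc k) - P k)"
    by (rule summable_comparison_test[OF _ geo[of 0]]) (use assms in auto)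
  define x where "x = P 0 + (\<Sum>k. P (Suc k) - P k)"
  have "(\<lambda>n. P 0 + (\<Sum>k<n. P (Suc k) - P k)) \<longlonglongrightarrow> x"
    unfolding x_def by (intro tendsto_intros summable_LIMSEQ sum1)
  then have lim: "P \<longlonglongrightarrow> x"
    by (simp add: sum_lessThan_telescope)
  moreover have "norm (x - P m) \<le> (1/2) ^ m * K" for m
  proof -
    have shift: "(\<lambda>k. P (k + m)) \<longlonglongrightarrow> x"
      using lim by (rule LIMSEQ_ignore_initial_segment)
    have dist_le: "norm (P (k + m) - P m) \<le> ((1/2) ^ m - (1/2) ^ (k + m)) * K" for k
    proof (induction k)
      case (Suc k)
      have "norm (P (Suc k + m) - P m) \<le> norm (P (Suc (k + m)) - P (k + m)) + norm (P (k + m) - P m)"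
        using norm_triangle_ineq[of "P (Suc (k + m)) - P (k + m)" "P (k + m) - P m"] by simp
      also have "\<dots> \<le> (1/2) ^ Suc (k + m) * K + ((1/2) ^ m - (1/2) ^ (k + m)) * K"
        by (intro add_mono assms Suc)
      also have "\<dots> = ((1/2) ^ m - (1/2) ^ (Suc k + m)) * K"
        by (simp add: algebra_simps)
      finally show ?case .
    qed simp
    have K: "K \<ge> 0"
      using order.trans[OF norm_ge_zero assms[of 0]] by simp
    have "norm (P (k + m) - P m) \<le> (1/2) ^ m * K" for k
      using dist_le[of k] K by (simp add: algebra_simps) (smt (verit) mult_nonneg_nonneg zero_le_power divide_nonneg_nonneg)
    moreover have "(\<lambda>k. norm (P (k + m) - P m)) \<longlonglongrightarrow> norm (x - P m)"
      by (intro tendsto_intros shift)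
    ultimately show ?thesis
      by (intro LIMSEQ_le_const2) auto
  qed
  ultimately show ?thesis
    by (rule that)
qed

section \<open>Volterra equations with an integrable kernel\<close>

text \<open>
  The integral over \<open>J t\<close> runs from \<open>0\<close> to \<open>t\<close> or from \<open>t\<close> to \<open>\<infinity>\<close>; \<open>\<sigma>\<close> is the sign that comes out
  when it is differentiated in \<open>t\<close>.
\<close>

definition direction :: "(real \<Rightarrow> real set) \<Rightarrow> complex \<Rightarrow> bool" where
  "direction J \<sigma> \<longleftrightarrow> J = (\<lambda>t. {0..t}) \<and> \<sigma> = 1 \<or> J = (\<lambda>t. {t..}) \<and> \<sigma> = -1"

lemma direction_forward: "direction (\<lambda>t. {0..t}) 1"
  and direction_backward: "direction (\<lambda>t. {t..}) (-1)"
  by (auto simp: direction_def)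

lemma direction_nonneg: "direction J \<sigma> \<Longrightarrow> 0 \<le> t \<Longrightarrow> s \<in> J t \<Longrightarrow> 0 \<le> s"
  by (auto simp: direction_def)

lemma direction_subset: "direction J \<sigma> \<Longrightarrow> 0 \<le> t \<Longrightarrow> J t \<subseteq> {0..}"
  by (auto simp: direction_def)

lemma direction_sets: "direction J \<sigma> \<Longrightarrow> J t \<in> sets lebesgue"
  by (auto simp: direction_def)

lemma is_primitive_direction:
  fixes f :: "real \<Rightarrow> complex"
  assumes J: "direction J \<sigma>" and f: "\<And>t. t \<ge> 0 \<Longrightarrow> f absolutely_integrable_on J t"
  shows "is_primitive (\<lambda>t. integral (J t) f) (\<lambda>t. \<sigma> * f t)"
  using J unfolding direction_def
proof
  assume fwd: "J = (\<lambda>t. {0..t}) \<and> \<sigma> = 1"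
  then show ?thesis
    using f by (simp add: is_primitive_def)
next
  assume bwd: "J = (\<lambda>t. {t..}) \<and> \<sigma> = -1"
  have f0: "f absolutely_integrable_on {0..}"
    using f[of 0] bwd by simp
  show ?thesis
    unfolding is_primitive_def
  proof (intro allI impI conjI)
    fix t :: real assume t: "t \<ge> 0"
    have ft: "f absolutely_integrable_on {0..t}"
      using f0 by (rule set_integrable_subset) auto
    then show "(\<lambda>t. \<sigma> * f t) absolutely_integrable_on {0..t}"
      by (rule set_integrable_mult_right)
    show "integral (J t) f = integral (J 0) f + integral {0..t} (\<lambda>t. \<sigma> * f t)"
      using bwd integral_atLeast_split[OF f0 t] by simp
  qed
qed

lemma is_primitive_exp_direction:
  fixes h :: "real \<Rightarrow> complex" and \<alpha> :: complex
  assumes J: "direction J \<sigma>"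
    and h: "\<And>t. t \<ge> 0 \<Longrightarrow> (\<lambda>s. exp (\<alpha> * of_real (s - t)) * h s) absolutely_integrable_on J t"
  defines "Y \<equiv> \<lambda>t. integral (J t) (\<lambda>s. exp (\<alpha> * of_real (s - t)) * h s)"
  shows "is_primitive Y (\<lambda>t. \<sigma> * h t - \<alpha> * Y t)"
proof -
  let ?f = "\<lambda>s. exp (\<alpha> * of_real s) * h s"
  have split: "exp (\<alpha> * of_real (s - t)) = exp (- \<alpha> * of_real t) * exp (\<alpha> * of_real s)" for s t :: real
    by (simp add: exp_add[symmetric] algebra_simps)
  have f: "?f absolutely_integrable_on J t" if "t \<ge> 0" for t
  proof -
    have "(\<lambda>s. exp (\<alpha> * of_real t) * (exp (\<alpha> * of_real (s - t)) * h s)) absolutely_integrable_on J t"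
      by (intro set_integrable_mult_right h that)
    moreover have "exp (\<alpha> * of_real t) * (exp (\<alpha> * of_real (s - t)) * h s) = ?f s" for s
      by (simp only: split) (simp add: exp_minus)
    ultimately show ?thesis by (simp only:)
  qed
  have "is_primitive (\<lambda>t. exp (- \<alpha> * of_real t)) (\<lambda>t. - \<alpha> * exp (- \<alpha> * of_real t))"
  proof (rule is_primitive_C1)
    fix t :: real
    show "((\<lambda>t. exp (- \<alpha> * of_real t)) has_vector_derivative - \<alpha> * exp (- \<alpha> * of_real t)) (at t within {0..})"
      by (rule has_vector_derivative_real_field) (auto intro!: derivative_eq_intros)
  qed (intro continuous_intros)
  from is_primitive_mult[OF this is_primitive_direction[OF J f]]
  have *: "is_primitive (\<lambda>t. exp (- \<alpha> * of_real t) * integral (J t) ?f)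
     (\<lambda>t. - \<alpha> * exp (- \<alpha> * of_real t) * integral (J t) ?f + exp (- \<alpha> * of_real t) * (\<sigma> * ?f t))"
    by simp
  have Y: "Y t = exp (- \<alpha> * of_real t) * integral (J t) ?f" for t
    unfolding Y_def by (simp only: split mult.assoc integral_mult_right)
  show ?thesis
    by (rule is_primitive_cong[OF *]) (simp_all add: Y exp_minus field_simps)
qed

text \<open>
  One step of the evolution: the vector \<open>W s x\<close>, transported from time \<open>s\<close> to time \<open>t\<close> by the
  diagonal flow with exponents \<open>\<alpha>\<close>.
\<close>

definition vker :: "complex^'n \<Rightarrow> (real \<Rightarrow> complex^'n^'n) \<Rightarrow> real \<Rightarrow> real \<Rightarrow> complex^'n \<Rightarrow> complex^'n" where
  "vker \<alpha> W t s x = (\<chi> i. exp (\<alpha> $ i * of_real (s - t)) * (W s *v x) $ i)"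

text \<open>
  The Volterra equation with inhomogeneity \<open>a\<close>. As in the equations to be solved, the integrals
  are Lebesgue integrals and their existence is required.
\<close>

definition vsol :: "(real \<Rightarrow> real set) \<Rightarrow> complex^'n \<Rightarrow> complex^'n \<Rightarrow> (real \<Rightarrow> complex^'n^'n) \<Rightarrow>
    (real \<Rightarrow> complex^'n) \<Rightarrow> bool" where
  "vsol J a \<alpha> W X \<longleftrightarrow> (\<forall>t\<ge>0. (\<lambda>s. vker \<alpha> W t s (X s)) absolutely_integrable_on J t \<and>
      X t = a + integral (J t) (\<lambda>s. vker \<alpha> W t s (X s)))"

lemma vker_diff: "vker \<alpha> W t s (x - y) = vker \<alpha> W t s x - vker \<alpha> W t s y"
  by (simp add: vker_def vec_eq_iff matrix_vector_mult_diff_distrib algebra_simps)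

lemma is_primitive_vker:
  assumes J: "direction J \<sigma>"
    and int: "\<And>t. t \<ge> 0 \<Longrightarrow> (\<lambda>s. vker \<alpha> W t s (X s)) absolutely_integrable_on J t"
  defines "Y \<equiv> \<lambda>t. integral (J t) (\<lambda>s. vker \<alpha> W t s (X s))"
  shows "is_primitive (\<lambda>t. Y t $ i) (\<lambda>t. \<sigma> * (W t *v X t) $ i - \<alpha> $ i * Y t $ i)"
proof -
  have comp: "(\<lambda>s. exp (\<alpha> $ i * of_real (s - t)) * (W s *v X s) $ i) absolutely_integrable_on J t"
    if "t \<ge> 0" for t
    using int[OF that] unfolding absolutely_integrable_on_vec_iff vker_def by simp
  have Y: "Y t $ i = integral (J t) (\<lambda>s. exp (\<alpha> $ i * of_real (s - t)) * (W s *v X s) $ i)"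
    if "t \<ge> 0" for t
    unfolding Y_def using integral_vec_nth[OF int[OF that], of i] by (simp add: vker_def)
  show ?thesis
    by (rule is_primitive_cong[OF is_primitive_exp_direction[OF J comp]]) (simp_all add: Y)
qed

lemma continuous_on_vec_iff:
  fixes f :: "'a::topological_space \<Rightarrow> complex^'n"
  shows "continuous_on S f \<longleftrightarrow> (\<forall>i. continuous_on S (\<lambda>x. f x $ i))"
  by (auto intro: continuous_on_component continuous_on_vec_lambda[of S "\<lambda>i x. f x $ i", simplified])

lemma continuous_on_vker_integral:
  assumes "direction J \<sigma>"
    and "\<And>t. t \<ge> 0 \<Longrightarrow> (\<lambda>s. vker \<alpha> W t s (X s)) absolutely_integrable_on J t"
  shows "continuous_on {0..} (\<lambda>t. integral (J t) (\<lambda>s. vker \<alpha> W t s (X s)))"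
  unfolding continuous_on_vec_iff
  using is_primitive_continuous[OF is_primitive_vker[OF assms]] by blast

lemma vsol_continuous:
  assumes J: "direction J \<sigma>" and X: "vsol J a \<alpha> W X"
  shows "continuous_on {0..} X"
proof -
  have "continuous_on {0..} (\<lambda>t. a + integral (J t) (\<lambda>s. vker \<alpha> W t s (X s)))"
    using X by (intro continuous_intros continuous_on_vker_integral[OF J]) (auto simp: vsol_def)
  then show ?thesis
    by (rule continuous_on_eq) (use X in \<open>simp add: vsol_def\<close>)
qed

text \<open>
  The differential equation behind the integral equation, in integrated form. The hypothesis on
  \<open>a\<close> says that the diagonal flow leaves the inhomogeneity fixed.
\<close>

lemma vsol_is_primitive:
  assumes J: "direction J \<sigma>" and X: "vsol J a \<alpha> W X" and a: "\<alpha> $ i * a $ i = 0"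
  shows "is_primitive (\<lambda>t. X t $ i) (\<lambda>t. \<sigma> * (W t *v X t) $ i - \<alpha> $ i * X t $ i)"
proof -
  have "is_primitive (\<lambda>t. integral (J t) (\<lambda>s. vker \<alpha> W t s (X s)) $ i)
     (\<lambda>t. \<sigma> * (W t *v X t) $ i - \<alpha> $ i * integral (J t) (\<lambda>s. vker \<alpha> W t s (X s)) $ i)"
    by (rule is_primitive_vker[OF J]) (use X in \<open>auto simp: vsol_def\<close>)
  from is_primitive_add[OF is_primitive_const[of "a $ i"] this] show ?thesis
  proof (rule is_primitive_cong)
    fix t :: real assume "t \<ge> 0"
    then have Xt: "X t = a + integral (J t) (\<lambda>s. vker \<alpha> W t s (X s))"
      using X unfolding vsol_def by blast
    show "a $ i + integral (J t) (\<lambda>s. vker \<alpha> W t s (X s)) $ i = X t $ i"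
      using arg_cong[OF Xt, of "\<lambda>x. x $ i"] by simp
    then show "0 + (\<sigma> * (W t *v X t) $ i - \<alpha> $ i * integral (J t) (\<lambda>s. vker \<alpha> W t s (X s)) $ i)
      = \<sigma> * (W t *v X t) $ i - \<alpha> $ i * X t $ i"
      using a by (simp add: algebra_simps flip: \<open>_ = X t $ i\<close>)
  qed
qed

text \<open>
  \<open>v\<close> dominates the kernel. The function \<open>weight\<close> below satisfies \<open>\<integral> v weight \<le> weight / 2\<close> over
  every \<open>J t\<close>, so that a Volterra operator dominated by \<open>v\<close> is a contraction in the supremum norm
  with this weight; a power of \<open>1 + \<integral> v\<close> suffices because \<open>\<integral> v\<close> is bounded.
\<close>

locale volterra =
  fixes J :: "real \<Rightarrow> real set" and \<sigma> :: complex and v :: "real \<Rightarrow> real"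
  assumes J: "direction J \<sigma>"
    and v_int: "v absolutely_integrable_on {0..}"
    and v_nonneg: "\<And>s. s \<ge> 0 \<Longrightarrow> v s \<ge> 0"
begin

text \<open>Total mass of \<open>v\<close>, the exponent and the supremum of the weight.\<close>

definition mass :: real where "mass = integral {0..} v"

definition expo :: nat where "expo = Suc (nat \<lceil>2 * (1 + mass)\<rceil>)"

definition weight :: "real \<Rightarrow> real" where "weight t = (1 + integral (J t) v) ^ expo"

definition bound :: real where "bound = (1 + mass) ^ expo"

lemma v_int_on: "A \<subseteq> {0..} \<Longrightarrow> A \<in> sets lebesgue \<Longrightarrow> v absolutely_integrable_on A"
  using v_int by (rule set_integrable_subset) auto

lemma v_int_J: "t \<ge> 0 \<Longrightarrow> v absolutely_integrable_on J t"
  using v_int_on direction_subset[OF J] direction_sets[OF J] by blast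

lemma integral_v_J: 
  assumes "t \<ge> 0"
  shows "0 \<le> integral (J t) v" "integral (J t) v \<le> mass"
proof -
  show "0 \<le> integral (J t) v"
    using v_int_J[OF assms] direction_nonneg[OF J assms] v_nonneg
    by (intro integral_nonneg) (auto simp: absolutely_integrable_on_def)
  show "integral (J t) v \<le> mass"
    unfolding mass_def
    using v_int_J[OF assms] v_int direction_subset[OF J assms] v_nonneg
    by (intro integral_subset_le) (auto simp: absolutely_integrable_on_def)
qed

lemma mass_nonneg: "mass \<ge> 0"
  using integral_v_J[of 0] by linarith

lemma weight_ge_1: "t \<ge> 0 \<Longrightarrow> 1 \<le> weight t"
  using integral_v_J[of t] by (auto simp: weight_def)

lemma weight_le_bound: "t \<ge> 0 \<Longrightarrow> weight t \<le> bound"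
  unfolding weight_def bound_def using integral_v_J[of t] by (intro power_mono) auto

lemma bound_ge_1: "1 \<le> bound"
  using weight_ge_1[of 0] weight_le_bound[of 0] by simp

lemma mass_primitive: "is_primitive (\<lambda>t. complex_of_real (integral (J t) v)) (\<lambda>t. \<sigma> * of_real (v t))"
proof -
  have "is_primitive (\<lambda>t. integral (J t) (\<lambda>s. complex_of_real (v s))) (\<lambda>t. \<sigma> * of_real (v t))"
    by (intro is_primitive_direction[OF J] absolutely_integrable_linear[OF v_int_J, unfolded o_def])
       (auto simp: bounded_linear_of_real)
  then show ?thesis
    by (rule is_primitive_cong)
       (use v_int_J in \<open>auto simp: absolutely_integrable_on_def integral_linear[OF _ bounded_linear_of_real, unfolded o_def]\<close>)
qed

lemma mass_primitive_real:
  "is_primitive (\<lambda>t. 1 + integral (J t) v) (\<lambda>t. Re \<sigma> * v t)"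
proof -
  have "is_primitive (\<lambda>t. integral (J t) v) (\<lambda>t. Re \<sigma> * v t)"
    using is_primitive_linear[OF mass_primitive bounded_linear_Re] by simp
  from is_primitive_add[OF is_primitive_const[of 1] this] show ?thesis by simp
qed

lemma weight_measurable: "weight \<in> borel_measurable (lebesgue_on {0..})"
proof (rule continuous_imp_measurable_on_sets_lebesgue)
  show "continuous_on {0..} weight"
    unfolding weight_def
    by (intro continuous_on_power is_primitive_continuous[OF mass_primitive_real])
qed simp

lemma v_weight_int: "A \<subseteq> {0..} \<Longrightarrow> A \<in> sets lebesgue \<Longrightarrow> (\<lambda>s. v s * weight s) absolutely_integrable_on A"
proof -
  assume A: "A \<subseteq> {0..}" "A \<in> sets lebesgue"
  have "norm (weight t) \<le> bound" if "t \<in> {0..}" for t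
    using weight_ge_1[of t] weight_le_bound[of t] that by auto
  then have "bounded (weight ` {0..})"
    unfolding bounded_iff by auto
  then have "(\<lambda>s. weight s * v s) absolutely_integrable_on {0..}"
    by (intro absolutely_integrable_bounded_measurable_product_real weight_measurable v_int) auto
  then show ?thesis
    using A by (auto simp: mult.commute intro: set_integrable_subset)
qed

lemma v_weight_integrable_J: "t \<ge> 0 \<Longrightarrow> (\<lambda>s. v s * weight s) integrable_on J t"
  using v_weight_int[OF direction_subset[OF J] direction_sets[OF J]] absolutely_integrable_on_def by blast

lemma integral_v_weight:
  assumes t: "t \<ge> 0"
  shows "integral (J t) (\<lambda>s. v s * weight s) \<le> weight t / 2"
proof -
  let ?F = "\<lambda>t. 1 + integral (J t) v"
  let ?g = "\<lambda>s. real expo * ?F s ^ (expo - 1) * v s"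
  have prim: "is_primitive weight (\<lambda>t. Re \<sigma> * ?g t)"
    unfolding weight_def using is_primitive_power[OF mass_primitive_real, of expo]
    by (rule is_primitive_cong) auto
  have le: "v s * weight s \<le> ?g s / 2" if "s \<ge> 0" for s
  proof -
    have "?F s \<le> real expo / 2"
      using integral_v_J[OF that] mass_nonneg by (auto simp: expo_def) linarith
    then have "?F s * (?F s ^ (expo - 1) * v s) \<le> real expo / 2 * (?F s ^ (expo - 1) * v s)"
      using integral_v_J[OF that] v_nonneg[OF that] by (intro mult_right_mono) auto
    moreover have "weight s = ?F s * ?F s ^ (expo - 1)"
      unfolding weight_def by (simp add: expo_def)
    ultimately show ?thesis
      by (simp add: mult_ac)
  qed
  have est: "integral {a..b} (\<lambda>s. v s * weight s) \<le> integral {a..b} ?g / 2"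
    if "0 \<le> a" "?g integrable_on {a..b}" for a b
  proof -
    have "integral {a..b} (\<lambda>s. v s * weight s) \<le> integral {a..b} (\<lambda>s. ?g s / 2)"
    proof (rule integral_le)
      show "(\<lambda>s. v s * weight s) integrable_on {a..b}"
        using v_weight_int[of "{a..b}"] that by (auto simp: absolutely_integrable_on_def)
      show "(\<lambda>s. ?g s / 2) integrable_on {a..b}"
        by (intro integrable_on_divide that)
    qed (use le that in auto)
    then show ?thesis
      by simp
  qed
  show ?thesis
    using J unfolding direction_def
  proof
    assume fwd: "J = (\<lambda>t. {0..t}) \<and> \<sigma> = 1"
    then have prim': "is_primitive weight ?g" using prim by simp
    have "integral {0..t} (\<lambda>s. v s * weight s) \<le> integral {0..t} ?g / 2"
      by (intro est is_primitive_integrable[OF prim']) simp_all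
    also have "integral {0..t} ?g = weight t - weight 0"
      by (rule is_primitive_diff_eq[OF prim' order_refl t, symmetric])
    also have "(weight t - weight 0) / 2 \<le> weight t / 2"
      using weight_ge_1[of 0] by simp
    finally show ?thesis
      unfolding conjunct1[OF fwd] .
  next
    assume bwd: "J = (\<lambda>t. {t..}) \<and> \<sigma> = -1"
    have prim': "is_primitive (\<lambda>t. - weight t) ?g"
      using is_primitive_linear[OF prim bounded_linear_minus[OF bounded_linear_ident]] bwd by simp
    have "integral {t..b} (\<lambda>s. v s * weight s) \<le> weight t / 2" if "b \<ge> t" for b
    proof -
      have "integral {t..b} (\<lambda>s. v s * weight s) \<le> integral {t..b} ?g / 2"
        by (intro est is_primitive_integrable[OF prim'] t)
      also have "integral {t..b} ?g = - weight b - (- weight t)"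
        by (rule is_primitive_diff_eq[OF prim' t that, symmetric])
      finally show ?thesis
        using weight_ge_1[of b] t that by simp
    qed
    then have "\<forall>\<^sub>F b in at_top. integral {t..b} (\<lambda>s. v s * weight s) \<le> weight t / 2"
      by (rule eventually_mono[OF eventually_ge_at_top[of t]])
    moreover have "((\<lambda>b. integral {t..b} (\<lambda>s. v s * weight s)) \<longlongrightarrow> integral {t..} (\<lambda>s. v s * weight s)) at_top"
      by (rule tendsto_integral_atLeast[OF v_weight_int]) (use t in auto)
    ultimately have "integral {t..} (\<lambda>s. v s * weight s) \<le> weight t / 2"
      by (intro tendsto_upperbound[where F = at_top]) auto
    then show ?thesis
      unfolding conjunct1[OF bwd] .
  qed
qed

lemma norm_integral_J_le:
  fixes h :: "real \<Rightarrow> 'b::euclidean_space"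
  assumes t: "t \<ge> 0" and g: "g \<ge> 0" and h: "\<And>s. s \<in> J t \<Longrightarrow> norm (h s) \<le> g * (v s * weight s)"
  shows "norm (integral (J t) h) \<le> g * weight t / 2"
proof (cases "h integrable_on J t")
  case True
  have "norm (integral (J t) h) \<le> integral (J t) (\<lambda>s. g * (v s * weight s))"
    using True h by (intro Henstock_Kurzweil_Integration.integral_norm_bound_integral)
      (auto intro!: integrable_on_mult_right v_weight_integrable_J[OF t])
  also have "\<dots> = g * integral (J t) (\<lambda>s. v s * weight s)"
    by simp
  also have "\<dots> \<le> g * (weight t / 2)"
    by (intro mult_left_mono integral_v_weight t g)
  finally show ?thesis by simp
next
  case False
  then show ?thesis
    using g weight_ge_1[OF t] by (simp add: not_integrable_integral)
qed

text \<open>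
  Gronwall's inequality. The a priori bound \<open>B\<close> is only needed to be finite.
\<close>

lemma gronwall:
  fixes X :: "real \<Rightarrow> 'a::real_normed_vector" and h :: "real \<Rightarrow> real \<Rightarrow> 'b::euclidean_space"
  assumes S: "S \<subseteq> {0..}" "\<And>t. t \<in> S \<Longrightarrow> J t \<subseteq> S"
    and \<gamma>: "\<And>t. t \<in> S \<Longrightarrow> \<gamma> t > 0"
    and B: "\<And>t. t \<in> S \<Longrightarrow> norm (X t) \<le> B * \<gamma> t"
    and X: "\<And>t. t \<in> S \<Longrightarrow> norm (X t) \<le> c * \<gamma> t + norm (integral (J t) (h t))"
    and h: "\<And>t s. t \<in> S \<Longrightarrow> s \<in> J t \<Longrightarrow> norm (h t s) \<le> \<gamma> t / \<gamma> s * v s * norm (X s)"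
    and c: "c \<ge> 0"
    and t: "t \<in> S"
  shows "norm (X t) \<le> 2 * bound * c * \<gamma> t"
proof -
  define q where "q s = norm (X s) / (\<gamma> s * weight s)" for s
  define m where "m = (SUP s\<in>S. q s)"
  \<comment> \<open>the contraction property turns the hypothesis into \<open>m \<le> c + m / 2\<close>\<close>
  have S0: "s \<ge> 0" if "s \<in> S" for s
    using S that by auto
  have pos: "\<gamma> s * weight s > 0" "weight s > 0" if "s \<in> S" for s
    using \<gamma>[OF that] weight_ge_1[OF S0[OF that]] by auto
  have q0: "q s \<ge> 0" if "s \<in> S" for s
    using pos[OF that] by (simp add: q_def)
  have "q s \<le> B" if "s \<in> S" for s
  proof -
    have "0 \<le> B * \<gamma> s"
      using B[OF that] norm_ge_zero order_trans by blast
    then have "0 \<le> B"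
      using \<gamma>[OF that] by (simp add: zero_le_mult_iff)
    then have "B * \<gamma> s * 1 \<le> B * \<gamma> s * weight s"
      using \<gamma>[OF that] weight_ge_1[OF S0[OF that]] by (intro mult_left_mono) auto
    then show ?thesis
      using B[OF that] pos(1)[OF that] by (simp add: q_def pos_divide_le_eq mult.assoc)
  qed
  then have bdd: "bdd_above (q ` S)"
    by (auto simp: bdd_above_def)
  have q_m: "q s \<le> m" if "s \<in> S" for s
    unfolding m_def by (rule cSUP_upper[OF that bdd])
  have m0: "m \<ge> 0"
    using q_m[OF t] q0[OF t] by linarith
  have "q s \<le> c + m / 2" if s: "s \<in> S" for s
  proof -
    have "norm (integral (J s) (h s)) \<le> (\<gamma> s * m) * weight s / 2"
    proof (rule norm_integral_J_le[OF S0[OF s]])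
      show "0 \<le> \<gamma> s * m"
        using \<gamma>[OF s] m0 by simp
      fix r assume r: "r \<in> J s"
      then have rS: "r \<in> S" using S(2)[OF s] by auto
      have "norm (X r) \<le> m * (\<gamma> r * weight r)"
        using q_m[OF rS] pos(1)[OF rS] by (simp add: q_def pos_divide_le_eq)
      then have "\<gamma> s / \<gamma> r * v r * norm (X r) \<le> \<gamma> s / \<gamma> r * v r * (m * (\<gamma> r * weight r))"
        using \<gamma>[OF s] \<gamma>[OF rS] v_nonneg[OF S0[OF rS]] by (intro mult_left_mono) auto
      also have "\<dots> = \<gamma> s * m * (v r * weight r)"
        using \<gamma>[OF rS] by simp
      finally show "norm (h s r) \<le> \<gamma> s * m * (v r * weight r)"
        using h[OF s r] by linarith
    qed
    then have "norm (X s) \<le> c * \<gamma> s + \<gamma> s * m * weight s / 2"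
      using X[OF s] by linarith
    also have "\<dots> \<le> c * (\<gamma> s * weight s) + \<gamma> s * m * weight s / 2"
      using c \<gamma>[OF s] weight_ge_1[OF S0[OF s]] by (intro add_mono mult_left_mono) auto
    also have "\<dots> = (c + m / 2) * (\<gamma> s * weight s)"
      by (simp add: algebra_simps)
    finally show ?thesis
      using pos(1)[OF s] by (simp add: q_def pos_divide_le_eq)
  qed
  then have "m \<le> c + m / 2"
    unfolding m_def using t by (intro cSUP_least) auto
  then have "q t \<le> 2 * c"
    using q_m[OF t] by linarith
  then have "norm (X t) \<le> 2 * c * (\<gamma> t * weight t)"
    using pos(1)[OF t] by (simp add: q_def pos_divide_le_eq)
  also have "\<dots> \<le> 2 * c * (\<gamma> t * bound)"
    using c \<gamma>[OF t] weight_le_bound[OF S0[OF t]] by (intro mult_left_mono) auto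
  finally show ?thesis
    by (simp add: mult_ac)
qed

text \<open>
  The kernel with exponents \<open>\<alpha>\<close> and matrix \<open>W\<close> is dominated by \<open>v\<close> up to growth of rate \<open>\<gamma>\<close>.
\<close>

definition dominated :: "(real \<Rightarrow> real) \<Rightarrow> complex^'n \<Rightarrow> (real \<Rightarrow> complex^'n^'n) \<Rightarrow> bool" where
  "dominated \<gamma> \<alpha> W \<longleftrightarrow> (\<forall>t\<ge>0. \<forall>s\<in>J t. \<forall>x. norm (vker \<alpha> W t s x) \<le> \<gamma> t / \<gamma> s * v s * norm x)"

lemma vker_integrable:
  fixes X :: "real \<Rightarrow> complex^'n"
  assumes dom: "dominated \<gamma> \<alpha> W" and "\<forall>t\<ge>0. \<gamma> t > 0"
    and W: "\<And>i j. (\<lambda>s. W s $ i $ j) \<in> borel_measurable (lebesgue_on {0..})"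
    and X: "continuous_on {0..} X" "\<And>s. s \<ge> 0 \<Longrightarrow> norm (X s) \<le> B * \<gamma> s"
    and t: "t \<ge> 0"
  shows "(\<lambda>s. vker \<alpha> W t s (X s)) absolutely_integrable_on J t"
  unfolding absolutely_integrable_on_vec_iff
proof
  note \<gamma> = assms(2)[rule_format]
  fix i
  have W': "(\<lambda>s. W s $ i $ j) \<in> borel_measurable (lebesgue_on (J t))" for i j
    by (rule measurable_restrict_mono[OF W direction_subset[OF J t]])
  have X': "(\<lambda>s. X s $ i) \<in> borel_measurable (lebesgue_on (J t))" for i
    by (intro continuous_imp_measurable_on_sets_lebesgue direction_sets[OF J] continuous_on_component
        continuous_on_subset[OF X(1) direction_subset[OF J t]])
  show "(\<lambda>s. vker \<alpha> W t s (X s) $ i) absolutely_integrable_on J t"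
  proof (rule measurable_bounded_by_integrable_imp_absolutely_integrable)
    have "(\<lambda>s. exp (\<alpha> $ i * of_real (s - t))) \<in> borel_measurable (lebesgue_on (J t))"
      by (intro continuous_imp_measurable_on_sets_lebesgue direction_sets[OF J] continuous_intros)
    then show "(\<lambda>s. vker \<alpha> W t s (X s) $ i) \<in> borel_measurable (lebesgue_on (J t))"
      unfolding vker_def matrix_vector_mult_def
      using W' X' by simp
    show "(\<lambda>s. \<gamma> t * B * v s) integrable_on J t"
      using v_int_J[OF t] by (intro integrable_on_mult_right) (auto simp: absolutely_integrable_on_def)
    fix s assume s: "s \<in> J t"
    then have s0: "s \<ge> 0" by (rule direction_nonneg[OF J t])
    have "norm (vker \<alpha> W t s (X s) $ i) \<le> norm (vker \<alpha> W t s (X s))"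
      by (rule Finite_Cartesian_Product.norm_nth_le)
    also have "\<dots> \<le> \<gamma> t / \<gamma> s * v s * norm (X s)"
      using dom t s by (auto simp: dominated_def)
    also have "\<dots> \<le> \<gamma> t / \<gamma> s * v s * (B * \<gamma> s)"
      using \<gamma>[OF t] \<gamma>[OF s0] v_nonneg[OF s0] X(2)[OF s0] by (intro mult_left_mono) auto
    also have "\<dots> = \<gamma> t * B * v s"
      using \<gamma>[OF s0] by simp
    finally show "norm (vker \<alpha> W t s (X s) $ i) \<le> \<gamma> t * B * v s" .
  qed (rule direction_sets[OF J])
qed

lemma vker_integral_bound:
  fixes X :: "real \<Rightarrow> complex^'n"
  assumes dom: "dominated \<gamma> \<alpha> W" and "\<forall>t\<ge>0. \<gamma> t > 0"
    and X: "\<And>s. s \<ge> 0 \<Longrightarrow> norm (X s) \<le> B * (\<gamma> s * weight s)"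
    and t: "t \<ge> 0" and B: "B \<ge> 0"
  shows "norm (integral (J t) (\<lambda>s. vker \<alpha> W t s (X s))) \<le> B * (\<gamma> t * weight t) / 2"
proof -
  note \<gamma> = assms(2)[rule_format]
  have "norm (integral (J t) (\<lambda>s. vker \<alpha> W t s (X s))) \<le> (B * \<gamma> t) * weight t / 2"
  proof (rule norm_integral_J_le[OF t])
    show "0 \<le> B * \<gamma> t" using B \<gamma>[OF t] by simp
    fix s assume s: "s \<in> J t"
    then have s0: "s \<ge> 0" by (rule direction_nonneg[OF J t])
    have "norm (vker \<alpha> W t s (X s)) \<le> \<gamma> t / \<gamma> s * v s * norm (X s)"
      using dom t s by (auto simp: dominated_def)
    also have "\<dots> \<le> \<gamma> t / \<gamma> s * v s * (B * (\<gamma> s * weight s))"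
      using \<gamma>[OF t] \<gamma>[OF s0] v_nonneg[OF s0] X[OF s0] by (intro mult_left_mono) auto
    also have "\<dots> = B * \<gamma> t * (v s * weight s)"
      using \<gamma>[OF s0] by simp
    finally show "norm (vker \<alpha> W t s (X s)) \<le> B * \<gamma> t * (v s * weight s)" .
  qed
  then show ?thesis by (simp add: mult_ac)
qed

text \<open>Picard iterates of the Volterra equation.\<close>

primrec picard :: "complex^'n \<Rightarrow> complex^'n \<Rightarrow> (real \<Rightarrow> complex^'n^'n) \<Rightarrow> nat \<Rightarrow> real \<Rightarrow> complex^'n" where
  "picard a \<alpha> W 0 = (\<lambda>t. a)"
| "picard a \<alpha> W (Suc m) = (\<lambda>t. a + integral (J t) (\<lambda>s. vker \<alpha> W t s (picard a \<alpha> W m s)))"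

lemma picard_props:
  fixes a \<alpha> :: "complex^'n"
  assumes dom: "dominated \<gamma> \<alpha> W" and \<gamma>1: "\<forall>t\<ge>0. \<gamma> t \<ge> 1"
    and W: "\<And>i j. (\<lambda>s. W s $ i $ j) \<in> borel_measurable (lebesgue_on {0..})"
    and a: "norm a \<le> 1"
  shows "continuous_on {0..} (picard a \<alpha> W m)"
    and "\<And>t. t \<ge> 0 \<Longrightarrow> norm (picard a \<alpha> W m t) \<le> 2 * (\<gamma> t * weight t)"
    and "\<And>t. t \<ge> 0 \<Longrightarrow> (\<lambda>s. vker \<alpha> W t s (picard a \<alpha> W m s)) absolutely_integrable_on J t"
    and "\<And>t. t \<ge> 0 \<Longrightarrow>
      norm (picard a \<alpha> W (Suc m) t - picard a \<alpha> W m t) \<le> (1/2) ^ Suc m * (\<gamma> t * weight t)"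
proof -
  let ?P = "picard a \<alpha> W"
  note \<gamma> = \<gamma>1[rule_format]
  have \<gamma>0: "\<gamma> t > 0" if "t \<ge> 0" for t
    using \<gamma>[OF that] by linarith
  then have \<gamma>pos: "\<forall>t\<ge>0. \<gamma> t > 0"
    by blast
  have ge1: "1 \<le> \<gamma> t * weight t" if "t \<ge> 0" for t
    using mult_mono[OF \<gamma>[OF that] weight_ge_1[OF that]] \<gamma>0[OF that] by simp
  have int: "(\<lambda>s. vker \<alpha> W t s (?P m s)) absolutely_integrable_on J t"
    if "t \<ge> 0" "continuous_on {0..} (?P m)" "\<And>t. t \<ge> 0 \<Longrightarrow> norm (?P m t) \<le> 2 * (\<gamma> t * weight t)"
    for t m
  proof (rule vker_integrable[OF dom \<gamma>pos W that(2)])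
    fix s :: real assume s: "s \<ge> 0"
    have "norm (?P m s) \<le> 2 * (\<gamma> s * weight s)"
      by (rule that(3)[OF s])
    also have "\<dots> \<le> 2 * (\<gamma> s * bound)"
      using weight_le_bound[OF s] \<gamma>0[OF s] by simp
    finally show "norm (?P m s) \<le> 2 * bound * \<gamma> s"
      by (simp add: mult_ac)
  qed (use that in auto)
  have basic: "continuous_on {0..} (?P m) \<and> (\<forall>t\<ge>0. norm (?P m t) \<le> 2 * (\<gamma> t * weight t))" for m
  proof (induction m)
    case 0
    have "norm a \<le> 2 * (\<gamma> t * weight t)" if "t \<ge> 0" for t
      using a ge1[OF that] by linarith
    then show ?case
      by simp
  next
    case (Suc m)
    have int': "(\<lambda>s. vker \<alpha> W t s (?P m s)) absolutely_integrable_on J t" if "t \<ge> 0" for t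
      by (rule int[OF that]) (use Suc in auto)
    have "continuous_on {0..} (?P (Suc m))"
      unfolding picard.simps by (intro continuous_intros continuous_on_vker_integral[OF J] int')
    moreover have "norm (?P (Suc m) t) \<le> 2 * (\<gamma> t * weight t)" if t: "t \<ge> 0" for t
    proof -
      have "norm (integral (J t) (\<lambda>s. vker \<alpha> W t s (?P m s))) \<le> 2 * (\<gamma> t * weight t) / 2"
        by (rule vker_integral_bound[OF dom \<gamma>pos _ t]) (use Suc in auto)
      then show ?thesis
        using norm_triangle_ineq[of a "integral (J t) (\<lambda>s. vker \<alpha> W t s (?P m s))"] a ge1[OF t]
        by simp
    qed
    ultimately show ?case by blast
  qed
  have int'': "(\<lambda>s. vker \<alpha> W t s (?P m s)) absolutely_integrable_on J t" if "t \<ge> 0" for t m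
    by (rule int[OF that]) (use basic[of m] in auto)
  have diff: "\<forall>t\<ge>0. norm (?P (Suc m) t - ?P m t) \<le> (1/2) ^ Suc m * (\<gamma> t * weight t)" for m
  proof (induction m)
    case 0
    show ?case
    proof (intro allI impI)
      fix t :: real assume t: "t \<ge> 0"
      have "norm (integral (J t) (\<lambda>s. vker \<alpha> W t s a)) \<le> 1 * (\<gamma> t * weight t) / 2"
      proof (rule vker_integral_bound[OF dom \<gamma>pos _ t])
        fix s :: real assume "s \<ge> 0"
        then show "norm a \<le> 1 * (\<gamma> s * weight s)"
          using ge1[of s] a by simp
      qed auto
      then show "norm (?P (Suc 0) t - ?P 0 t) \<le> (1/2) ^ Suc 0 * (\<gamma> t * weight t)"
        by simp
    qed
  next
    case (Suc m)
    show ?case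
    proof (intro allI impI)
      fix t :: real assume t: "t \<ge> 0"
      have "?P (Suc (Suc m)) t - ?P (Suc m) t =
          integral (J t) (\<lambda>s. vker \<alpha> W t s (?P (Suc m) s)) - integral (J t) (\<lambda>s. vker \<alpha> W t s (?P m s))"
        by (simp only: picard.simps(2)[of a \<alpha> W "Suc m"] picard.simps(2)[of a \<alpha> W m]) simp
      also have "\<dots> = integral (J t) (\<lambda>s. vker \<alpha> W t s (?P (Suc m) s - ?P m s))"
        unfolding vker_diff
        using int''[OF t, of "Suc m"] int''[OF t, of m]
        by (intro Henstock_Kurzweil_Integration.integral_diff[symmetric])
           (simp_all only: absolutely_integrable_on_def)
      finally have "norm (?P (Suc (Suc m)) t - ?P (Suc m) t)
          \<le> (1/2) ^ Suc m * (\<gamma> t * weight t) / 2"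
        using vker_integral_bound[OF dom \<gamma>pos Suc[rule_format] t] by simp
      then show "norm (?P (Suc (Suc m)) t - ?P (Suc m) t) \<le> (1/2) ^ Suc (Suc m) * (\<gamma> t * weight t)"
        by simp
    qed
  qed
  show "continuous_on {0..} (?P m)" using basic by blast
  show "norm (?P m t) \<le> 2 * (\<gamma> t * weight t)" if "t \<ge> 0" for t using basic that by blast
  show "(\<lambda>s. vker \<alpha> W t s (?P m s)) absolutely_integrable_on J t" if "t \<ge> 0" for t
    by (rule int''[OF that])
  show "norm (?P (Suc m) t - ?P m t) \<le> (1/2) ^ Suc m * (\<gamma> t * weight t)" if "t \<ge> 0" for t
    using diff that by blast
qed

lemma picard_limit:
  fixes a \<alpha> :: "complex^'n"
  assumes dom: "dominated \<gamma> \<alpha> W" and \<gamma>: "\<forall>t\<ge>0. \<gamma> t \<ge> 1" "continuous_on {0..} \<gamma>"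
    and W: "\<And>i j. (\<lambda>s. W s $ i $ j) \<in> borel_measurable (lebesgue_on {0..})"
    and a: "norm a \<le> 1"
  obtains X where "vsol J a \<alpha> W X" "\<And>t. t \<ge> 0 \<Longrightarrow> norm (X t) \<le> 2 * bound * \<gamma> t"
    "\<And>t m. t \<ge> 0 \<Longrightarrow> norm (X t - picard a \<alpha> W m t) \<le> (1/2) ^ m * (\<gamma> t * weight t)"
proof -
  let ?P = "picard a \<alpha> W"
  note props = picard_props[where \<gamma> = \<gamma>, OF dom \<gamma>(1) W a]
  have \<gamma>0: "\<gamma> t > 0" if "t \<ge> 0" for t
    using \<gamma>(1)[rule_format, OF that] by linarith
  then have \<gamma>pos: "\<forall>t\<ge>0. \<gamma> t > 0"
    by blast
  define X where "X t = lim (\<lambda>m. ?P m t)" for t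
  have X: "(\<lambda>m. ?P m t) \<longlonglongrightarrow> X t" "\<And>m. norm (X t - ?P m t) \<le> (1/2) ^ m * (\<gamma> t * weight t)"
    if t: "t \<ge> 0" for t
  proof -
    obtain x where x: "(\<lambda>m. ?P m t) \<longlonglongrightarrow> x" "\<And>m. norm (x - ?P m t) \<le> (1/2) ^ m * (\<gamma> t * weight t)"
      using geometric_increments_limit[of "\<lambda>m. ?P m t", OF props(4)[OF t]] by blast
    moreover have "x = X t"
      using x(1) by (simp add: X_def limI)
    ultimately show "(\<lambda>m. ?P m t) \<longlonglongrightarrow> X t" "\<And>m. norm (X t - ?P m t) \<le> (1/2) ^ m * (\<gamma> t * weight t)"
      by auto
  qed
  have X_le: "norm (X t) \<le> 2 * bound * \<gamma> t" if t: "t \<ge> 0" for t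
  proof -
    have "norm (?P m t) \<le> 2 * bound * \<gamma> t" for m
    proof -
      have "norm (?P m t) \<le> 2 * (\<gamma> t * weight t)"
        by (rule props(2)[OF t])
      also have "\<dots> \<le> 2 * (\<gamma> t * bound)"
        using weight_le_bound[OF t] \<gamma>0[OF t] by simp
      finally show ?thesis
        by (simp add: mult_ac)
    qed
    then show ?thesis
      using tendsto_norm[OF X(1)[OF t]] by (intro LIMSEQ_le_const2) auto
  qed
  have cont: "continuous_on {0..} X"
  proof (rule continuous_on_atLeastI)
    fix b :: real
    have "compact (\<gamma> ` {0..b})"
      by (intro compact_continuous_image continuous_on_subset[OF \<gamma>(2)]) auto
    then obtain M where M: "\<And>t. t \<in> {0..b} \<Longrightarrow> norm (\<gamma> t) \<le> M"
      using compact_imp_bounded bounded_iff by (metis imageI)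
    have "uniform_limit {0..b} ?P X sequentially"
    proof (rule uniform_limitI)
      fix e :: real assume e: "e > 0"
      have "(\<lambda>m. (1/2) ^ m * (M * bound)) \<longlonglongrightarrow> 0 * (M * bound)"
        by (intro tendsto_intros LIMSEQ_realpow_zero) auto
      then have "\<forall>\<^sub>F m in sequentially. (1/2) ^ m * (M * bound) < e"
        using e order_tendstoD(2) by fastforce
      then show "\<forall>\<^sub>F m in sequentially. \<forall>t\<in>{0..b}. dist (?P m t) (X t) < e"
      proof eventually_elim
        case (elim m)
        show ?case
        proof
          fix t assume t: "t \<in> {0..b}"
          then have t0: "t \<ge> 0" by simp
          have "norm (X t - ?P m t) \<le> (1/2) ^ m * (\<gamma> t * weight t)"
            by (rule X(2)[OF t0])
          also have "\<dots> \<le> (1/2) ^ m * (M * bound)"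
            using M[OF t] \<gamma>0[OF t0] weight_le_bound[OF t0] weight_ge_1[OF t0]
            by (intro mult_left_mono mult_mono) auto
          finally show "dist (?P m t) (X t) < e"
            using elim by (simp add: dist_norm norm_minus_commute)
        qed
      qed
    qed
    moreover have "\<forall>\<^sub>F m in sequentially. continuous_on {0..b} (?P m)"
      by (intro always_eventually allI continuous_on_subset[OF props(1)]) auto
    ultimately show "continuous_on {0..b} X"
      using uniform_limit_theorem trivial_limit_sequentially by blast
  qed
  have int: "(\<lambda>s. vker \<alpha> W t s (X s)) absolutely_integrable_on J t" if "t \<ge> 0" for t
    by (rule vker_integrable[OF dom \<gamma>pos W cont X_le that]) auto
  have eq: "X t = a + integral (J t) (\<lambda>s. vker \<alpha> W t s (X s))" if t: "t \<ge> 0" for t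
  proof -
    have "(\<lambda>m. ?P (Suc m) t - a) \<longlonglongrightarrow> X t - a"
      by (intro tendsto_intros LIMSEQ_Suc X(1)[OF t])
    moreover have "(\<lambda>m. ?P (Suc m) t - a) \<longlonglongrightarrow> integral (J t) (\<lambda>s. vker \<alpha> W t s (X s))"
    proof (rule Lim_null[THEN iffD2], rule Lim_null_comparison)
      show "(\<lambda>m. (1/2) ^ m * (\<gamma> t * weight t) / 2) \<longlonglongrightarrow> 0"
        by (intro tendsto_eq_intros LIMSEQ_realpow_zero) auto
      have "norm (?P (Suc m) t - a - integral (J t) (\<lambda>s. vker \<alpha> W t s (X s)))
          \<le> (1/2) ^ m * (\<gamma> t * weight t) / 2" for m
      proof -
        have "integral (J t) (\<lambda>s. vker \<alpha> W t s (?P m s)) - integral (J t) (\<lambda>s. vker \<alpha> W t s (X s))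
          = integral (J t) (\<lambda>s. vker \<alpha> W t s (?P m s - X s))"
          unfolding vker_diff
          using props(3)[OF t, of m] int[OF t]
          by (intro Henstock_Kurzweil_Integration.integral_diff[symmetric])
             (simp_all only: absolutely_integrable_on_def)
        moreover have "norm (integral (J t) (\<lambda>s. vker \<alpha> W t s (?P m s - X s)))
            \<le> (1/2) ^ m * (\<gamma> t * weight t) / 2"
          by (rule vker_integral_bound[OF dom \<gamma>pos _ t])
             (use X(2) in \<open>auto simp: norm_minus_commute\<close>)
        ultimately show ?thesis
          by simp
      qed
      then show "\<forall>\<^sub>F m in sequentially. norm (?P (Suc m) t - a - integral (J t) (\<lambda>s. vker \<alpha> W t s (X s)))
          \<le> (1/2) ^ m * (\<gamma> t * weight t) / 2"
        by (intro always_eventually) simp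
    qed
    ultimately have "X t - a = integral (J t) (\<lambda>s. vker \<alpha> W t s (X s))"
      by (rule LIMSEQ_unique)
    then show ?thesis by (simp add: algebra_simps)
  qed
  show ?thesis
    by (rule that[of X]) (use int eq X_le X(2) in \<open>auto simp: vsol_def\<close>)
qed

text \<open>
  Existence for all parameters \<open>z \<in> \<Omega>\<close> with a common bound, and with holomorphic dependence on \<open>z\<close>
  when \<open>\<Omega>\<close> is open.
\<close>

lemma vsol_exists_holomorphic:
  fixes a :: "complex^'n" and \<alpha> :: "complex \<Rightarrow> complex^'n"
  assumes dom: "\<And>z. z \<in> \<Omega> \<Longrightarrow> dominated \<gamma> (\<alpha> z) (W z)"
    and \<gamma>: "\<forall>t\<ge>0. \<gamma> t \<ge> 1" "continuous_on {0..} \<gamma>"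
    and W: "\<And>z i j. z \<in> \<Omega> \<Longrightarrow> (\<lambda>s. W z s $ i $ j) \<in> borel_measurable (lebesgue_on {0..})"
    and a: "norm a \<le> 1"
  obtains X where "\<And>z. z \<in> \<Omega> \<Longrightarrow> vsol J a (\<alpha> z) (W z) (X z)"
    "\<And>z t. z \<in> \<Omega> \<Longrightarrow> t \<ge> 0 \<Longrightarrow> norm (X z t) \<le> 2 * bound * \<gamma> t"
    "\<And>t i. open \<Omega> \<Longrightarrow> (\<And>i. (\<lambda>z. \<alpha> z $ i) holomorphic_on \<Omega>) \<Longrightarrow>
      (\<And>s i j. s \<ge> 0 \<Longrightarrow> (\<lambda>z. W z s $ i $ j) holomorphic_on \<Omega>) \<Longrightarrow>
      t \<ge> 0 \<Longrightarrow> (\<lambda>z. X z t $ i) holomorphic_on \<Omega>"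
proof -
  have \<gamma>0: "\<gamma> t > 0" if "t \<ge> 0" for t
    using \<gamma>(1)[rule_format, OF that] by linarith
  then have \<gamma>pos: "\<forall>t\<ge>0. \<gamma> t > 0"
    by blast
  have "\<forall>z\<in>\<Omega>. \<exists>X. vsol J a (\<alpha> z) (W z) X \<and> (\<forall>t\<ge>0. norm (X t) \<le> 2 * bound * \<gamma> t) \<and>
      (\<forall>t\<ge>0. \<forall>m. norm (X t - picard a (\<alpha> z) (W z) m t) \<le> (1/2) ^ m * (\<gamma> t * weight t))"
    by (metis picard_limit[OF dom \<gamma> W a])
  then obtain X where X: "\<And>z. z \<in> \<Omega> \<Longrightarrow> vsol J a (\<alpha> z) (W z) (X z)"
    "\<And>z t. z \<in> \<Omega> \<Longrightarrow> t \<ge> 0 \<Longrightarrow> norm (X z t) \<le> 2 * bound * \<gamma> t"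
    "\<And>z t m. z \<in> \<Omega> \<Longrightarrow> t \<ge> 0 \<Longrightarrow>
       norm (X z t - picard a (\<alpha> z) (W z) m t) \<le> (1/2) ^ m * (\<gamma> t * weight t)"
    by metis
  have holo: "(\<lambda>z. X z t $ i) holomorphic_on \<Omega>"
    if \<Omega>: "open \<Omega>" and h\<alpha>: "\<And>i. (\<lambda>z. \<alpha> z $ i) holomorphic_on \<Omega>"
      and hW: "\<And>s i j. s \<ge> 0 \<Longrightarrow> (\<lambda>z. W z s $ i $ j) holomorphic_on \<Omega>"
      and t: "t \<ge> 0" for t i
  proof -
    let ?P = "\<lambda>m z t. picard a (\<alpha> z) (W z) m t"
    have hP: "\<forall>t\<ge>0. \<forall>i. (\<lambda>z. ?P m z t $ i) holomorphic_on \<Omega>" for m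
    proof (induction m)
      case (Suc m)
      show ?case
      proof (intro allI impI)
        fix t :: real and i assume t: "t \<ge> 0"
        have ai: "(\<lambda>s. vker (\<alpha> z) (W z) t s (?P m z s)) absolutely_integrable_on J t" if "z \<in> \<Omega>" for z
          by (rule picard_props(3)[where \<gamma> = \<gamma>, OF dom[OF that] \<gamma>(1) W[OF that] a t])
        have "(\<lambda>z. a $ i + integral (J t) (\<lambda>s. vker (\<alpha> z) (W z) t s (?P m z s) $ i)) holomorphic_on \<Omega>"
        proof (intro holomorphic_intros holomorphic_on_integral[OF \<Omega> direction_sets[OF J]])
          show "(\<lambda>s. \<gamma> t * (2 * bound) * v s) integrable_on J t"
            using v_int_J[OF t] by (intro integrable_on_mult_right) (auto simp: absolutely_integrable_on_def)
          show "(\<lambda>s. vker (\<alpha> z) (W z) t s (?P m z s) $ i) \<in> borel_measurable (lebesgue_on (J t))"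
            if "z \<in> \<Omega>" for z
            using ai[OF that] unfolding absolutely_integrable_on_vec_iff
            by (blast intro: absolutely_integrable_measurable direction_sets[OF J]
                dest: absolutely_integrable_imp_borel_measurable)
          fix s assume s: "s \<in> J t"
          then have s0: "s \<ge> 0" by (rule direction_nonneg[OF J t])
          show "(\<lambda>z. vker (\<alpha> z) (W z) t s (?P m z s) $ i) holomorphic_on \<Omega>"
            unfolding vker_def matrix_vector_mult_def
            using Suc s0 hW[OF s0] h\<alpha> by (auto intro!: holomorphic_intros)
          fix z assume z: "z \<in> \<Omega>"
          have "norm (vker (\<alpha> z) (W z) t s (?P m z s) $ i) \<le> norm (vker (\<alpha> z) (W z) t s (?P m z s))"
            by (rule Finite_Cartesian_Product.norm_nth_le)
          also have "\<dots> \<le> \<gamma> t / \<gamma> s * v s * norm (?P m z s)"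
            using dom[OF z] t s by (auto simp: dominated_def)
          also have "\<dots> \<le> \<gamma> t / \<gamma> s * v s * (2 * (\<gamma> s * weight s))"
            using \<gamma>0[OF t] \<gamma>0[OF s0] v_nonneg[OF s0]
              picard_props(2)[where \<gamma> = \<gamma>, OF dom[OF z] \<gamma>(1) W[OF z] a s0, of m]
            by (intro mult_left_mono) auto
          also have "\<dots> \<le> \<gamma> t / \<gamma> s * v s * (2 * (\<gamma> s * bound))"
            using \<gamma>0[OF t] \<gamma>0[OF s0] v_nonneg[OF s0] weight_le_bound[OF s0]
            by (intro mult_left_mono) auto
          also have "\<dots> = \<gamma> t * (2 * bound) * v s"
            using \<gamma>0[OF s0] by simp
          finally show "norm (vker (\<alpha> z) (W z) t s (?P m z s) $ i) \<le> \<gamma> t * (2 * bound) * v s" .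
        qed
        then show "(\<lambda>z. ?P (Suc m) z t $ i) holomorphic_on \<Omega>"
          by (rule holomorphic_transform) (use integral_vec_nth[OF ai] in simp)
      qed
    qed (auto intro: holomorphic_intros)
    show ?thesis
    proof (rule holomorphic_uniform_sequence[OF \<Omega>])
      show "(\<lambda>z. ?P m z t $ i) holomorphic_on \<Omega>" for m
        using hP t by blast
      fix x assume "x \<in> \<Omega>"
      then obtain d where d: "d > 0" "cball x d \<subseteq> \<Omega>"
        using \<Omega> open_contains_cball by blast
      have "uniform_limit (cball x d) (\<lambda>m z. ?P m z t $ i) (\<lambda>z. X z t $ i) sequentially"
      proof (rule uniform_limitI)
        fix e :: real assume e: "e > 0"
        have "(\<lambda>m. (1/2) ^ m * (\<gamma> t * weight t)) \<longlonglongrightarrow> 0 * (\<gamma> t * weight t)"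
          by (intro tendsto_intros LIMSEQ_realpow_zero) auto
        then have "\<forall>\<^sub>F m in sequentially. (1/2) ^ m * (\<gamma> t * weight t) < e"
          using e order_tendstoD(2) by fastforce
        then show "\<forall>\<^sub>F m in sequentially. \<forall>z\<in>cball x d. dist (?P m z t $ i) (X z t $ i) < e"
        proof eventually_elim
          case (elim m)
          show ?case
          proof
            fix z assume "z \<in> cball x d"
            then have z: "z \<in> \<Omega>" using d by auto
            have "norm ((X z t - ?P m z t) $ i) \<le> (1/2) ^ m * (\<gamma> t * weight t)"
              using X(3)[OF z t] Finite_Cartesian_Product.norm_nth_le order_trans by blast
            then show "dist (?P m z t $ i) (X z t $ i) < e"
              using elim by (simp add: dist_norm norm_minus_commute)
          qed
        qed
      qed
      then show "\<exists>d>0. cball x d \<subseteq> \<Omega> \<and>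
          uniform_limit (cball x d) (\<lambda>m z. ?P m z t $ i) (\<lambda>z. X z t $ i) sequentially"
        using d by blast
    qed
  qed
  show ?thesis
    by (rule that[of X]) (use X holo in auto)
qed

end

section \<open>Column solutions of the Lax equation\<close>

text \<open>The diagonal entries of \<open>\<sigma>\<^sub>3\<close>, and the transposition of the two indices.\<close>

definition sg :: "2 \<Rightarrow> real" where "sg i = (if i = 1 then 1 else -1)"

definition other :: "2 \<Rightarrow> 2" where "other i = (if i = 1 then 2 else 1)"

lemma sg_cases: "sg i = 1 \<or> sg i = -1"
  by (auto simp: sg_def)

lemma not_1_eq_2 [simp]: "i \<noteq> (1::2) \<longleftrightarrow> i = 2" "i \<noteq> (2::2) \<longleftrightarrow> i = 1"
  using exhaust_2[of i] by auto

lemma sg_other [simp]: "sg (other i) = - sg i"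
  by (auto simp: sg_def other_def)

lemma neq_imp_other: "i \<noteq> c \<Longrightarrow> i = other c"
  by (cases "i = 1"; cases "c = 1") (auto simp: other_def)

lemma other_neq [simp]: "other c \<noteq> c" "c \<noteq> other c"
  by (auto simp: other_def)

lemma sum_2_other: "sum f UNIV = f c + f (other c)" for f :: "2 \<Rightarrow> 'a::comm_monoid_add"
  by (cases "c = 1") (auto simp: sum_2 other_def add.commute)

text \<open>
  The eigenvalues of \<open>i\<theta>\<^sub>2 [\<sigma>\<^sub>3, \<cdot>]\<close> on the entries of column \<open>c\<close>, and the real part \<open>eta\<close> of the
  off-diagonal one. The sign of \<open>eta\<close> decides in which direction of time the equation for the
  column is stable.
\<close>

definition expn :: "2 \<Rightarrow> complex \<Rightarrow> complex^2" where
  "expn c k = (\<chi> i. \<i> * theta2 k * of_real (sg i - sg c))"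

definition eta :: "2 \<Rightarrow> complex \<Rightarrow> real" where
  "eta c k = 2 * sg c * Im (theta2 k)"

lemma Re_expn: "Re (expn c k $ i) = (if i = c then 0 else eta c k)"
  using neq_imp_other[of i c] by (auto simp: expn_def eta_def)

lemma norm_exp_expn: "norm (exp (expn c k $ i * of_real r)) = (if i = c then 1 else exp (eta c k * r))"
  by (simp add: norm_exp_eq_Re Re_expn)

lemma expn_diag [simp]: "expn c k $ c = 0"
  by (simp add: expn_def)

lemma norm_vker_le:
  assumes M: "M \<ge> 0" and W: "\<And>i j. norm (W s $ i $ j) \<le> M / 4"
  shows "norm (vker (expn c k) W t s x) \<le> max 1 (exp (eta c k * (s - t))) * M * norm x"
proof -
  let ?m = "max 1 (exp (eta c k * (s - t)))"
  have "norm (vker (expn c k) W t s x $ i) \<le> ?m * (M / 2 * norm x)" for i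
  proof -
    have "norm ((W s *v x) $ i) \<le> (\<Sum>j\<in>UNIV. norm (W s $ i $ j * x $ j))"
      unfolding matrix_vector_mult_def by (simp add: norm_sum)
    also have "\<dots> \<le> (\<Sum>j\<in>(UNIV::2 set). M / 4 * norm x)"
      unfolding norm_mult
      by (intro sum_mono mult_mono W Finite_Cartesian_Product.norm_nth_le) (use M in auto)
    also have "\<dots> = M / 2 * norm x"
      by simp
    finally have 1: "norm ((W s *v x) $ i) \<le> M / 2 * norm x" .
    have "norm (exp (expn c k $ i * of_real (s - t))) \<le> ?m"
      unfolding norm_exp_expn by auto
    then show ?thesis
      unfolding vker_def vec_lambda_beta norm_mult using 1 by (intro mult_mono) auto
  qed
  then have "(\<Sum>i\<in>UNIV. norm (vker (expn c k) W t s x $ i)) \<le> (\<Sum>i\<in>(UNIV::2 set). ?m * (M / 2 * norm x))"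
    by (intro sum_mono)
  then show ?thesis
    using norm_vec_le_sum[of "vker (expn c k) W t s x"] by simp
qed

text \<open>
  What the argument uses of the potential: a majorant \<open>w\<close> with finite \<open>n\<close>-th moment, analyticity in \<open>k\<close>, vanishing
  trace, and the two symmetries.
\<close>

locale potential =
  fixes n :: nat and V :: "real \<Rightarrow> complex \<Rightarrow> complex^2^2" and w :: "real \<Rightarrow> real"
  assumes n_pos: "n \<ge> 1"
    and w_nonneg: "\<And>s. s \<ge> 0 \<Longrightarrow> w s \<ge> 0"
    and w_meas: "w \<in> borel_measurable (lebesgue_on {0..})"
    and w_moment: "(\<lambda>s. (1 + s) ^ n * w s) absolutely_integrable_on {0..}"
    and V_meas: "\<And>k i j. k \<noteq> 0 \<Longrightarrow> (\<lambda>s. V s k $ i $ j) \<in> borel_measurable (lebesgue_on {0..})"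
    and V_holo: "\<And>s i j. (\<lambda>k. V s k $ i $ j) holomorphic_on - {0}"
    and V_bound: "\<And>s k i j. s \<ge> 0 \<Longrightarrow> k \<noteq> 0 \<Longrightarrow> norm (V s k $ i $ j) \<le> (1 + 1 / norm k) * w s / 4"
    and V_trace: "\<And>s k. V s k $ 1 $ 1 + V s k $ 2 $ 2 = 0"
    and V_minus: "\<And>s k i j. V s (- k) $ i $ j = of_real (sg i * sg j) * V s k $ other i $ other j"
    and V_cnj: "\<And>s k i j. cnj (V s (cnj k) $ i $ j) = of_real (sg i * sg j) * V s k $ other i $ other j"
begin

lemma w_int: "w absolutely_integrable_on {0..}"
proof (rule measurable_bounded_by_integrable_imp_absolutely_integrable[OF w_meas])
  show "(\<lambda>s. (1 + s) ^ n * w s) integrable_on {0..}"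
    using w_moment absolutely_integrable_on_def by blast
  fix s :: real assume "s \<in> {0..}"
  then have "1 * w s \<le> (1 + s) ^ n * w s"
    by (intro mult_right_mono w_nonneg) auto
  then show "norm (w s) \<le> (1 + s) ^ n * w s"
    using w_nonneg \<open>s \<in> {0..}\<close> by auto
qed simp

lemma volterra_w: "direction J \<sigma> \<Longrightarrow> K \<ge> 0 \<Longrightarrow> volterra J \<sigma> (\<lambda>s. K * w s)"
  by unfold_locales (auto intro!: set_integrable_mult_right w_int mult_nonneg_nonneg w_nonneg)

lemma V_bound_ge:
  assumes "s \<ge> 0" "\<delta> > 0" "norm k \<ge> \<delta>"
  shows "norm (V s k $ i $ j) \<le> (1 + 1 / \<delta>) * w s / 4"
proof -
  have "k \<noteq> 0" "1 / norm k \<le> 1 / \<delta>"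
    using assms by (auto simp: frac_le)
  then have "(1 + 1 / norm k) * w s \<le> (1 + 1 / \<delta>) * w s"
    using w_nonneg[OF assms(1)] by (intro mult_right_mono) auto
  then show ?thesis
    using V_bound[OF assms(1) \<open>k \<noteq> 0\<close>, of i j] by (meson divide_right_mono order_trans zero_le_numeral)
qed

text \<open>
  \<open>Vcut A\<close> is the potential of the equation integrated from \<open>\<infinity>\<close>, cut off outside \<open>A\<close>; its
  sign is that of \<open>\<integral>\<^sub>\<infinity>\<^sup>t = -\<integral>\<^sub>t\<^sup>\<infinity>\<close>.
\<close>

definition Vcut :: "real set \<Rightarrow> complex \<Rightarrow> real \<Rightarrow> complex^2^2" where
  "Vcut A k s = (if s \<in> A then - V s k else 0)"

text \<open>The mass of \<open>w\<close> on \<open>A\<close>.\<close>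

definition wmass :: "real set \<Rightarrow> real" where
  "wmass A = integral {0..} (\<lambda>s. indicator A s * w s)"

text \<open>
  The exponential factors of the equation from \<open>\<infinity>\<close>, cut off outside \<open>A\<close>, are at most \<open>E\<close>.
\<close>

definition stable :: "real \<Rightarrow> real set \<Rightarrow> 2 \<Rightarrow> complex \<Rightarrow> bool" where
  "stable E A c k \<longleftrightarrow> (\<forall>s\<in>A. \<forall>t. 0 \<le> t \<and> t \<le> s \<longrightarrow> exp (eta c k * (s - t)) \<le> E)"

lemma stable_halfline: "eta c k \<le> 0 \<Longrightarrow> 1 \<le> E \<Longrightarrow> stable E A c k"
  unfolding stable_def
proof (intro ballI allI impI)
  fix s t :: real assume "eta c k \<le> 0" "1 \<le> E" "0 \<le> t \<and> t \<le> s"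
  then have "exp (eta c k * (s - t)) \<le> 1"
    by (simp add: mult_nonpos_nonneg)
  then show "exp (eta c k * (s - t)) \<le> E" using \<open>1 \<le> E\<close> by linarith
qed

lemma stable_cut:
  assumes "eta c k * R \<le> r" "A \<subseteq> {0..R}" "r \<ge> 0"
  shows "stable (exp r) A c k"
  unfolding stable_def
proof (intro ballI allI impI)
  fix s t assume s: "s \<in> A" "0 \<le> t \<and> t \<le> s"
  have "eta c k * (s - t) \<le> r"
  proof (cases "eta c k \<le> 0")
    case True
    then have "eta c k * (s - t) \<le> 0"
      using s by (simp add: mult_nonpos_nonneg)
    then show ?thesis using assms by simp
  next
    case False
    then have "eta c k * (s - t) \<le> eta c k * R"
      using s assms by (intro mult_left_mono) auto
    then show ?thesis using assms by simp
  qed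
  then show "exp (eta c k * (s - t)) \<le> exp r" by simp
qed

lemma stable_mono: "stable E A' c k \<Longrightarrow> A \<subseteq> A' \<Longrightarrow> stable E A c k"
  by (auto simp: stable_def)

text \<open>
  Solutions of the column equations from \<open>\<infinity>\<close> with potential cut off outside \<open>A\<close> (so \<open>A = [0,\<infinity>)\<close> is the
  full equation), and from \<open>0\<close>. \<open>Tcol\<close> and \<open>Ucol\<close> are the columns of \<open>T\<close> and \<open>U\<close>; they are chosen
  pointwise in \<open>k\<close>, and uniqueness identifies them with the holomorphic families constructed locally.
\<close>

definition solT :: "real set \<Rightarrow> 2 \<Rightarrow> complex \<Rightarrow> (real \<Rightarrow> complex^2) \<Rightarrow> bool" where
  "solT A c k X \<longleftrightarrow> vsol (\<lambda>t. {t..}) (axis c 1) (expn c k) (Vcut A k) X"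

definition solU :: "2 \<Rightarrow> complex \<Rightarrow> (real \<Rightarrow> complex^2) \<Rightarrow> bool" where
  "solU c k X \<longleftrightarrow> vsol (\<lambda>t. {0..t}) (axis c 1) (expn c k) (\<lambda>s. V s k) X"

definition Tcol :: "real set \<Rightarrow> 2 \<Rightarrow> complex \<Rightarrow> real \<Rightarrow> complex^2" where
  "Tcol A c k = (SOME X. solT A c k X \<and> (\<exists>B. \<forall>t\<ge>0. norm (X t) \<le> B))"

definition Ucol :: "2 \<Rightarrow> complex \<Rightarrow> real \<Rightarrow> complex^2" where
  "Ucol c k = (SOME X. solU c k X)"

lemma norm_vker_Vcut:
  assumes "\<delta> > 0" "norm k \<ge> \<delta>" "E \<ge> 1" "stable E A c k" "0 \<le> t" "t \<le> s"
  shows "norm (vker (expn c k) (Vcut A k) t s x) \<le> E * (1 + 1 / \<delta>) * w s * norm x"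
proof (cases "s \<in> A")
  case True
  have s: "s \<ge> 0" using assms by simp
  have "norm (vker (expn c k) (Vcut A k) t s x)
      \<le> max 1 (exp (eta c k * (s - t))) * ((1 + 1 / \<delta>) * w s) * norm x"
    by (rule norm_vker_le)
       (use assms(1) w_nonneg[OF s] V_bound_ge[OF s assms(1,2)] True in \<open>auto simp: Vcut_def\<close>)
  also have "\<dots> \<le> E * ((1 + 1 / \<delta>) * w s) * norm x"
    using assms True w_nonneg[OF s] by (intro mult_right_mono) (auto simp: stable_def)
  finally show ?thesis by (simp add: mult_ac)
next
  case False
  then have "vker (expn c k) (Vcut A k) t s x = 0"
    by (simp add: vker_def Vcut_def vec_eq_iff)
  then show ?thesis
    using assms w_nonneg[of s] by simp
qed

lemma dominated_Vcut:
  assumes "\<delta> > 0" "norm k \<ge> \<delta>" "E \<ge> 1" "stable E A c k"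
  shows "volterra.dominated (\<lambda>t. {t..}) (\<lambda>s. E * (1 + 1 / \<delta>) * w s) (\<lambda>t. 1) (expn c k) (Vcut A k)"
proof -
  interpret B: volterra "\<lambda>t. {t..}" "-1" "\<lambda>s. E * (1 + 1 / \<delta>) * w s"
    using assms by (intro volterra_w direction_backward) auto
  show ?thesis
    unfolding B.dominated_def using norm_vker_Vcut[OF assms] by simp
qed

lemma Vcut_meas:
  assumes "A \<in> sets lebesgue" "k \<noteq> 0"
  shows "(\<lambda>s. Vcut A k s $ i $ j) \<in> borel_measurable (lebesgue_on {0..})"
proof -
  have "(\<lambda>s. if s \<in> A then - V s k $ i $ j else 0) \<in> borel_measurable (lebesgue_on {0..})"
    using assms V_meas[OF assms(2), of i j]
    by (intro measurable_If_set borel_measurable_uminus) (auto simp: sets_restrict_space)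
  moreover have "(\<lambda>s. if s \<in> A then - V s k $ i $ j else 0) = (\<lambda>s. Vcut A k s $ i $ j)"
    by (auto simp: Vcut_def)
  ultimately show ?thesis by simp
qed

lemma theta2_holo: "theta2 holomorphic_on - {0}"
  unfolding theta2_def by (intro holomorphic_intros) auto

lemma expn_holo: "(\<lambda>k. expn c k $ i) holomorphic_on - {0}"
  unfolding expn_def by (auto intro!: holomorphic_intros theta2_holo)

lemma Vcut_holo: "(\<lambda>k. Vcut A k s $ i $ j) holomorphic_on - {0}"
proof (cases "s \<in> A")
  case True
  then show ?thesis using V_holo[of s i j] by (auto simp: Vcut_def intro!: holomorphic_intros)
qed (auto simp: Vcut_def)

lemma eta_continuous: "continuous_on (- {0}) (eta c)"
  unfolding eta_def
  by (intro continuous_intros holomorphic_on_imp_continuous_on theta2_holo)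

lemma norm_axis_1 [simp]: "norm (axis c 1 :: complex^2) = 1"
  by (simp add: norm_vec_def L2_set_def axis_def if_distrib[of norm] if_distrib[of "\<lambda>x. x\<^sup>2"] cong: if_cong)

lemma solT_exists_family:
  assumes "\<delta> > 0" "E \<ge> 1" "A \<in> sets lebesgue"
    and \<Omega>: "\<And>z. z \<in> \<Omega> \<Longrightarrow> norm z \<ge> \<delta>" "\<And>z. z \<in> \<Omega> \<Longrightarrow> stable E A c z"
  obtains X B where "\<And>z. z \<in> \<Omega> \<Longrightarrow> solT A c z (X z)"
    "\<And>z t. z \<in> \<Omega> \<Longrightarrow> t \<ge> 0 \<Longrightarrow> norm (X z t) \<le> B"
    "\<And>t i. open \<Omega> \<Longrightarrow> t \<ge> 0 \<Longrightarrow> (\<lambda>z. X z t $ i) holomorphic_on \<Omega>"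
proof -
  interpret B: volterra "\<lambda>t. {t..}" "-1" "\<lambda>s. E * (1 + 1 / \<delta>) * w s"
    using assms by (intro volterra_w direction_backward) auto
  have ne: "z \<noteq> 0" if "z \<in> \<Omega>" for z
    using \<Omega>(1)[OF that] \<open>\<delta> > 0\<close> by auto
  then have sub: "\<Omega> \<subseteq> - {0}" by auto
  have meas: "(\<lambda>s. Vcut A z s $ i $ j) \<in> borel_measurable (lebesgue_on {0..})" if "z \<in> \<Omega>" for z i j
    using ne[OF that] assms(3) by (rule Vcut_meas[rotated])
  obtain X where X: "\<And>z. z \<in> \<Omega> \<Longrightarrow> vsol (\<lambda>t. {t..}) (axis c 1) (expn c z) (Vcut A z) (X z)"
    "\<And>z t. z \<in> \<Omega> \<Longrightarrow> t \<ge> 0 \<Longrightarrow> norm (X z t) \<le> 2 * B.bound * 1"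
    "\<And>t i. open \<Omega> \<Longrightarrow> (\<And>i. (\<lambda>z. expn c z $ i) holomorphic_on \<Omega>) \<Longrightarrow>
      (\<And>s i j. s \<ge> 0 \<Longrightarrow> (\<lambda>z. Vcut A z s $ i $ j) holomorphic_on \<Omega>) \<Longrightarrow>
      t \<ge> 0 \<Longrightarrow> (\<lambda>z. X z t $ i) holomorphic_on \<Omega>"
    by (rule B.vsol_exists_holomorphic[of \<Omega> "\<lambda>_. 1" "expn c" "Vcut A" "axis c 1"])
       (use assms meas in \<open>auto intro: dominated_Vcut\<close>)
  show ?thesis
  proof (rule that[of X "2 * B.bound"])
    show "solT A c z (X z)" if "z \<in> \<Omega>" for z
      unfolding solT_def by (rule X(1)[OF that])
    show "norm (X z t) \<le> 2 * B.bound" if "z \<in> \<Omega>" "t \<ge> 0" for z t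
      using X(2)[OF that] by simp
    show "(\<lambda>z. X z t $ i) holomorphic_on \<Omega>" if "open \<Omega>" "t \<ge> 0" for t i
      by (rule X(3)[OF that(1) _ _ that(2)])
         (auto intro: holomorphic_on_subset[OF expn_holo sub] holomorphic_on_subset[OF Vcut_holo sub])
  qed
qed

lemma indicator_w_int: "A \<in> sets lebesgue \<Longrightarrow> (\<lambda>s. indicator A s * w s) absolutely_integrable_on {0..}"
  using integrable_mult_indicator[of A lebesgue "\<lambda>s. indicator {0..} s *\<^sub>R w s"] w_int
  unfolding set_integrable_def by (simp add: mult_ac)

lemma indicator_w_integrable: "A \<in> sets lebesgue \<Longrightarrow> (\<lambda>s. indicator A s * w s) integrable_on {0..}"
  using indicator_w_int absolutely_integrable_on_def by blast

text \<open>
  Two bounded solutions with different cutoffs differ by at most a multiple of the mass of \<open>w\<close>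
  between the cutoffs. The constant depends only on \<open>E\<close> and on a lower bound for \<open>|k|\<close>.
\<close>

lemma solT_compare:
  assumes \<delta>: "\<delta> > 0" and E: "E \<ge> 1"
  obtains C where "C > 0"
    "\<And>c k A X B t. norm k \<ge> \<delta> \<Longrightarrow> stable E A c k \<Longrightarrow> solT A c k X \<Longrightarrow>
       (\<And>t. t \<ge> 0 \<Longrightarrow> norm (X t) \<le> B) \<Longrightarrow> t \<ge> 0 \<Longrightarrow> norm (X t) \<le> C"
    "\<And>c k A A' X X' B B' t. norm k \<ge> \<delta> \<Longrightarrow> A \<subseteq> A' \<Longrightarrow> A \<in> sets lebesgue \<Longrightarrow> A' \<in> sets lebesgue \<Longrightarrow>
       stable E A' c k \<Longrightarrow> solT A c k X \<Longrightarrow> solT A' c k X' \<Longrightarrow>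
       (\<And>t. t \<ge> 0 \<Longrightarrow> norm (X t) \<le> B) \<Longrightarrow> (\<And>t. t \<ge> 0 \<Longrightarrow> norm (X' t) \<le> B') \<Longrightarrow> t \<ge> 0 \<Longrightarrow>
       norm (X' t - X t) \<le> C * wmass (A' - A)"
proof -
  let ?K = "E * (1 + 1 / \<delta>)"
  have K: "?K > 0" using \<delta> E by (intro mult_pos_pos add_pos_pos) auto
  interpret B: volterra "\<lambda>t. {t..}" "-1" "\<lambda>s. ?K * w s"
    using K by (intro volterra_w direction_backward) auto
  let ?b = "2 * B.bound"
  have b: "?b \<ge> 2" using B.bound_ge_1 by simp
  have bdd: "norm (X t) \<le> ?b"
    if k: "norm k \<ge> \<delta>" and st: "stable E A c k" and X: "solT A c k X"
      and B: "\<And>t. t \<ge> 0 \<Longrightarrow> norm (X t) \<le> B" and t: "t \<ge> 0" for c k A X B t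
  proof -
    have "norm (X t) \<le> 2 * B.bound * 1 * 1"
    proof (rule B.gronwall[where S = "{0..}" and \<gamma> = "\<lambda>_. 1" and B = B
          and h = "\<lambda>t s. vker (expn c k) (Vcut A k) t s (X s)"])
      fix t :: real assume t: "t \<in> {0..}"
      then have "X t = axis c 1 + integral {t..} (\<lambda>s. vker (expn c k) (Vcut A k) t s (X s))"
        using X by (simp add: solT_def vsol_def)
      then show "norm (X t) \<le> 1 * 1 + norm (integral {t..} (\<lambda>s. vker (expn c k) (Vcut A k) t s (X s)))"
        by (metis mult_1 norm_axis_1 norm_triangle_ineq)
      fix s assume "s \<in> {t..}"
      then show "norm (vker (expn c k) (Vcut A k) t s (X s)) \<le> 1 / 1 * (?K * w s) * norm (X s)"
        using norm_vker_Vcut[OF \<delta> k E st, of t s "X s"] t by simp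
    qed (use B t in auto)
    then show ?thesis by simp
  qed
  have cmp: "norm (X' t - X t) \<le> (?b * ?b * ?K) * wmass (A' - A)"
    if k: "norm k \<ge> \<delta>" and A: "A \<subseteq> A'" "A \<in> sets lebesgue" "A' \<in> sets lebesgue"
      and st: "stable E A' c k" and X: "solT A c k X" and X': "solT A' c k X'"
      and B: "\<And>t. t \<ge> 0 \<Longrightarrow> norm (X t) \<le> B" and B': "\<And>t. t \<ge> 0 \<Longrightarrow> norm (X' t) \<le> B'"
      and t: "t \<ge> 0" for c k A A' X X' B B' t
  proof -
    have stA: "stable E A c k" by (rule stable_mono[OF st A(1)])
    let ?f = "\<lambda>t s. vker (expn c k) (Vcut A k) t s (X s)"
    let ?f' = "\<lambda>t s. vker (expn c k) (Vcut A' k) t s (X' s)"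
    let ?r = "\<lambda>t s. indicator (A' - A) s *\<^sub>R ?f' t s"
    define c0 where "c0 = ?b * ?K * wmass (A' - A)"
    have A'A: "A' - A \<in> sets lebesgue" using A by blast
    have wm0: "wmass (A' - A) \<ge> 0"
      unfolding wmass_def
      by (intro integral_nonneg indicator_w_integrable A'A) (auto intro!: mult_nonneg_nonneg w_nonneg)
    have c0: "c0 \<ge> 0"
      using b K wm0 by (auto simp: c0_def)
    have "norm (X' t - X t) \<le> 2 * B.bound * c0 * 1"
    proof (rule B.gronwall[where S = "{0..}" and \<gamma> = "\<lambda>_. 1" and B = "B + B'"
          and h = "\<lambda>t s. ?f' t s - ?f t s - ?r t s"])
      fix t :: real assume "t \<in> {0..}"
      then have t: "t \<ge> 0" by simp
      have f: "?f t absolutely_integrable_on {t..}" "X t = axis c 1 + integral {t..} (?f t)"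
        and f': "?f' t absolutely_integrable_on {t..}" "X' t = axis c 1 + integral {t..} (?f' t)"
        using X X' t by (auto simp: solT_def vsol_def)
      have r: "?r t absolutely_integrable_on {t..}"
        using integrable_mult_indicator[OF A'A, of "\<lambda>s. indicator {t..} s *\<^sub>R ?f' t s"] f'(1)
        unfolding set_integrable_def by (simp add: mult_ac)
      note ints = f(1)[unfolded absolutely_integrable_on_def, THEN conjunct1]
        f'(1)[unfolded absolutely_integrable_on_def, THEN conjunct1]
        r[unfolded absolutely_integrable_on_def, THEN conjunct1]
      have "X' t - X t = integral {t..} (\<lambda>s. ?f' t s - ?f t s)"
        unfolding f(2) f'(2) using ints by (subst Henstock_Kurzweil_Integration.integral_diff) auto
      also have "\<dots> = integral {t..} (\<lambda>s. ?f' t s - ?f t s - ?r t s) + integral {t..} (?r t)"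
        using ints by (subst (2) Henstock_Kurzweil_Integration.integral_diff)
          (auto intro!: Henstock_Kurzweil_Integration.integrable_diff)
      finally have eq: "X' t - X t =
        integral {t..} (\<lambda>s. ?f' t s - ?f t s - ?r t s) + integral {t..} (?r t)" .
      have "norm (integral {t..} (?r t)) \<le> integral {t..} (\<lambda>s. ?b * ?K * (indicator (A' - A) s * w s))"
      proof (rule Henstock_Kurzweil_Integration.integral_norm_bound_integral)
        show "(\<lambda>s. ?b * ?K * (indicator (A' - A) s * w s)) integrable_on {t..}"
          using set_integrable_subset[OF indicator_w_int[OF A'A], of "{t..}"] t
          by (intro integrable_on_mult_right) (auto simp: absolutely_integrable_on_def)
        fix s assume s: "s \<in> {t..}"
        have "norm (?f' t s) \<le> ?K * w s * norm (X' s)"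
          using norm_vker_Vcut[OF \<delta> k E st t, of s "X' s"] s by simp
        also have "\<dots> \<le> ?K * w s * ?b"
          using K w_nonneg[of s] bdd[OF k st X' B', of s] s t by (intro mult_left_mono) auto
        finally show "norm (?r t s) \<le> ?b * ?K * (indicator (A' - A) s * w s)"
          by (auto simp: indicator_def mult_ac)
      qed (rule ints)
      also have "\<dots> = ?b * ?K * integral {t..} (\<lambda>s. indicator (A' - A) s * w s)"
        by simp
      also have "\<dots> \<le> c0"
        unfolding c0_def wmass_def
      proof (intro mult_left_mono integral_subset_le indicator_w_integrable A'A)
        show "(\<lambda>s. indicator (A' - A) s * w s) integrable_on {t..}"
          using set_integrable_subset[OF indicator_w_int[OF A'A], of "{t..}"] t
          by (auto simp: absolutely_integrable_on_def)
      qed (use b K t w_nonneg in auto)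
      finally show "norm (X' t - X t) \<le> c0 * 1 + norm (integral {t..} (\<lambda>s. ?f' t s - ?f t s - ?r t s))"
        unfolding eq using norm_triangle_ineq[of "integral {t..} (\<lambda>s. ?f' t s - ?f t s - ?r t s)"
            "integral {t..} (?r t)"] by linarith
      fix s assume s: "s \<in> {t..}"
      have "?f' t s - ?f t s - ?r t s = vker (expn c k) (Vcut A k) t s (X' s - X s)"
        using A(1) unfolding vker_diff
        by (cases "s \<in> A"; cases "s \<in> A'") (auto simp: vker_def Vcut_def vec_eq_iff)
      then show "norm (?f' t s - ?f t s - ?r t s) \<le> 1 / 1 * (?K * w s) * norm (X' s - X s)"
        using norm_vker_Vcut[OF \<delta> k E stA t, of s "X' s - X s"] s by simp
    next
      fix t :: real assume t: "t \<in> {0..}"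
      then show "norm (X' t - X t) \<le> (B + B') * 1"
        using norm_triangle_ineq4[of "X' t" "X t"] B[of t] B'[of t] by simp
    qed (use c0 t in auto)
    then show ?thesis
      by (simp add: c0_def mult_ac)
  qed
  show ?thesis
  proof (rule that[of "max ?b (?b * ?b * ?K)"])
    show "max ?b (?b * ?b * ?K) > 0" using b by simp
    show "norm (X t) \<le> max ?b (?b * ?b * ?K)"
      if "norm k \<ge> \<delta>" "stable E A c k" "solT A c k X"
      "\<And>t. t \<ge> 0 \<Longrightarrow> norm (X t) \<le> B" "t \<ge> 0" for c k A X B t
      using bdd[OF that] by simp
    show "norm (X' t - X t) \<le> max ?b (?b * ?b * ?K) * wmass (A' - A)"
      if "norm k \<ge> \<delta>" "A \<subseteq> A'" "A \<in> sets lebesgue" "A' \<in> sets lebesgue"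
       "stable E A' c k" "solT A c k X" "solT A' c k X'"
       "\<And>t. t \<ge> 0 \<Longrightarrow> norm (X t) \<le> B" "\<And>t. t \<ge> 0 \<Longrightarrow> norm (X' t) \<le> B'" "t \<ge> 0"
     for c k A A' X X' B B' t
    proof -
      have "wmass (A' - A) \<ge> 0"
        unfolding wmass_def using that
        by (intro integral_nonneg indicator_w_integrable) (auto intro!: mult_nonneg_nonneg w_nonneg)
      then have "(?b * ?b * ?K) * wmass (A' - A) \<le> max ?b (?b * ?b * ?K) * wmass (A' - A)"
        by (intro mult_right_mono) auto
      then show ?thesis
        using cmp[OF that] by linarith
    qed
  qed
qed

lemma solT_bounded_unique:
  assumes k: "k \<noteq> 0" and st: "stable E A c k" and E: "E \<ge> 1" and A: "A \<in> sets lebesgue"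
    and X: "solT A c k X" "\<And>t. t \<ge> 0 \<Longrightarrow> norm (X t) \<le> B"
    and X': "solT A c k X'" "\<And>t. t \<ge> 0 \<Longrightarrow> norm (X' t) \<le> B'" and t: "t \<ge> 0"
  shows "X' t = X t"
proof -
  have "norm k > 0" using k by simp
  then obtain C where "\<And>c k' A A' X X' B B' t. norm k' \<ge> norm k \<Longrightarrow> A \<subseteq> A' \<Longrightarrow> A \<in> sets lebesgue \<Longrightarrow> A' \<in> sets lebesgue \<Longrightarrow>
       stable E A' c k' \<Longrightarrow> solT A c k' X \<Longrightarrow> solT A' c k' X' \<Longrightarrow>
       (\<And>t. t \<ge> 0 \<Longrightarrow> norm (X t) \<le> B) \<Longrightarrow> (\<And>t. t \<ge> 0 \<Longrightarrow> norm (X' t) \<le> B') \<Longrightarrow> t \<ge> 0 \<Longrightarrow>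
       norm (X' t - X t) \<le> C * wmass (A' - A)"
    using solT_compare[OF _ E] by metis
  from this[OF order_refl order_refl A A st X(1) X'(1) X(2) X'(2) t]
  show ?thesis by (simp add: wmass_def)
qed

lemma Tcol_props:
  assumes k: "k \<noteq> 0" and st: "stable E A c k" and E: "E \<ge> 1" and A: "A \<in> sets lebesgue"
  shows "solT A c k (Tcol A c k)" "\<exists>B. \<forall>t\<ge>0. norm (Tcol A c k t) \<le> B"
proof -
  have "norm k > 0" using k by simp
  then obtain X B where "\<And>z. z \<in> {k} \<Longrightarrow> solT A c z (X z)"
    "\<And>z t. z \<in> {k} \<Longrightarrow> t \<ge> 0 \<Longrightarrow> norm (X z t) \<le> B"
    using solT_exists_family[of "norm k" E A "{k}" c] E A st by (metis order_refl singletonD)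
  then have "\<exists>X. solT A c k X \<and> (\<exists>B. \<forall>t\<ge>0. norm (X t) \<le> B)"
    by blast
  from someI_ex[OF this] show "solT A c k (Tcol A c k)" "\<exists>B. \<forall>t\<ge>0. norm (Tcol A c k t) \<le> B"
    unfolding Tcol_def by blast+
qed

lemma Tcol_holomorphic:
  assumes "\<delta> > 0" "E \<ge> 1" "A \<in> sets lebesgue" "open \<Omega>"
    and \<Omega>: "\<And>z. z \<in> \<Omega> \<Longrightarrow> norm z \<ge> \<delta>" "\<And>z. z \<in> \<Omega> \<Longrightarrow> stable E A c z"
    and t: "t \<ge> 0"
  shows "(\<lambda>z. Tcol A c z t $ i) holomorphic_on \<Omega>"
proof -
  obtain X B where X: "\<And>z. z \<in> \<Omega> \<Longrightarrow> solT A c z (X z)"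
    "\<And>z t. z \<in> \<Omega> \<Longrightarrow> t \<ge> 0 \<Longrightarrow> norm (X z t) \<le> B"
    "\<And>t i. open \<Omega> \<Longrightarrow> t \<ge> 0 \<Longrightarrow> (\<lambda>z. X z t $ i) holomorphic_on \<Omega>"
    using solT_exists_family[OF assms(1-3) \<Omega>] by blast
  have eq: "X z t = Tcol A c z t" if z: "z \<in> \<Omega>" for z
  proof -
    have z0: "z \<noteq> 0" using \<Omega>(1)[OF z] \<open>\<delta> > 0\<close> by auto
    note T = Tcol_props[OF z0 \<Omega>(2)[OF z] assms(2,3)]
    then obtain B' where "\<And>t. t \<ge> 0 \<Longrightarrow> norm (Tcol A c z t) \<le> B'" by blast
    from solT_bounded_unique[OF z0 \<Omega>(2)[OF z] assms(2,3) T(1) this X(1)[OF z] X(2)[OF z] t]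
    show ?thesis by simp
  qed
  show ?thesis
    by (rule holomorphic_transform[OF X(3)[OF assms(4) t]]) (simp add: eq)
qed

lemma Tcol_cut_analytic:
  assumes t: "t \<ge> 0" and R: "R \<ge> 0"
  shows "(\<lambda>z. Tcol {0..<R} c z t $ i) analytic_on - {0}"
  unfolding analytic_on_def
proof
  fix z :: complex assume "z \<in> - {0}"
  then have z: "norm z > 0" by simp
  let ?d = "norm z / 2"
  have far: "norm u \<ge> ?d" if "u \<in> cball z ?d" for u
    using norm_triangle_ineq2[of z "z - u"] that by (simp add: dist_norm)
  then have sub: "cball z ?d \<subseteq> - {0}"
    using z by force
  have "compact (eta c ` cball z ?d)"
    by (intro compact_continuous_image continuous_on_subset[OF eta_continuous sub]) auto
  then obtain M where M: "\<And>u. u \<in> cball z ?d \<Longrightarrow> norm (eta c u) \<le> M"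
    using compact_imp_bounded bounded_iff by (metis imageI)
  have "M \<ge> 0" using M[of z] z norm_ge_zero[of "eta c z"] by (auto simp del: norm_ge_zero)
  have "(\<lambda>z. Tcol {0..<R} c z t $ i) holomorphic_on ball z ?d"
  proof (rule Tcol_holomorphic[of ?d "exp (M * R)"])
    fix u assume u: "u \<in> ball z ?d"
    show "norm u \<ge> ?d" using far[of u] u by auto
    have "eta c u * R \<le> M * R"
      using M[of u] u R by (intro mult_right_mono) auto
    then show "stable (exp (M * R)) {0..<R} c u"
      by (rule stable_cut) (use R \<open>M \<ge> 0\<close> in auto)
  qed (use z t R \<open>M \<ge> 0\<close> in auto)
  then show "\<exists>e>0. (\<lambda>z. Tcol {0..<R} c z t $ i) holomorphic_on ball z e"
    using z by (intro exI[of _ ?d]) simp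
qed

lemma Tcol_analytic:
  assumes "open \<Omega>" "\<And>z. z \<in> \<Omega> \<Longrightarrow> z \<noteq> 0" "\<And>z. z \<in> \<Omega> \<Longrightarrow> eta c z \<le> 0" and t: "t \<ge> 0"
  shows "(\<lambda>z. Tcol {0..} c z t $ i) analytic_on \<Omega>"
  unfolding analytic_on_def
proof
  fix z assume z: "z \<in> \<Omega>"
  obtain e where e: "e > 0" "ball z e \<subseteq> \<Omega>"
    using assms(1) z openE by blast
  let ?d = "min e (norm z / 2)"
  have z0: "norm z > 0" using assms(2)[OF z] by simp
  have "(\<lambda>z. Tcol {0..} c z t $ i) holomorphic_on ball z ?d"
  proof (rule Tcol_holomorphic[of "norm z / 2" 1])
    fix u assume u: "u \<in> ball z ?d"
    show "norm u \<ge> norm z / 2"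
      using norm_triangle_ineq2[of z "z - u"] u by (simp add: dist_norm)
    show "stable 1 {0..} c u"
      using u e by (intro stable_halfline assms(3)) auto
  qed (use z0 t in auto)
  then show "\<exists>e>0. (\<lambda>z. Tcol {0..} c z t $ i) holomorphic_on ball z e"
    using z0 e by (intro exI[of _ ?d]) simp
qed

text \<open>
  Every solution of the equation from \<open>\<infinity>\<close> is bounded, although integrability alone only gives
  \<open>O(e\<^sup>-\<^sup>\<eta>\<^sup>t)\<close> for the off-diagonal component.
\<close>

lemma solT_bounded:
  assumes k: "k \<noteq> 0" and \<eta>: "eta c k \<le> 0" and X: "solT {0..} c k X"
  shows "\<exists>B. \<forall>t\<ge>0. norm (X t) \<le> B"
proof -
  let ?\<eta> = "eta c k" and ?o = "other c"
  let ?K = "1 + 1 / norm k"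
  have K: "?K > 0" using k by (intro add_pos_pos) auto
  interpret B: volterra "\<lambda>t. {t..}" "-1" "\<lambda>s. ?K * w s"
    using K by (intro volterra_w direction_backward) auto
  have cont: "continuous_on {0..} X"
    using X unfolding solT_def by (rule vsol_continuous[OF direction_backward])
  let ?h = "\<lambda>i s. (Vcut {0..} k s *v X s) $ i"
  have comp: "(\<lambda>s. exp (expn c k $ i * of_real (s - t)) * ?h i s) absolutely_integrable_on {t..}"
    "X t $ i = axis c 1 $ i + integral {t..} (\<lambda>s. exp (expn c k $ i * of_real (s - t)) * ?h i s)"
    if "t \<ge> 0" for t i
  proof -
    have f: "(\<lambda>s. vker (expn c k) (Vcut {0..} k) t s (X s)) absolutely_integrable_on {t..}"
      "X t = axis c 1 + integral {t..} (\<lambda>s. vker (expn c k) (Vcut {0..} k) t s (X s))"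
      using X that by (auto simp: solT_def vsol_def)
    show "(\<lambda>s. exp (expn c k $ i * of_real (s - t)) * ?h i s) absolutely_integrable_on {t..}"
      using f(1) unfolding absolutely_integrable_on_vec_iff vker_def by simp
    show "X t $ i = axis c 1 $ i + integral {t..} (\<lambda>s. exp (expn c k $ i * of_real (s - t)) * ?h i s)"
      using arg_cong[OF f(2), of "\<lambda>x. x $ i"] integral_vec_nth[OF f(1), of i]
      by (simp add: vker_def)
  qed
  define B1 where "B1 = 1 + integral {0..} (\<lambda>s. norm (?h c s))"
  have B1: "norm (X t $ c) \<le> B1" if t: "t \<ge> 0" for t
  proof -
    have h: "?h c absolutely_integrable_on {0..}" "?h c absolutely_integrable_on {t..}"
      using comp(1)[of 0 c] comp(1)[OF t, of c] by simp_all
    have "norm (integral {t..} (?h c)) \<le> integral {t..} (\<lambda>s. norm (?h c s))"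
      using h(2) by (intro Henstock_Kurzweil_Integration.integral_norm_bound_integral)
        (auto simp: absolutely_integrable_on_def)
    also have "\<dots> \<le> integral {0..} (\<lambda>s. norm (?h c s))"
      using h t by (intro integral_subset_le) (auto simp: absolutely_integrable_on_def)
    finally show ?thesis
      using comp(2)[OF t, of c] norm_triangle_ineq[of 1 "integral {t..} (?h c)"]
      by (simp add: B1_def axis_def)
  qed
  then have B1_0: "B1 \<ge> 0"
    using norm_ge_zero order_trans by blast
  define B2 where "B2 = integral {0..} (\<lambda>s. norm (exp (expn c k $ ?o * of_real s) * ?h ?o s))"
  have B2: "norm (X t $ ?o) \<le> B2 * exp (- ?\<eta> * t)" if t: "t \<ge> 0" for t
  proof -
    let ?f = "\<lambda>s. exp (expn c k $ ?o * of_real s) * ?h ?o s"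
    have f0: "?f absolutely_integrable_on {0..}"
      using comp(1)[of 0 ?o] by simp
    then have ft: "?f absolutely_integrable_on {t..}"
      by (rule set_integrable_subset) (use t in auto)
    have "X t $ ?o = integral {t..} (\<lambda>s. exp (- expn c k $ ?o * of_real t) * ?f s)"
      using comp(2)[OF t, of ?o] 
      by (simp add: axis_def mult.assoc[symmetric] exp_add[symmetric] algebra_simps
          del: integral_mult_right)
    then have "norm (X t $ ?o) = exp (- ?\<eta> * t) * norm (integral {t..} ?f)"
      using norm_exp_expn[of c k ?o "- t"] by (simp add: norm_mult)
    also have "norm (integral {t..} ?f) \<le> integral {t..} (\<lambda>s. norm (?f s))"
      using ft by (intro Henstock_Kurzweil_Integration.integral_norm_bound_integral)
        (auto simp: absolutely_integrable_on_def)
    also have "\<dots> \<le> B2"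
      unfolding B2_def
      using ft f0 t by (intro integral_subset_le) (auto simp: absolutely_integrable_on_def)
    finally show ?thesis
      by (simp add: mult.commute)
  qed
  define c0 where "c0 = ?K * B1 * integral {0..} w"
  have w_int': "w integrable_on {t..}" if "t \<ge> 0" for t
    using set_integrable_subset[OF w_int, of "{t..}"] that by (auto simp: absolutely_integrable_on_def)
  have c0: "c0 \<ge> 0"
    using K B1_0 integral_nonneg[OF w_int'[of 0]] w_nonneg by (simp add: c0_def)
  have V_le: "norm (Vcut {0..} k s $ i $ j) \<le> ?K * w s" if "s \<ge> 0" for s i j
  proof -
    have "0 \<le> ?K * w s"
      using K w_nonneg[OF that] by (intro mult_nonneg_nonneg) auto
    then have "?K * w s / 4 \<le> ?K * w s"
      using divide_left_mono[of 1 4 "?K * w s"] by simp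
    then have "norm (V s k $ i $ j) \<le> ?K * w s"
      by (rule order_trans[OF V_bound[OF that k, of i j]])
    then show ?thesis
      using that by (simp add: Vcut_def)
  qed
  have off: "norm (X t $ ?o) \<le> 2 * B.bound * c0" if t0: "t \<ge> 0" for t
  proof -
    \<comment> \<open>\<open>c0\<close> is at most \<open>c0 e\<^sup>\<eta>\<^sup>t\<close> times the growth rate \<open>e\<^sup>-\<^sup>\<eta>\<^sup>r\<close> for \<open>r \<ge> t\<close>, and at \<open>r = t\<close> the exponentials cancel\<close>
    have "norm (X t $ ?o) \<le> 2 * B.bound * (c0 * exp (?\<eta> * t)) * exp (- ?\<eta> * t)"
    proof (rule B.gronwall[where S = "{t..}" and \<gamma> = "\<lambda>t. exp (- ?\<eta> * t)" and B = B2
          and h = "\<lambda>t s. exp (expn c k $ ?o * of_real (s - t)) * (Vcut {0..} k s $ ?o $ ?o * X s $ ?o)"])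
      fix r assume r: "r \<in> {t..}"
      then have r0: "r \<ge> 0" using t0 by simp
      let ?e = "\<lambda>s. exp (expn c k $ ?o * of_real (s - r))"
      let ?f1 = "\<lambda>s. ?e s * (Vcut {0..} k s $ ?o $ c * X s $ c)"
      let ?f2 = "\<lambda>s. ?e s * (Vcut {0..} k s $ ?o $ ?o * X s $ ?o)"
      show "norm (X r $ ?o) \<le> B2 * exp (- ?\<eta> * r)"
        by (rule B2[OF r0])
      have split: "?e s * ?h ?o s = ?f1 s + ?f2 s" for s
        by (simp add: matrix_vector_mult_def sum_2_other[of _ c] algebra_simps)
      have f1_le: "norm (?f1 s) \<le> ?K * B1 * w s" if s: "s \<in> {r..}" for s
      proof -
        have s0: "s \<ge> 0" using s r0 by simp
        have "norm (?e s) \<le> 1"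
          unfolding norm_exp_expn using \<eta> s by (simp add: mult_nonpos_nonneg)
        then have "norm (?f1 s) \<le> 1 * (?K * w s * B1)"
          unfolding norm_mult
          by (intro mult_mono V_le B1 s0 mult_nonneg_nonneg) (use K w_nonneg[OF s0] in auto)
        then show ?thesis by (simp add: mult_ac)
      qed
      have f1: "?f1 absolutely_integrable_on {r..}"
      proof (rule measurable_bounded_by_integrable_imp_absolutely_integrable)
        have sub: "{r..} \<subseteq> {0..}" using r0 by auto
        have "?e \<in> borel_measurable (lebesgue_on {r..})"
          by (intro continuous_imp_measurable_on_sets_lebesgue continuous_intros) auto
        moreover have "(\<lambda>s. Vcut {0..} k s $ ?o $ c) \<in> borel_measurable (lebesgue_on {r..})"
          by (rule measurable_restrict_mono[OF Vcut_meas[OF _ k] sub]) simp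
        moreover have "(\<lambda>s. X s $ c) \<in> borel_measurable (lebesgue_on {r..})"
          by (intro continuous_imp_measurable_on_sets_lebesgue continuous_on_component
              continuous_on_subset[OF cont sub]) auto
        ultimately show "?f1 \<in> borel_measurable (lebesgue_on {r..})"
          by (intro borel_measurable_times)
        show "(\<lambda>s. ?K * B1 * w s) integrable_on {r..}"
          by (intro integrable_on_mult_right w_int' r0)
      qed (use f1_le in auto)
      have f2: "?f2 absolutely_integrable_on {r..}"
        using set_integral_diff(1)[OF comp(1)[OF r0, of ?o] f1] unfolding split by simp
      have "X r $ ?o = integral {r..} ?f1 + integral {r..} ?f2"
        using comp(2)[OF r0, of ?o] f1 f2 unfolding split
        by (simp add: axis_def Henstock_Kurzweil_Integration.integral_add absolutely_integrable_on_def)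
      moreover have "norm (integral {r..} ?f1) \<le> c0"
      proof -
        have "norm (integral {r..} ?f1) \<le> integral {r..} (\<lambda>s. ?K * B1 * w s)"
          using f1 f1_le r0
          by (intro Henstock_Kurzweil_Integration.integral_norm_bound_integral
              integrable_on_mult_right w_int') (auto simp: absolutely_integrable_on_def)
        also have "\<dots> = ?K * B1 * integral {r..} w"
          by simp
        also have "\<dots> \<le> c0"
          unfolding c0_def using K B1_0 r0 w_nonneg
          by (intro mult_left_mono integral_subset_le w_int') auto
        finally show ?thesis .
      qed
      moreover have "c0 \<le> c0 * exp (?\<eta> * t) * exp (- ?\<eta> * r)"
      proof -
        have "0 \<le> ?\<eta> * (t - r)"
          using \<eta> r by (simp add: mult_nonpos_nonpos)
        then have "1 \<le> exp (?\<eta> * t) * exp (- ?\<eta> * r)"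
          by (simp add: exp_add[symmetric] algebra_simps)
        then show ?thesis
          using mult_left_mono[OF _ c0] by (fastforce simp: mult.assoc)
      qed
      ultimately show "norm (X r $ ?o) \<le> c0 * exp (?\<eta> * t) * exp (- ?\<eta> * r) + norm (integral {r..} ?f2)"
        using norm_triangle_ineq[of "integral {r..} ?f1" "integral {r..} ?f2"] by simp
      fix s assume s: "s \<in> {r..}"
      then have s0: "s \<ge> 0" using r0 by simp
      have "norm (?f2 s) = exp (?\<eta> * (s - r)) * norm (Vcut {0..} k s $ ?o $ ?o) * norm (X s $ ?o)"
        unfolding norm_mult norm_exp_expn by simp
      also have "\<dots> \<le> exp (?\<eta> * (s - r)) * (?K * w s) * norm (X s $ ?o)"
        using V_le[OF s0] by (intro mult_left_mono mult_right_mono) auto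
      also have "exp (?\<eta> * (s - r)) = exp (- ?\<eta> * r) / exp (- ?\<eta> * s)"
        by (simp add: exp_diff[symmetric] algebra_simps)
      finally show "norm (?f2 s) \<le> exp (- ?\<eta> * r) / exp (- ?\<eta> * s) * (?K * w s) * norm (X s $ ?o)" .
    qed (use t0 c0 in auto)
    also have "\<dots> = 2 * B.bound * c0"
      by (simp add: exp_minus)
    finally show ?thesis .
  qed
  have "norm (X t) \<le> B1 + 2 * B.bound * c0" if "t \<ge> 0" for t
    using norm_vec_le_sum[of "X t"] B1[OF that] off[OF that]
    unfolding sum_2_other[of _ c] by linarith
  then show ?thesis by blast
qed

lemma Tcol_unique:
  assumes k: "k \<noteq> 0" and \<eta>: "eta c k \<le> 0" and X: "solT {0..} c k X" and t: "t \<ge> 0"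
  shows "X t = Tcol {0..} c k t"
proof -
  have st: "stable 1 {0..} c k"
    using \<eta> by (rule stable_halfline) simp
  obtain B where B: "\<And>t. t \<ge> 0 \<Longrightarrow> norm (X t) \<le> B"
    using solT_bounded[OF k \<eta> X] by blast
  note T = Tcol_props[OF k st order_refl, simplified]
  then obtain B' where B': "\<And>t. t \<ge> 0 \<Longrightarrow> norm (Tcol {0..} c k t) \<le> B'" by blast
  show ?thesis
    by (rule solT_bounded_unique[OF k st order_refl _ T(1) B' X B t]) simp_all
qed

subsection \<open>The equation from time zero\<close>

lemma norm_vker_V:
  assumes "\<delta> > 0" "norm k \<ge> \<delta>" "- eta c k \<le> \<beta>" "\<beta> \<ge> 0" "0 \<le> s" "s \<le> t"
  shows "norm (vker (expn c k) (\<lambda>s. V s k) t s x)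
     \<le> exp (\<beta> * t) / exp (\<beta> * s) * ((1 + 1 / \<delta>) * w s) * norm x"
proof -
  have "norm (vker (expn c k) (\<lambda>s. V s k) t s x)
      \<le> max 1 (exp (eta c k * (s - t))) * ((1 + 1 / \<delta>) * w s) * norm x"
    by (rule norm_vker_le)
       (use assms(1) w_nonneg[OF assms(5)] V_bound_ge[OF assms(5,1,2)] in auto)
  moreover have "max 1 (exp (eta c k * (s - t))) \<le> exp (\<beta> * (t - s))"
  proof -
    have "- eta c k * (t - s) \<le> \<beta> * (t - s)"
      using assms by (intro mult_right_mono) auto
    moreover have "0 \<le> \<beta> * (t - s)"
      using assms by simp
    ultimately show ?thesis
      by (simp add: algebra_simps)
  qed
  moreover have "exp (\<beta> * (t - s)) = exp (\<beta> * t) / exp (\<beta> * s)"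
    by (simp add: exp_diff[symmetric] algebra_simps)
  ultimately show ?thesis
    using assms(1) w_nonneg[OF assms(5)]
    by (smt (verit, best) mult_right_mono norm_ge_zero zero_le_mult_iff divide_nonneg_nonneg)
qed

lemma solU_exists_family:
  assumes "\<delta> > 0" "\<beta> \<ge> 0"
    and \<Omega>: "\<And>z. z \<in> \<Omega> \<Longrightarrow> norm z \<ge> \<delta>" "\<And>z. z \<in> \<Omega> \<Longrightarrow> - eta c z \<le> \<beta>"
  obtains X where "\<And>z. z \<in> \<Omega> \<Longrightarrow> solU c z (X z)"
    "\<And>t i. open \<Omega> \<Longrightarrow> t \<ge> 0 \<Longrightarrow> (\<lambda>z. X z t $ i) holomorphic_on \<Omega>"
proof -
  interpret B: volterra "\<lambda>t. {0..t}" 1 "\<lambda>s. (1 + 1 / \<delta>) * w s"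
    using assms by (intro volterra_w direction_forward) auto
  have ne: "z \<noteq> 0" if "z \<in> \<Omega>" for z
    using \<Omega>(1)[OF that] \<open>\<delta> > 0\<close> by auto
  then have sub: "\<Omega> \<subseteq> - {0}" by auto
  have dom: "B.dominated (\<lambda>t. exp (\<beta> * t)) (expn c z) (\<lambda>s. V s z)" if "z \<in> \<Omega>" for z
    unfolding B.dominated_def using norm_vker_V[OF assms(1) \<Omega>(1)[OF that] \<Omega>(2)[OF that] assms(2)] by simp
  have meas: "(\<lambda>s. V s z $ i $ j) \<in> borel_measurable (lebesgue_on {0..})" if "z \<in> \<Omega>" for z i j
    by (rule V_meas[OF ne[OF that]])
  obtain X where X: "\<And>z. z \<in> \<Omega> \<Longrightarrow> vsol (\<lambda>t. {0..t}) (axis c 1) (expn c z) (\<lambda>s. V s z) (X z)"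
    "\<And>t i. open \<Omega> \<Longrightarrow> (\<And>i. (\<lambda>z. expn c z $ i) holomorphic_on \<Omega>) \<Longrightarrow>
      (\<And>s i j. s \<ge> 0 \<Longrightarrow> (\<lambda>z. V s z $ i $ j) holomorphic_on \<Omega>) \<Longrightarrow>
      t \<ge> 0 \<Longrightarrow> (\<lambda>z. X z t $ i) holomorphic_on \<Omega>"
    by (rule B.vsol_exists_holomorphic[of \<Omega> "\<lambda>t. exp (\<beta> * t)" "expn c" "\<lambda>z s. V s z" "axis c 1"])
       (use assms(2) dom meas in \<open>auto intro!: continuous_intros\<close>)
  show ?thesis
  proof (rule that[of X])
    show "solU c z (X z)" if "z \<in> \<Omega>" for z
      unfolding solU_def by (rule X(1)[OF that])
    show "(\<lambda>z. X z t $ i) holomorphic_on \<Omega>" if "open \<Omega>" "t \<ge> 0" for t i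
      by (rule X(2)[OF that(1) _ _ that(2)])
         (auto intro: holomorphic_on_subset[OF expn_holo sub] holomorphic_on_subset[OF V_holo sub])
  qed
qed

lemma solU_bound:
  assumes \<delta>: "\<delta> > 0"
  obtains C where "C > 0"
    "\<And>c k X t. norm k \<ge> \<delta> \<Longrightarrow> solU c k X \<Longrightarrow> t \<ge> 0 \<Longrightarrow> norm (X t) \<le> C * exp (max 0 (- eta c k) * t)"
    "\<And>c k X Y t. norm k \<ge> \<delta> \<Longrightarrow> solU c k X \<Longrightarrow> solU c k Y \<Longrightarrow> t \<ge> 0 \<Longrightarrow> X t = Y t"
proof -
  interpret B: volterra "\<lambda>t. {0..t}" 1 "\<lambda>s. (1 + 1 / \<delta>) * w s"
    using assms by (intro volterra_w direction_forward) auto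
  have key: "norm (X t) \<le> 2 * B.bound * d * exp (max 0 (- eta c k) * t)"
    if k: "norm k \<ge> \<delta>" and X: "continuous_on {0..} X" and d: "d \<ge> 0" "\<And>t. t \<ge> 0 \<Longrightarrow> 
        norm (X t) \<le> d + norm (integral {0..t} (\<lambda>s. vker (expn c k) (\<lambda>s. V s k) t s (X s)))"
      and t: "t \<ge> 0" for c k X d t
  proof -
    let ?\<beta> = "max 0 (- eta c k)"
    have "compact (X ` {0..t})"
      by (intro compact_continuous_image continuous_on_subset[OF X]) auto
    then obtain M where M: "\<And>s. s \<in> {0..t} \<Longrightarrow> norm (X s) \<le> M"
      using compact_imp_bounded bounded_iff by (metis imageI)
    have ge1: "1 \<le> exp (?\<beta> * s)" if "s \<ge> 0" for s
      using that by simp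
    show ?thesis
    proof (rule B.gronwall[where S = "{0..t}" and \<gamma> = "\<lambda>t. exp (?\<beta> * t)" and B = M
          and h = "\<lambda>t s. vker (expn c k) (\<lambda>s. V s k) t s (X s)"])
      fix r assume r: "r \<in> {0..t}"
      have "0 \<le> M" using M[OF r] norm_ge_zero order_trans by blast
      then have "M * 1 \<le> M * exp (?\<beta> * r)"
        using ge1[of r] r by (intro mult_left_mono) auto
      then show "norm (X r) \<le> M * exp (?\<beta> * r)"
        using M[OF r] by simp
      have "d * 1 \<le> d * exp (?\<beta> * r)"
        using ge1[of r] r d by (intro mult_left_mono) auto
      then show "norm (X r) \<le> d * exp (?\<beta> * r) +
          norm (integral {0..r} (\<lambda>s. vker (expn c k) (\<lambda>s. V s k) r s (X s)))"
        using d(2)[of r] r by simp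
      fix s assume "s \<in> {0..r}"
      then show "norm (vker (expn c k) (\<lambda>s. V s k) r s (X s))
          \<le> exp (?\<beta> * r) / exp (?\<beta> * s) * ((1 + 1 / \<delta>) * w s) * norm (X s)"
        by (intro norm_vker_V \<delta> k) auto
    qed (use d t in auto)
  qed
  show ?thesis
  proof (rule that[of "2 * B.bound"])
    show "2 * B.bound > 0" using B.bound_ge_1 by simp
    fix c k X t assume k: "norm k \<ge> \<delta>" and X: "solU c k X" and t: "(t::real) \<ge> 0"
    have cX: "continuous_on {0..} X"
      using X unfolding solU_def by (rule vsol_continuous[OF direction_forward])
    have eq: "(\<lambda>s. vker (expn c k) (\<lambda>s. V s k) t s (X s)) absolutely_integrable_on {0..t}"
      "X t = axis c 1 + integral {0..t} (\<lambda>s. vker (expn c k) (\<lambda>s. V s k) t s (X s))"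
      if "t \<ge> 0" for t
      using X that by (auto simp: solU_def vsol_def)
    have "norm (X t) \<le> 2 * B.bound * 1 * exp (max 0 (- eta c k) * t)"
    proof (rule key[OF k cX _ _ t])
      fix t :: real assume "t \<ge> 0"
      from eq(2)[OF this]
      show "norm (X t) \<le> 1 + norm (integral {0..t} (\<lambda>s. vker (expn c k) (\<lambda>s. V s k) t s (X s)))"
        by (metis norm_axis_1 norm_triangle_ineq)
    qed simp
    then show "norm (X t) \<le> 2 * B.bound * exp (max 0 (- eta c k) * t)" by simp
    fix Y assume Y: "solU c k Y"
    have cY: "continuous_on {0..} Y"
      using Y unfolding solU_def by (rule vsol_continuous[OF direction_forward])
    have eqY: "(\<lambda>s. vker (expn c k) (\<lambda>s. V s k) t s (Y s)) absolutely_integrable_on {0..t}"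
      "Y t = axis c 1 + integral {0..t} (\<lambda>s. vker (expn c k) (\<lambda>s. V s k) t s (Y s))"
      if "t \<ge> 0" for t
      using Y that by (auto simp: solU_def vsol_def)
    have "norm (X t - Y t) \<le> 2 * B.bound * 0 * exp (max 0 (- eta c k) * t)"
    proof (rule key[OF k _ _ _ t])
      show "continuous_on {0..} (\<lambda>t. X t - Y t)"
        by (intro continuous_intros cX cY)
      fix t :: real assume t: "t \<ge> 0"
      have "X t - Y t = integral {0..t} (\<lambda>s. vker (expn c k) (\<lambda>s. V s k) t s (X s - Y s))"
        unfolding vker_diff
        using eq[OF t] eqY[OF t]
        by (subst Henstock_Kurzweil_Integration.integral_diff)
           (auto simp only: absolutely_integrable_on_def add_diff_cancel_left)
      then show "norm (X t - Y t)
          \<le> 0 + norm (integral {0..t} (\<lambda>s. vker (expn c k) (\<lambda>s. V s k) t s (X s - Y s)))"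
        by simp
    qed simp
    then show "X t = Y t" by simp
  qed
qed

lemma solU_unique:
  assumes "k \<noteq> 0" "solU c k X" "solU c k Y" "t \<ge> 0"
  shows "X t = Y t"
proof -
  have "norm k > 0" using assms(1) by simp
  from solU_bound[OF this] show ?thesis
    using assms by (metis order_refl)
qed

lemma Ucol_props:
  assumes "k \<noteq> 0"
  shows "solU c k (Ucol c k)"
proof -
  have "norm k > 0" using assms by simp
  then obtain X where "\<And>z. z \<in> {k} \<Longrightarrow> solU c z (X z)"
    using solU_exists_family[of "norm k" "max 0 (- eta c k)" "{k}" c]
    by (metis max.cobounded1 max.cobounded2 order_refl singletonD)
  then have "\<exists>X. solU c k X" by blast
  from someI_ex[OF this] show ?thesis unfolding Ucol_def .
qed

lemma Ucol_analytic:
  assumes t: "t \<ge> 0"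
  shows "(\<lambda>z. Ucol c z t $ i) analytic_on - {0}"
  unfolding analytic_on_def
proof
  fix z :: complex assume "z \<in> - {0}"
  then have z: "norm z > 0" by simp
  let ?d = "norm z / 2"
  have far: "norm u \<ge> ?d" if "u \<in> cball z ?d" for u
    using norm_triangle_ineq2[of z "z - u"] that by (simp add: dist_norm)
  then have sub: "cball z ?d \<subseteq> - {0}"
    using z by force
  have "compact (eta c ` cball z ?d)"
    by (intro compact_continuous_image continuous_on_subset[OF eta_continuous sub]) auto
  then obtain M where M: "\<And>u. u \<in> cball z ?d \<Longrightarrow> norm (eta c u) \<le> M"
    using compact_imp_bounded bounded_iff by (metis imageI)
  have bds: "norm u \<ge> ?d" "- eta c u \<le> max 0 M" if "u \<in> ball z ?d" for u
    using far[of u] M[of u] that by auto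
  have "?d > 0" using z by simp
  then obtain X where X: "\<And>u. u \<in> ball z ?d \<Longrightarrow> solU c u (X u)"
    "\<And>t i. t \<ge> 0 \<Longrightarrow> (\<lambda>u. X u t $ i) holomorphic_on ball z ?d"
    using solU_exists_family[of ?d "max 0 M" "ball z ?d" c] bds
    by (metis max.cobounded1 open_ball)
  have "(\<lambda>z. Ucol c z t $ i) holomorphic_on ball z ?d"
  proof (rule holomorphic_transform[OF X(2)[OF t]])
    fix u assume u: "u \<in> ball z ?d"
    then have "u \<noteq> 0" using bds(1)[OF u] z by auto
    then show "X u t $ i = Ucol c u t $ i"
      using solU_unique[OF _ X(1)[OF u] Ucol_props t] by simp
  qed
  then show "\<exists>e>0. (\<lambda>z. Ucol c z t $ i) holomorphic_on ball z e"
    using z by (intro exI[of _ ?d]) simp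
qed

end

section \<open>Derivatives in the spectral parameter\<close>

lemma eta_lipschitz:
  assumes \<delta>: "\<delta> > 0"
  obtains \<rho> where "0 < \<rho>" "\<rho> \<le> 1" 
    "\<And>c k z r. norm k \<ge> \<delta> \<Longrightarrow> r \<le> 1 \<Longrightarrow> dist k z \<le> \<rho> * r \<Longrightarrow>
        norm z \<ge> \<delta> / 2 \<and> \<bar>eta c z - eta c k\<bar> \<le> r / 2"
proof -
  let ?L = "1 + 2 / \<delta>\<^sup>2"
  have L: "?L \<ge> 1" "?L > 0" using \<delta> by (auto intro: add_pos_pos)
  let ?\<rho> = "min (\<delta> / 2) (1 / ?L)"
  show ?thesis
  proof (rule that[of ?\<rho>])
    show "0 < ?\<rho>" using \<delta> L by auto
    have "1 / ?L \<le> 1" using L by (simp add: divide_le_eq)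
    then show "?\<rho> \<le> 1" by linarith
    fix c and k z :: complex and r :: real assume k: "norm k \<ge> \<delta>" and r: "r \<le> 1" and d: "dist k z \<le> ?\<rho> * r"
    have r0: "r \<ge> 0"
      using d zero_le_dist[of k z] \<open>0 < ?\<rho>\<close> by (meson order_trans zero_le_mult_iff not_le)
    have "?\<rho> * r \<le> ?\<rho> * 1"
      using \<open>0 < ?\<rho>\<close> r by (intro mult_left_mono) auto
    then have "dist k z \<le> \<delta> / 2"
      using d by linarith
    then have z: "norm z \<ge> \<delta> / 2"
      using k norm_triangle_ineq2[of k "k - z"] by (simp add: dist_norm)
    have nz: "z \<noteq> 0" "k \<noteq> 0" using z k \<delta> by auto
    have "theta2 z - theta2 k = (z - k) * (1 - 1 / (z * k)) / 4"
      using nz by (simp add: theta2_def field_simps)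
    then have "norm (theta2 z - theta2 k) = dist k z * norm (1 - 1 / (z * k)) / 4"
      by (simp only: norm_mult norm_divide dist_norm norm_minus_commute[of k z] norm_numeral)
    also have "\<dots> \<le> (?\<rho> * r) * ?L / 4"
    proof (intro divide_right_mono mult_mono d)
      have "\<delta> / 2 * \<delta> \<le> norm z * norm k"
        using z k \<delta> by (intro mult_mono) auto
      then have "1 / (norm z * norm k) \<le> 1 / (\<delta> / 2 * \<delta>)"
        using \<delta> by (intro divide_left_mono) (auto intro: mult_pos_pos simp: nz)
      then have "norm (1 / (z * k)) \<le> 2 / \<delta>\<^sup>2"
        by (simp add: norm_divide norm_mult power2_eq_square)
      then show "norm (1 - 1 / (z * k)) \<le> ?L"
        using norm_triangle_ineq4[of 1 "1 / (z * k)"] by simp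
    qed (use \<open>0 < ?\<rho>\<close> r0 in auto)
    also have "\<dots> \<le> (1 / ?L * r) * ?L / 4"
      using L r0 by (intro divide_right_mono mult_right_mono) auto
    also have "\<dots> = r / 4"
      using L by simp
    finally have "\<bar>Im (theta2 z - theta2 k)\<bar> \<le> r / 4"
      using abs_Im_le_cmod order_trans by blast
    moreover have "\<bar>eta c z - eta c k\<bar> = 2 * \<bar>Im (theta2 z - theta2 k)\<bar>"
      using sg_cases[of c] by (auto simp: eta_def abs_if)
    ultimately show "norm z \<ge> \<delta> / 2 \<and> \<bar>eta c z - eta c k\<bar> \<le> r / 2"
      using z by simp
  qed
qed

text \<open>
  Cauchy's inequality on a disc of radius \<open>\<rho> r\<close>, with a constant that serves for all \<open>j \<le> n\<close>.
\<close>

lemma Cauchy_inequality_scaled: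
  assumes f: "f analytic_on - {0}" and \<rho>: "0 < \<rho>" "\<rho> \<le> 1" and r: "r > 0" and j: "j \<le> n"
    and B: "\<And>z. dist k z \<le> \<rho> * r \<Longrightarrow> z \<noteq> 0 \<and> norm (f z) \<le> B"
  shows "norm ((deriv ^^ j) f k) \<le> fact n * B / \<rho> ^ n / r ^ j"
proof -
  have sub: "cball k (\<rho> * r) \<subseteq> - {0}"
    using B by (metis ComplI mem_cball singletonD subsetI)
  have B0: "B \<ge> 0"
    using B[of k] \<rho> r norm_ge_zero[of "f k"] by (auto simp del: norm_ge_zero)
  have "norm ((deriv ^^ j) f k) \<le> fact j * B / (\<rho> * r) ^ j"
  proof (rule Cauchy_inequality)
    have holo: "f holomorphic_on - {0}"
      using f by (rule analytic_imp_holomorphic)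
    then show "f holomorphic_on ball k (\<rho> * r)"
      using sub ball_subset_cball holomorphic_on_subset by blast
    show "continuous_on (cball k (\<rho> * r)) f"
      using holo sub holomorphic_on_imp_continuous_on holomorphic_on_subset by blast
  qed (use B \<rho> r in \<open>auto simp: dist_norm\<close>)
  also have "\<dots> = fact j * B / \<rho> ^ j / r ^ j"
    by (simp add: power_mult_distrib)
  also have "\<dots> \<le> fact n * B / \<rho> ^ n / r ^ j"
  proof -
    have "\<rho> ^ n \<le> \<rho> ^ j"
      using \<rho> j by (intro power_decreasing) auto
    then have "fact j * B / \<rho> ^ j \<le> fact n * B / \<rho> ^ n"
      using \<rho> B0 j by (intro frac_le mult_right_mono fact_mono) auto
    then show ?thesis
      using r by (intro divide_right_mono) auto
  qed
  finally show ?thesis .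
qed

context potential
begin

lemma wmass_le:
  assumes A: "A \<in> sets lebesgue" and a: "a > 0" "\<And>s. s \<in> A \<Longrightarrow> s \<ge> 0 \<Longrightarrow> a \<le> 1 + s"
  shows "wmass A \<le> integral {0..} (\<lambda>s. indicator A s * ((1 + s) ^ n * w s)) / a ^ n"
proof -
  have int: "(\<lambda>s. indicator A s * ((1 + s) ^ n * w s)) absolutely_integrable_on {0..}"
    using integrable_mult_indicator[of A lebesgue "\<lambda>s. indicator {0..} s *\<^sub>R ((1 + s) ^ n * w s)"] w_moment A
    unfolding set_integrable_def by (simp add: mult_ac)
  have "wmass A \<le> integral {0..} (\<lambda>s. indicator A s * ((1 + s) ^ n * w s) / a ^ n)"
    unfolding wmass_def
  proof (rule integral_le[OF indicator_w_integrable[OF A]])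
    show "(\<lambda>s. indicator A s * ((1 + s) ^ n * w s) / a ^ n) integrable_on {0..}"
      using int by (intro integrable_on_divide) (auto simp: absolutely_integrable_on_def)
    fix s :: real assume s: "s \<in> {0..}"
    show "indicator A s * w s \<le> indicator A s * ((1 + s) ^ n * w s) / a ^ n"
    proof (cases "s \<in> A")
      case True
      then have "a ^ n \<le> (1 + s) ^ n"
        using a s by (intro power_mono) auto
      then have "a ^ n * w s \<le> (1 + s) ^ n * w s"
        using w_nonneg s by (intro mult_right_mono) auto
      then show ?thesis
        using a True by (simp add: pos_le_divide_eq mult.commute)
    qed simp
  qed
  then show ?thesis by simp
qed

text \<open>
  Dyadic times: on the shell \<open>[Rd m, Rd (m+1))\<close> the factor \<open>1 + s\<close> is comparable to \<open>2\<^sup>m\<close>.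
\<close>

definition Rd :: "nat \<Rightarrow> real" where "Rd m = 2 ^ m - 1"

definition shell :: "nat \<Rightarrow> real set" where "shell m = {Rd m..<Rd (Suc m)}"

text \<open>The \<open>n\<close>-th moment of \<open>w\<close> on the shell.\<close>

definition shell_mass :: "nat \<Rightarrow> real" where
  "shell_mass m = integral {0..} (\<lambda>s. indicator (shell m) s * ((1 + s) ^ n * w s))"

lemma Rd_nonneg [simp]: "Rd m \<ge> 0"
  by (simp add: Rd_def)

lemma shell_sets [simp]: "shell m \<in> sets lebesgue"
  by (simp add: shell_def)

lemma shell_integrable: "(\<lambda>s. indicator (shell m) s * ((1 + s) ^ n * w s)) integrable_on {0..}"
  using integrable_mult_indicator[of "shell m" lebesgue "\<lambda>s. indicator {0..} s *\<^sub>R ((1 + s) ^ n * w s)"] w_moment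
  unfolding set_integrable_def
  by (intro set_lebesgue_integral_eq_integral(1)) (simp add: set_integrable_def mult_ac)

lemma shell_mass_nonneg: "shell_mass m \<ge> 0"
  unfolding shell_mass_def
  by (intro integral_nonneg shell_integrable mult_nonneg_nonneg w_nonneg) auto

lemma sum_shell_mass_le: "(\<Sum>m<N. shell_mass m) \<le> integral {0..} (\<lambda>s. (1 + s) ^ n * w s)"
proof -
  have "(\<Sum>m<N. shell_mass m) = integral {0..} (\<lambda>s. \<Sum>m<N. indicator (shell m) s * ((1 + s) ^ n * w s))"
    unfolding shell_mass_def by (intro integral_sum[symmetric] shell_integrable) auto
  also have "\<dots> \<le> integral {0..} (\<lambda>s. (1 + s) ^ n * w s)"
  proof (rule integral_le)
    show "(\<lambda>s. \<Sum>m<N. indicator (shell m) s * ((1 + s) ^ n * w s)) integrable_on {0..}"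
      by (intro integrable_sum shell_integrable) auto
    show "(\<lambda>s. (1 + s) ^ n * w s) integrable_on {0..}"
      using w_moment by (simp add: absolutely_integrable_on_def)
    fix s :: real assume s: "s \<in> {0..}"
    have "(\<Sum>m<N. indicator (shell m) s) = (indicator {Rd 0..<Rd N} s :: real)"
    proof (induction N)
      case (Suc N)
      have "Rd 0 \<le> Rd N" "Rd N \<le> Rd (Suc N)" by (auto simp: Rd_def)
      then show ?case
        using Suc by (auto simp: shell_def indicator_def)
    qed simp
    also have "\<dots> \<le> 1" by (simp add: indicator_def)
    finally have "(\<Sum>m<N. indicator (shell m) s) * ((1 + s) ^ n * w s) \<le> 1 * ((1 + s) ^ n * w s)"
      using s w_nonneg by (intro mult_right_mono) auto
    then show "(\<Sum>m<N. indicator (shell m) s * ((1 + s) ^ n * w s)) \<le> (1 + s) ^ n * w s"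
      by (simp add: sum_distrib_right)
  qed
  finally show ?thesis .
qed

lemma summable_shell_mass: "summable shell_mass"
proof (rule bounded_imp_summable[of _ "integral {0..} (\<lambda>s. (1 + s) ^ n * w s)"])
  show "(\<Sum>k\<le>m. shell_mass k) \<le> integral {0..} (\<lambda>s. (1 + s) ^ n * w s)" for m
    using sum_shell_mass_le[of "Suc m"] by (simp add: lessThan_Suc_atMost)
qed (rule shell_mass_nonneg)

lemma wmass_shell_le: "wmass (shell m) \<le> shell_mass m / (2 ^ m) ^ n"
  unfolding shell_mass_def by (rule wmass_le) (auto simp: shell_def Rd_def)

lemma stable_shell:
  assumes "eta c z \<le> (1 / 2 ^ m) / 2"
  shows "stable (exp 1) {0..<Rd (Suc m)} c z"
proof (rule stable_cut)
  have "eta c z * Rd (Suc m) \<le> (1 / 2 ^ m) / 2 * Rd (Suc m)"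
    using assms by (intro mult_right_mono) auto
  also have "\<dots> \<le> 1"
    by (simp add: Rd_def field_simps)
  finally show "eta c z * Rd (Suc m) \<le> 1" .
qed auto

text \<open>
  \<open>Delta c m t\<close> is the contribution of the \<open>m\<close>-th shell to \<open>T(t,\<cdot>) - I\<close>. It is analytic in \<open>k \<noteq> 0\<close>,
  and up to a distance of order \<open>2\<^sup>-\<^sup>m\<close> beyond the domain of \<open>T\<close> it is bounded, locally uniformly
  in \<open>k \<noteq> 0\<close>, by a multiple of the mass of \<open>w\<close> on the shell.
\<close>

definition Delta :: "2 \<Rightarrow> nat \<Rightarrow> real \<Rightarrow> 2 \<Rightarrow> complex \<Rightarrow> complex" where
  "Delta c m t i z = Tcol {0..<Rd (Suc m)} c z t $ i - Tcol {0..<Rd m} c z t $ i"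

lemma Delta_analytic: "t \<ge> 0 \<Longrightarrow> Delta c m t i analytic_on - {0}"
  unfolding Delta_def by (intro analytic_intros Tcol_cut_analytic) auto

lemma stable_cut_exists: "\<exists>E\<ge>1. stable E {0..<R} c k"
proof -
  have "stable (exp (max 0 (eta c k * R))) {0..<R} c k"
    by (rule stable_cut[where R = R]) auto
  then show ?thesis by (intro exI[of _ "exp (max 0 (eta c k * R))"]) auto
qed

lemma Tcol_beyond_cut:
  assumes "k \<noteq> 0" "t \<ge> 0" "t \<ge> R"
  shows "Tcol {0..<R} c k t = axis c 1"
proof -
  obtain E where "E \<ge> 1" "stable E {0..<R} c k" using stable_cut_exists by blast
  then have "solT {0..<R} c k (Tcol {0..<R} c k)"
    using Tcol_props[OF assms(1)] by auto
  then have "Tcol {0..<R} c k t = axis c 1 +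
      integral {t..} (\<lambda>s. vker (expn c k) (Vcut {0..<R} k) t s (Tcol {0..<R} c k s))"
    using assms(2) by (simp add: solT_def vsol_def)
  also have "integral {t..} (\<lambda>s. vker (expn c k) (Vcut {0..<R} k) t s (Tcol {0..<R} c k s)) = integral {t..} (\<lambda>s. 0)"
    by (rule integral_cong) (use assms(3) in \<open>auto simp: vker_def Vcut_def vec_eq_iff\<close>)
  finally show ?thesis by simp
qed

lemma Delta_deriv_bound:
  assumes \<delta>: "\<delta> > 0"
  obtains C where "C > 0" "\<And>c k t m i j. norm k \<ge> \<delta> \<Longrightarrow> eta c k \<le> 0 \<Longrightarrow> t \<ge> 0 \<Longrightarrow> j \<le> n \<Longrightarrow>
     norm ((deriv ^^ j) (Delta c m t i) k) \<le> C / (1 + t) ^ (n - j) * shell_mass m"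
proof -
  obtain \<rho> where \<rho>: "0 < \<rho>" "\<rho> \<le> 1"
    "\<And>c k z r. norm k \<ge> \<delta> \<Longrightarrow> r \<le> 1 \<Longrightarrow> dist k z \<le> \<rho> * r \<Longrightarrow>
        norm z \<ge> \<delta> / 2 \<and> \<bar>eta c z - eta c k\<bar> \<le> r / 2"
    using eta_lipschitz[OF \<delta>] by metis
  have "\<delta> / 2 > 0" using \<delta> by simp
  from solT_compare[OF this, of "exp 1"] obtain C where C: "C > 0"
    "\<And>c k A A' X X' B B' t. norm k \<ge> \<delta> / 2 \<Longrightarrow> A \<subseteq> A' \<Longrightarrow> A \<in> sets lebesgue \<Longrightarrow> A' \<in> sets lebesgue \<Longrightarrow>
       stable (exp 1) A' c k \<Longrightarrow> solT A c k X \<Longrightarrow> solT A' c k X' \<Longrightarrow>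
       (\<And>t. t \<ge> 0 \<Longrightarrow> norm (X t) \<le> B) \<Longrightarrow> (\<And>t. t \<ge> 0 \<Longrightarrow> norm (X' t) \<le> B') \<Longrightarrow> t \<ge> 0 \<Longrightarrow>
       norm (X' t - X t) \<le> C * wmass (A' - A)"
    by (metis one_le_exp_iff zero_le_one)
  let ?C = "fact n * C / \<rho> ^ n * 2 ^ n"
  show ?thesis
  proof (rule that[of ?C])
    show "?C > 0" using C \<rho> by simp
    fix c k t m i j
    assume k: "norm k \<ge> \<delta>" "eta c k \<le> 0" and t: "(t::real) \<ge> 0" and j: "j \<le> n"
    \<comment> \<open>at times past the shell both cut-off solutions are the identity\<close>
    define B where "B = (if 1 + t \<ge> 2 ^ Suc m then 0 else C * wmass (shell m))"
    have "norm ((deriv ^^ j) (Delta c m t i) k) \<le> fact n * B / \<rho> ^ n / (1 / 2 ^ m) ^ j"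
    proof (rule Cauchy_inequality_scaled[OF Delta_analytic[OF t] \<rho>(1,2) _ j])
      fix z assume "dist k z \<le> \<rho> * (1 / 2 ^ m)"
      then have z: "norm z \<ge> \<delta> / 2" "\<bar>eta c z - eta c k\<bar> \<le> (1 / 2 ^ m) / 2"
        using \<rho>(3)[OF k(1), of "1 / 2 ^ m" z c] by auto
      then have z0: "z \<noteq> 0" using \<delta> by auto
      have st': "stable (exp 1) {0..<Rd (Suc m)} c z"
        by (rule stable_shell) (use z(2) k(2) in linarith)
      have sub: "{0..<Rd m} \<subseteq> {0..<Rd (Suc m)}"
        by (auto simp: Rd_def)
      have st: "stable (exp 1) {0..<Rd m} c z"
        by (rule stable_mono[OF st' sub])
      have e: "exp (1::real) \<ge> 1" by simp
      note P = Tcol_props[OF z0 st e] and P' = Tcol_props[OF z0 st' e]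
      obtain b b' where b: "\<And>t. t \<ge> 0 \<Longrightarrow> norm (Tcol {0..<Rd m} c z t) \<le> b"
        "\<And>t. t \<ge> 0 \<Longrightarrow> norm (Tcol {0..<Rd (Suc m)} c z t) \<le> b'"
        using P(2) P'(2) by auto
      have "norm (Tcol {0..<Rd (Suc m)} c z t - Tcol {0..<Rd m} c z t)
          \<le> C * wmass ({0..<Rd (Suc m)} - {0..<Rd m})"
        by (rule C(2)[OF z(1) sub _ _ st' P(1) P'(1) b t]) auto
      moreover have "{0..<Rd (Suc m)} - {0..<Rd m} = shell m"
        using Rd_nonneg[of m] unfolding shell_def by (auto simp del: Rd_nonneg)
      ultimately have "norm (Delta c m t i z) \<le> C * wmass (shell m)"
        using Finite_Cartesian_Product.norm_nth_le
          [of "Tcol {0..<Rd (Suc m)} c z t - Tcol {0..<Rd m} c z t" i]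
        by (simp add: Delta_def)
      moreover have "Delta c m t i z = 0" if "1 + t \<ge> 2 ^ Suc m"
      proof -
        have "t \<ge> Rd (Suc m)" using that by (simp add: Rd_def)
        moreover have "Rd m \<le> Rd (Suc m)" by (simp add: Rd_def)
        ultimately show ?thesis
          using z0 t by (simp add: Delta_def Tcol_beyond_cut)
      qed
      ultimately show "z \<noteq> 0 \<and> norm (Delta c m t i z) \<le> B"
        using z0 by (simp add: B_def)
    qed simp
    also have "\<dots> \<le> ?C / (1 + t) ^ (n - j) * shell_mass m"
    proof (cases "1 + t \<ge> 2 ^ Suc m")
      case True
      then have "B = 0" by (simp add: B_def)
      then show ?thesis
        using C(1) \<rho>(1) t shell_mass_nonneg[of m] by simp
    next
      case False
      then have t2: "(1 + t) / 2 \<le> 2 ^ m" by simp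
      have "B = C * wmass (shell m)"
        using False by (simp add: B_def)
      then have "B * (2 ^ m) ^ j \<le> C * (shell_mass m / (2 ^ m) ^ n) * (2 ^ m) ^ j"
        using C(1) by (simp only:) (intro mult_right_mono mult_left_mono wmass_shell_le, auto)
      also have "\<dots> = C * shell_mass m / (2 ^ m) ^ (n - j)"
      proof -
        have "(2 ^ m :: real) ^ n = (2 ^ m) ^ (n - j) * (2 ^ m) ^ j"
          using j by (metis le_add_diff_inverse2 power_add)
        then show ?thesis
          by (simp only:) simp
      qed
      also have "\<dots> \<le> C * shell_mass m / ((1 + t) / 2) ^ (n - j)"
        using t2 t C(1) shell_mass_nonneg[of m]
        by (intro divide_left_mono power_mono mult_nonneg_nonneg mult_pos_pos zero_less_power) auto
      also have "\<dots> = C * shell_mass m * 2 ^ (n - j) / (1 + t) ^ (n - j)"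
        by (simp add: power_divide)
      also have "\<dots> \<le> C * shell_mass m * 2 ^ n / (1 + t) ^ (n - j)"
        using t C(1) shell_mass_nonneg[of m]
        by (intro divide_right_mono mult_left_mono power_increasing) auto
      finally have "fact n / \<rho> ^ n * (B * (2 ^ m) ^ j) \<le>
          fact n / \<rho> ^ n * (C * shell_mass m * 2 ^ n / (1 + t) ^ (n - j))"
        using \<rho>(1) by (intro mult_left_mono) auto
      then show ?thesis
        by (simp add: power_divide mult_ac)
    qed
    finally show "norm ((deriv ^^ j) (Delta c m t i) k) \<le> ?C / (1 + t) ^ (n - j) * shell_mass m" .
  qed
qed

text \<open>
  The \<open>j\<close>-th \<open>k\<close>-derivative of \<open>T - I\<close>, continued to the boundary of the domain of \<open>T\<close>.
\<close>

definition Tderiv :: "2 \<Rightarrow> real \<Rightarrow> nat \<Rightarrow> complex \<Rightarrow> complex^2" where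
  "Tderiv c t j k = (\<chi> i. \<Sum>m. (deriv ^^ j) (Delta c m t i) k)"

lemma summable_Delta_deriv:
  assumes "k \<noteq> 0" "eta c k \<le> 0" "t \<ge> 0" "j \<le> n"
  shows "summable (\<lambda>m. norm ((deriv ^^ j) (Delta c m t i) k))"
proof -
  have "norm k > 0" using assms by simp
  then obtain C where C: "\<And>m. norm ((deriv ^^ j) (Delta c m t i) k) \<le> C / (1 + t) ^ (n - j) * shell_mass m"
    using Delta_deriv_bound[of "norm k"] assms by (metis order_refl)
  show ?thesis
    by (rule summable_comparison_test[OF _ summable_mult[OF summable_shell_mass, of "C / (1 + t) ^ (n - j)"]])
       (use C in auto)
qed

lemma Tderiv_bound:
  assumes \<delta>: "\<delta> > 0"
  obtains C where "C > 0" "\<And>c k t j. norm k \<ge> \<delta> \<Longrightarrow> eta c k \<le> 0 \<Longrightarrow> t \<ge> 0 \<Longrightarrow> j \<le> n \<Longrightarrow>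
     norm (Tderiv c t j k) \<le> C / (1 + t) ^ (n - j)"
proof -
  obtain C where C: "C > 0" "\<And>c k t m i j. norm k \<ge> \<delta> \<Longrightarrow> eta c k \<le> 0 \<Longrightarrow> t \<ge> 0 \<Longrightarrow> j \<le> n \<Longrightarrow>
     norm ((deriv ^^ j) (Delta c m t i) k) \<le> C / (1 + t) ^ (n - j) * shell_mass m"
    using Delta_deriv_bound[OF \<delta>] by metis
  let ?M = "suminf shell_mass"
  have M: "?M \<ge> 0" by (intro suminf_nonneg summable_shell_mass shell_mass_nonneg)
  show ?thesis
  proof (rule that[of "2 * C * (?M + 1)"])
    show "2 * C * (?M + 1) > 0" using C M by simp
    fix c k t j assume k: "norm k \<ge> \<delta>" "eta c k \<le> 0" and t: "(t::real) \<ge> 0" and j: "j \<le> n"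
    have k0: "k \<noteq> 0" using k \<delta> by auto
    let ?q = "C / (1 + t) ^ (n - j)"
    have q: "?q \<ge> 0" using C t by simp
    have "norm (Tderiv c t j k $ i) \<le> ?q * ?M" for i
    proof -
      have "norm (Tderiv c t j k $ i) \<le> (\<Sum>m. norm ((deriv ^^ j) (Delta c m t i) k))"
        unfolding Tderiv_def vec_lambda_beta
        by (rule summable_norm[OF summable_Delta_deriv[OF k0 k(2) t j]])
      also have "\<dots> \<le> (\<Sum>m. ?q * shell_mass m)"
        by (intro suminf_le summable_Delta_deriv[OF k0 k(2) t j] summable_mult summable_shell_mass C k t j)
      also have "\<dots> = ?q * ?M"
        by (rule suminf_mult[OF summable_shell_mass])
      finally show ?thesis .
    qed
    then have "(\<Sum>i\<in>UNIV. norm (Tderiv c t j k $ i)) \<le> (\<Sum>i\<in>(UNIV::2 set). ?q * ?M)"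
      by (intro sum_mono)
    then have "norm (Tderiv c t j k) \<le> 2 * (?q * ?M)"
      using norm_vec_le_sum[of "Tderiv c t j k"] by simp
    also have "\<dots> \<le> 2 * (?q * (?M + 1))"
      using q by (intro mult_left_mono) auto
    finally show "norm (Tderiv c t j k) \<le> 2 * C * (?M + 1) / (1 + t) ^ (n - j)"
      by (simp add: mult_ac)
  qed
qed

lemma Tderiv_continuous:
  assumes t: "t \<ge> 0" and j: "j \<le> n"
  shows "continuous_on {k. k \<noteq> 0 \<and> eta c k \<le> 0} (Tderiv c t j)"
proof -
  let ?S = "{k. k \<noteq> 0 \<and> eta c k \<le> 0}"
  have piece: "continuous_on {k\<in>?S. norm k \<ge> \<delta>} (Tderiv c t j)" if \<delta>: "\<delta> > 0" for \<delta>
    unfolding Tderiv_def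
  proof (rule continuous_on_vec_lambda)
    fix i
    obtain C where C: "C > 0" "\<And>c k t m i j. norm k \<ge> \<delta> \<Longrightarrow> eta c k \<le> 0 \<Longrightarrow> t \<ge> 0 \<Longrightarrow> j \<le> n \<Longrightarrow>
       norm ((deriv ^^ j) (Delta c m t i) k) \<le> C / (1 + t) ^ (n - j) * shell_mass m"
      using Delta_deriv_bound[OF \<delta>] by metis
    have lim: "uniform_limit {k\<in>?S. norm k \<ge> \<delta>} (\<lambda>N k. \<Sum>m<N. (deriv ^^ j) (Delta c m t i) k)
        (\<lambda>k. \<Sum>m. (deriv ^^ j) (Delta c m t i) k) sequentially"
      by (rule Weierstrass_m_test[OF _ summable_mult[OF summable_shell_mass, of "C / (1 + t) ^ (n - j)"]])
         (use C t j in auto)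
    have "\<forall>\<^sub>F N in sequentially. continuous_on {k\<in>?S. norm k \<ge> \<delta>}
        (\<lambda>k. \<Sum>m<N. (deriv ^^ j) (Delta c m t i) k)"
    proof (intro always_eventually allI continuous_on_sum)
      fix m
      have "(deriv ^^ j) (Delta c m t i) holomorphic_on - {0}"
        by (intro holomorphic_higher_deriv analytic_imp_holomorphic Delta_analytic t) auto
      then show "continuous_on {k\<in>?S. norm k \<ge> \<delta>} (\<lambda>k. (deriv ^^ j) (Delta c m t i) k)"
        by (rule holomorphic_on_imp_continuous_on[OF holomorphic_on_subset]) auto
    qed
    from uniform_limit_theorem[OF this lim]
    show "continuous_on {k\<in>?S. norm k \<ge> \<delta>} (\<lambda>k. \<Sum>m. (deriv ^^ j) (Delta c m t i) k)"
      by simp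
  qed
  show ?thesis
    unfolding continuous_on_eq_continuous_within
  proof
    fix x assume x: "x \<in> ?S"
    then have "continuous (at x within {k\<in>?S. norm k \<ge> norm x / 2}) (Tderiv c t j)"
      using piece[of "norm x / 2"] by (auto simp: continuous_on_eq_continuous_within)
    moreover have "at x within {k\<in>?S. norm k \<ge> norm x / 2} = at x within ?S"
    proof (rule at_within_nhd[of x "{k. norm k > norm x / 2}"])
      show "open {k. norm k > norm x / 2}"
        by (intro open_Collect_less continuous_intros)
    qed (use x in auto)
    ultimately show "continuous (at x within ?S) (Tderiv c t j)" by simp
  qed
qed

lemma sum_Delta: "k \<noteq> 0 \<Longrightarrow> t \<ge> 0 \<Longrightarrow> (\<Sum>m<N. Delta c m t i k) = Tcol {0..<Rd N} c k t $ i - axis c 1 $ i"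
proof (induction N)
  case 0
  then show ?case using Tcol_beyond_cut[of k t 0 c] by (simp add: Rd_def)
qed (simp add: Delta_def)

text \<open>
  The cut-off solutions converge to the full one, locally uniformly in \<open>k\<close>.
\<close>

lemma Tcol_cut_uniform_limit:
  assumes \<delta>: "\<delta> > 0" and t: "t \<ge> 0"
  shows "uniform_limit {k. norm k \<ge> \<delta> \<and> eta c k \<le> 0}
     (\<lambda>N k. \<Sum>m<N. Delta c m t i k) (\<lambda>k. Tcol {0..} c k t $ i - axis c 1 $ i) sequentially"
proof -
  obtain C where C: "C > 0"
    "\<And>c k A A' X X' B B' t. norm k \<ge> \<delta> \<Longrightarrow> A \<subseteq> A' \<Longrightarrow> A \<in> sets lebesgue \<Longrightarrow> A' \<in> sets lebesgue \<Longrightarrow>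
       stable 1 A' c k \<Longrightarrow> solT A c k X \<Longrightarrow> solT A' c k X' \<Longrightarrow>
       (\<And>t. t \<ge> 0 \<Longrightarrow> norm (X t) \<le> B) \<Longrightarrow> (\<And>t. t \<ge> 0 \<Longrightarrow> norm (X' t) \<le> B') \<Longrightarrow> t \<ge> 0 \<Longrightarrow>
       norm (X' t - X t) \<le> C * wmass (A' - A)"
    using solT_compare[OF \<delta> order_refl] by metis
  let ?M = "integral {0..} (\<lambda>s. (1 + s) ^ n * w s)"
  have tail: "wmass {Rd N..} \<le> (1 / 2) ^ N * ?M" for N
  proof -
    have M0: "?M \<ge> 0"
      using w_moment by (intro integral_nonneg) (auto simp: absolutely_integrable_on_def w_nonneg)
    have int: "(\<lambda>s. indicator {Rd N..} s * ((1 + s) ^ n * w s)) integrable_on {0..}"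
      using integrable_mult_indicator[of "{Rd N..}" lebesgue "\<lambda>s. indicator {0..} s *\<^sub>R ((1 + s) ^ n * w s)"] w_moment
      unfolding set_integrable_def
      by (intro set_lebesgue_integral_eq_integral(1)) (simp add: set_integrable_def mult_ac)
    have "wmass {Rd N..} \<le> integral {0..} (\<lambda>s. indicator {Rd N..} s * ((1 + s) ^ n * w s)) / (2 ^ N) ^ n"
      by (rule wmass_le) (auto simp: Rd_def)
    also have "\<dots> \<le> ?M / (2 ^ N) ^ n"
      using w_moment
      by (intro divide_right_mono integral_le int)
         (auto simp: absolutely_integrable_on_def indicator_def w_nonneg)
    also have "\<dots> \<le> ?M / (2 ^ N) ^ 1"
      using M0 n_pos by (intro divide_left_mono power_increasing) auto
    finally show ?thesis by (simp add: power_one_over field_simps)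
  qed
  have le: "norm ((\<Sum>m<N. Delta c m t i k) - (Tcol {0..} c k t $ i - axis c 1 $ i)) \<le> (1 / 2) ^ N * (C * ?M)"
    if k: "norm k \<ge> \<delta>" "eta c k \<le> 0" for k N
  proof -
    have k0: "k \<noteq> 0" using k \<delta> by auto
    have st: "stable 1 A c k" for A
      using k(2) by (rule stable_halfline) simp
    have sub: "{0..<Rd N} \<subseteq> {0..}" by auto
    note P = Tcol_props[OF k0 st order_refl, where A = "{0..<Rd N}"]
      and P' = Tcol_props[OF k0 st order_refl, where A = "{0..}"]
    obtain b b' where b: "\<And>t. t \<ge> 0 \<Longrightarrow> norm (Tcol {0..<Rd N} c k t) \<le> b"
        "\<And>t. t \<ge> 0 \<Longrightarrow> norm (Tcol {0..} c k t) \<le> b'"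
      using P(2) P'(2) by auto
    have "norm (Tcol {0..} c k t - Tcol {0..<Rd N} c k t) \<le> C * wmass ({0..} - {0..<Rd N})"
      by (rule C(2)[OF k(1) sub _ _ st P(1) P'(1) b t]) auto
    also have "{0..} - {0..<Rd N} = {Rd N..}"
      using Rd_nonneg[of N] by (auto simp del: Rd_nonneg)
    also have "C * wmass {Rd N..} \<le> C * ((1 / 2) ^ N * ?M)"
      using C(1) tail by (intro mult_left_mono) auto
    finally have "norm (Tcol {0..} c k t - Tcol {0..<Rd N} c k t) \<le> (1 / 2) ^ N * (C * ?M)"
      by (simp add: mult_ac)
    then show ?thesis
      using Finite_Cartesian_Product.norm_nth_le[of "Tcol {0..} c k t - Tcol {0..<Rd N} c k t" i]
      by (simp add: sum_Delta k0 t norm_minus_commute)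
  qed
  show ?thesis
  proof (rule uniform_limitI)
    fix e :: real assume e: "e > 0"
    have "(\<lambda>N. (1 / 2) ^ N * (C * ?M)) \<longlonglongrightarrow> 0 * (C * ?M)"
      by (intro tendsto_intros LIMSEQ_realpow_zero) auto
    then have "\<forall>\<^sub>F N in sequentially. (1 / 2) ^ N * (C * ?M) < e"
      using e order_tendstoD(2) by fastforce
    then show "\<forall>\<^sub>F N in sequentially. \<forall>k\<in>{k. norm k \<ge> \<delta> \<and> eta c k \<le> 0}.
        dist (\<Sum>m<N. Delta c m t i k) (Tcol {0..} c k t $ i - axis c 1 $ i) < e"
    proof eventually_elim
      case (elim N)
      show ?case
        using le[of _ N] elim unfolding dist_norm by (auto intro: order.strict_trans1)
    qed
  qed
qed

lemma Tderiv_0: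
  assumes k: "k \<noteq> 0" "eta c k \<le> 0" and t: "t \<ge> 0"
  shows "Tderiv c t 0 k = Tcol {0..} c k t - axis c 1"
proof -
  have "(\<Sum>m. Delta c m t i k) = Tcol {0..} c k t $ i - axis c 1 $ i" for i
  proof -
    have "norm k > 0" using k by simp
    from Tcol_cut_uniform_limit[OF this t, of c i]
    have "(\<lambda>N. \<Sum>m<N. Delta c m t i k) \<longlonglongrightarrow> Tcol {0..} c k t $ i - axis c 1 $ i"
      by (rule tendsto_uniform_limitI) (use k in simp)
    then show ?thesis
      by (simp add: sums_def sums_unique[symmetric])
  qed
  then show ?thesis
    by (simp add: Tderiv_def vec_eq_iff)
qed

lemma higher_deriv_sum_analytic:
  fixes f :: "nat \<Rightarrow> complex \<Rightarrow> complex"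
  assumes "\<And>m. m < N \<Longrightarrow> f m analytic_on {k}"
  shows "(deriv ^^ j) (\<lambda>z. \<Sum>m<N. f m z) k = (\<Sum>m<N. (deriv ^^ j) (f m) k)"
  using assms
proof (induction N)
  case (Suc N)
  have "(deriv ^^ j) (\<lambda>z. (\<Sum>m<N. f m z) + f N z) k = (deriv ^^ j) (\<lambda>z. \<Sum>m<N. f m z) k + (deriv ^^ j) (f N) k"
    using Suc.prems by (intro higher_deriv_add_at analytic_intros) auto
  then show ?case
    using Suc by simp
qed simp

lemma Tderiv_interior:
  assumes \<Omega>: "open \<Omega>" "\<And>z. z \<in> \<Omega> \<Longrightarrow> z \<noteq> 0" "\<And>z. z \<in> \<Omega> \<Longrightarrow> eta c z \<le> 0" and k: "k \<in> \<Omega>"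
    and t: "t \<ge> 0" and j: "j \<le> n"
  shows "Tderiv c t j k $ i = (deriv ^^ j) (\<lambda>z. Tcol {0..} c z t $ i - axis c 1 $ i) k"
proof -
  have k0: "k \<noteq> 0" "eta c k \<le> 0" using \<Omega> k by auto
  let ?\<delta> = "norm k / 2"
  let ?A = "\<Omega> \<inter> {z. norm z > ?\<delta>}"
  have A: "open ?A" "k \<in> ?A"
    using \<Omega>(1) k k0 by (auto intro!: open_Int open_Collect_less continuous_intros)
  have "uniform_limit ?A (\<lambda>N k. \<Sum>m<N. Delta c m t i k) (\<lambda>k. Tcol {0..} c k t $ i - axis c 1 $ i) sequentially"
    by (rule uniform_limit_on_subset[OF Tcol_cut_uniform_limit[of ?\<delta>]]) (use k0 t \<Omega> in auto)
  moreover have "(\<lambda>z. \<Sum>m<N. Delta c m t i z) holomorphic_on ?A" for N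
    using \<Omega>(2) by (intro holomorphic_on_sum holomorphic_on_subset[OF analytic_imp_holomorphic[OF Delta_analytic[OF t]]]) auto
  ultimately have "(\<lambda>N. (deriv ^^ j) (\<lambda>z. \<Sum>m<N. Delta c m t i z) k) \<longlonglongrightarrow>
      (deriv ^^ j) (\<lambda>z. Tcol {0..} c z t $ i - axis c 1 $ i) k"
    by (intro higher_deriv_complex_uniform_limit[OF _ _ _ A]) auto
  moreover have "(deriv ^^ j) (\<lambda>z. \<Sum>m<N. Delta c m t i z) k = (\<Sum>m<N. (deriv ^^ j) (Delta c m t i) k)" for N
    using k0 by (intro higher_deriv_sum_analytic analytic_on_subset[OF Delta_analytic[OF t]]) auto
  ultimately show ?thesis
    by (simp add: Tderiv_def sums_def sums_unique[symmetric])
qed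

subsection \<open>The solution from time zero\<close>

lemma U_deriv_bound:
  obtains C where "C > 0"
    "\<And>c k t i j. norm k \<ge> 1 \<Longrightarrow> eta c k \<ge> 0 \<Longrightarrow> t \<ge> 0 \<Longrightarrow> j \<le> n \<Longrightarrow>
      norm ((deriv ^^ j) (\<lambda>z. Ucol c z t $ i - axis c 1 $ i) k) \<le> C * (1 + t) ^ j"
    "\<And>c k t i j. norm k \<ge> 1 \<Longrightarrow> eta c k \<le> 0 \<Longrightarrow> t \<ge> 0 \<Longrightarrow> j \<le> n \<Longrightarrow>
      norm ((deriv ^^ j) (\<lambda>z. (Ucol c z t $ i - axis c 1 $ i)
        * exp (- 2 * \<i> * theta2 z * of_real t * of_real (sg c))) k) \<le> C * (1 + t) ^ j"
proof -
  obtain \<rho> where \<rho>: "0 < \<rho>" "\<rho> \<le> 1"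
    "\<And>c k z r. norm k \<ge> 1 \<Longrightarrow> r \<le> 1 \<Longrightarrow> dist k z \<le> \<rho> * r \<Longrightarrow>
        norm z \<ge> 1 / 2 \<and> \<bar>eta c z - eta c k\<bar> \<le> r / 2"
    using eta_lipschitz[of 1] by auto
  obtain C where C: "C > 0"
    "\<And>c k X t. norm k \<ge> 1 / 2 \<Longrightarrow> solU c k X \<Longrightarrow> t \<ge> 0 \<Longrightarrow> norm (X t) \<le> C * exp (max 0 (- eta c k) * t)"
    using solU_bound[of "1/2"] by (metis half_gt_zero zero_less_one)
  let ?B = "(C + 1) * exp 1"
  let ?C = "fact n * ?B / \<rho> ^ n"
  have small: "exp (x * t) \<le> exp 1" if "x \<le> (1 / (1 + t)) / 2" "t \<ge> 0" for x t :: real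
  proof -
    have "x * t \<le> (1 / (1 + t)) / 2 * t"
      using that by (intro mult_right_mono)
    also have "\<dots> \<le> 1" using that by (simp add: divide_le_eq)
    finally show ?thesis by simp
  qed
  have U: "norm (Ucol c z t $ i - axis c 1 $ i) \<le> (C + 1) * exp (max 0 (- eta c z) * t)"
    if "norm z \<ge> 1 / 2" "t \<ge> 0" for c z t i
  proof -
    have "z \<noteq> 0" using that by auto
    have "norm ((Ucol c z t - axis c 1) $ i) \<le> norm (Ucol c z t) + 1"
      using Finite_Cartesian_Product.norm_nth_le[of "Ucol c z t - axis c 1" i]
        norm_triangle_ineq4[of "Ucol c z t" "axis c 1"] norm_axis_1[of c] by linarith
    also have "\<dots> \<le> C * exp (max 0 (- eta c z) * t) + exp (max 0 (- eta c z) * t)"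
      using that by (intro add_mono C(2) Ucol_props \<open>z \<noteq> 0\<close>) auto
    finally show ?thesis by (simp add: algebra_simps)
  qed
  have final: "norm ((deriv ^^ j) f k) \<le> ?C * (1 + t) ^ j"
    if k: "norm k \<ge> 1" and t: "t \<ge> 0" and j: "j \<le> n" and f: "f analytic_on - {0}"
      and bd: "\<And>z. norm z \<ge> 1 / 2 \<Longrightarrow> \<bar>eta c z - eta c k\<bar> \<le> (1 / (1 + t)) / 2 \<Longrightarrow> norm (f z) \<le> ?B"
    for f c k t j
  proof -
    have "norm ((deriv ^^ j) f k) \<le> fact n * ?B / \<rho> ^ n / (1 / (1 + t)) ^ j"
    proof (rule Cauchy_inequality_scaled[OF f \<rho>(1,2) _ j])
      show "1 / (1 + t) > 0" using t by simp
      fix z assume d: "dist k z \<le> \<rho> * (1 / (1 + t))"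
      have "1 / (1 + t) \<le> 1" using t by simp
      from \<rho>(3)[OF k this d, of c] show "z \<noteq> 0 \<and> norm (f z) \<le> ?B"
        using bd[of z] by auto
    qed
    also have "\<dots> = ?C * (1 + t) ^ j"
      by (simp add: power_one_over)
    finally show ?thesis .
  qed
  show ?thesis
  proof (rule that[of ?C])
    show "?C > 0" using C \<rho> by simp
  next
    fix c k t i j assume k: "norm k \<ge> 1" "eta c k \<ge> 0" and t: "(t::real) \<ge> 0" and j: "j \<le> n"
    show "norm ((deriv ^^ j) (\<lambda>z. Ucol c z t $ i - axis c 1 $ i) k) \<le> ?C * (1 + t) ^ j"
    proof (rule final[OF k(1) t j])
      show "(\<lambda>z. Ucol c z t $ i - axis c 1 $ i) analytic_on - {0}"
        by (intro analytic_intros Ucol_analytic t)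
      fix z assume z: "norm z \<ge> 1 / 2" "\<bar>eta c z - eta c k\<bar> \<le> (1 / (1 + t)) / 2"
      have "max 0 (- eta c z) \<le> (1 / (1 + t)) / 2"
        using z(2) k(2) t by auto
      then have "(C + 1) * exp (max 0 (- eta c z) * t) \<le> ?B"
        using C(1) t by (intro mult_left_mono small) auto
      then show "norm (Ucol c z t $ i - axis c 1 $ i) \<le> ?B"
        using U[OF z(1) t, of c i] by linarith
    qed
  next
    fix c k t i j assume k: "norm k \<ge> 1" "eta c k \<le> 0" and t: "(t::real) \<ge> 0" and j: "j \<le> n"
    let ?e = "\<lambda>z. exp (- 2 * \<i> * theta2 z * of_real t * of_real (sg c))"
    show "norm ((deriv ^^ j) (\<lambda>z. (Ucol c z t $ i - axis c 1 $ i) * ?e z) k) \<le> ?C * (1 + t) ^ j"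
    proof (rule final[OF k(1) t j])
      have "theta2 analytic_on - {0}"
        using theta2_holo by (subst analytic_on_open) auto
      then show "(\<lambda>z. (Ucol c z t $ i - axis c 1 $ i) * ?e z) analytic_on - {0}"
        by (intro analytic_intros Ucol_analytic t)
      fix z assume z: "norm z \<ge> 1 / 2" "\<bar>eta c z - eta c k\<bar> \<le> (1 / (1 + t)) / 2"
      have e: "norm (?e z) = exp (eta c z * t)"
        by (simp add: norm_exp_eq_Re eta_def mult_ac)
      have "norm ((Ucol c z t $ i - axis c 1 $ i) * ?e z)
          \<le> (C + 1) * exp (max 0 (- eta c z) * t) * exp (eta c z * t)"
        unfolding norm_mult e using U[OF z(1) t] by (intro mult_right_mono) auto
      also have "\<dots> = (C + 1) * exp (max 0 (eta c z) * t)"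
        by (simp add: mult.assoc exp_add[symmetric] algebra_simps max_def)
      also have "\<dots> \<le> ?B"
      proof -
        have "max 0 (eta c z) \<le> (1 / (1 + t)) / 2"
          using z(2) k(2) t by auto
        then show ?thesis
          using C(1) t by (intro mult_left_mono small) auto
      qed
      finally show "norm ((Ucol c z t $ i - axis c 1 $ i) * ?e z) \<le> ?B" .
    qed
  qed
qed

end

section \<open>Differential equation, determinant and symmetries\<close>

lemma vsol_transform:
  assumes X: "vsol J a' \<alpha>' W' X" and h: "bounded_linear h" "h a' = a"
    and ker: "\<And>t s x. vker \<alpha> W t s (h x) = h (vker \<alpha>' W' t s x)"
  shows "vsol J a \<alpha> W (\<lambda>t. h (X t))"
  unfolding vsol_def
proof (intro allI impI)
  fix t :: real assume "t \<ge> 0"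
  then have f: "(\<lambda>s. vker \<alpha>' W' t s (X s)) absolutely_integrable_on J t"
    "X t = a' + integral (J t) (\<lambda>s. vker \<alpha>' W' t s (X s))"
    using X by (auto simp: vsol_def)
  have "(\<lambda>s. vker \<alpha> W t s (h (X s))) absolutely_integrable_on J t"
    unfolding ker using absolutely_integrable_linear[OF f(1) h(1)] by (simp add: o_def)
  moreover have "integral (J t) (\<lambda>s. vker \<alpha> W t s (h (X s))) = h (integral (J t) (\<lambda>s. vker \<alpha>' W' t s (X s)))"
    unfolding ker using integral_linear[OF _ h(1), of "\<lambda>s. vker \<alpha>' W' t s (X s)" "J t"] f(1)
    by (simp add: o_def absolutely_integrable_on_def)
  moreover have "h (X t) = h a' + h (integral (J t) (\<lambda>s. vker \<alpha>' W' t s (X s)))"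
    using arg_cong[OF f(2), of h] h(1) by (simp add: linear_simps)
  ultimately show "(\<lambda>s. vker \<alpha> W t s (h (X s))) absolutely_integrable_on J t \<and>
      h (X t) = a + integral (J t) (\<lambda>s. vker \<alpha> W t s (h (X s)))"
    using h(2) by simp
qed

text \<open>
  Column \<open>c\<close> of \<open>\<sigma>\<^sub>2 M \<sigma>\<^sub>2\<close>, as a function of the other column of \<open>M\<close>, and the same with \<open>M\<close> conjugated.
\<close>

definition flip :: "2 \<Rightarrow> complex^2 \<Rightarrow> complex^2" where
  "flip c x = (\<chi> i. of_real (sg i * sg c) * x $ other i)"

definition cflip :: "2 \<Rightarrow> complex^2 \<Rightarrow> complex^2" where
  "cflip c x = (\<chi> i. of_real (sg i * sg c) * cnj (x $ other i))"

lemma bounded_linear_flip: "bounded_linear (flip c)"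
  unfolding linear_conv_bounded_linear[symmetric]
  by (rule linearI) (auto simp: flip_def vec_eq_iff algebra_simps)

lemma bounded_linear_cflip: "bounded_linear (cflip c)"
  unfolding linear_conv_bounded_linear[symmetric]
  by (rule linearI) (auto simp: cflip_def vec_eq_iff algebra_simps)

lemma flip_axis: "flip c (axis (other c) 1) = axis c 1" "cflip c (axis (other c) 1) = axis c 1"
  using exhaust_2[of c] by (auto simp: flip_def cflip_def vec_eq_iff axis_def forall_2 sg_def other_def)

lemma theta2_minus: "theta2 (- k) = - theta2 k"
  by (cases "k = 0") (auto simp: theta2_def field_simps)

lemma theta2_cnj: "theta2 (cnj k) = cnj (theta2 k)"
  by (simp add: theta2_def)

lemma expn_minus: "expn (other c) (- k) $ other i = expn c k $ i"
  by (simp add: expn_def theta2_minus algebra_simps)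

lemma expn_cnj: "cnj (expn (other c) (cnj k) $ other i) = expn c k $ i"
  by (simp add: expn_def theta2_cnj algebra_simps)

lemma eta_minus: "eta (other c) (- k) = eta c k"
  by (simp add: eta_def theta2_minus)

lemma eta_cnj: "eta (other c) (cnj k) = eta c k"
  by (simp add: eta_def theta2_cnj)

text \<open>
  The coefficients of the equation satisfied by the determinant cancel because the trace vanishes.
\<close>

lemma wronskian_constant:
  fixes X Y :: "real \<Rightarrow> complex^2"
  assumes X: "\<And>i. is_primitive (\<lambda>t. X t $ i) (\<lambda>t. (W t *v X t) $ i - expn 1 k $ i * X t $ i)"
    and Y: "\<And>i. is_primitive (\<lambda>t. Y t $ i) (\<lambda>t. (W t *v Y t) $ i - expn 2 k $ i * Y t $ i)"
    and tr: "\<And>t. W t $ 1 $ 1 + W t $ 2 $ 2 = 0" and t: "t \<ge> 0"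
  shows "X t $ 1 * Y t $ 2 - Y t $ 1 * X t $ 2 = X 0 $ 1 * Y 0 $ 2 - Y 0 $ 1 * X 0 $ 2"
proof -
  note 1 = is_primitive_mult[OF X[of 1] Y[of 2]]
  note 2 = is_primitive_linear[OF is_primitive_mult[OF Y[of 1] X[of 2]] bounded_linear_minus[OF bounded_linear_ident]]
  have "is_primitive (\<lambda>t. X t $ 1 * Y t $ 2 - Y t $ 1 * X t $ 2) (\<lambda>t. 0)"
  proof (rule is_primitive_cong[OF is_primitive_add[OF 1 2]])
    fix t :: real
    have W22: "W t $ 2 $ 2 = - W t $ 1 $ 1"
      using tr[of t] by (simp add: eq_neg_iff_add_eq_0 add.commute)
    show "((W t *v X t) $ 1 - expn 1 k $ 1 * X t $ 1) * Y t $ 2 +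
         X t $ 1 * ((W t *v Y t) $ 2 - expn 2 k $ 2 * Y t $ 2) +
         - (((W t *v Y t) $ 1 - expn 2 k $ 1 * Y t $ 1) * X t $ 2 +
            Y t $ 1 * ((W t *v X t) $ 2 - expn 1 k $ 2 * X t $ 2)) = 0"
      by (simp add: matrix_vector_mult_def sum_2 W22 expn_def sg_def algebra_simps)
  qed simp
  from is_primitive_eq[OF this t] show ?thesis by simp
qed

lemma integral_zero_outside:
  fixes h :: "real \<Rightarrow> 'a::euclidean_space"
  assumes "\<And>x. x \<notin> K \<Longrightarrow> h x = 0" "K \<subseteq> S" "K \<subseteq> S'"
  shows "integral S h = integral S' h"
proof -
  have "(\<lambda>x. if x \<in> S then h x else 0) = (\<lambda>x. if x \<in> S' then h x else 0)"
    using assms by (intro ext) auto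
  then show "integral S h = integral S' h"
    using integral_restrict_UNIV[of S h] integral_restrict_UNIV[of S' h] by simp
qed

text \<open>Integration by parts against a test function.\<close>

lemma has_weak_derivative_if_primitive:
  fixes X X' :: "real \<Rightarrow> complex^'n"
  assumes X: "\<And>i. is_primitive (\<lambda>t. X t $ i) (\<lambda>t. X' t $ i)"
  shows "has_weak_derivative X X'"
  unfolding has_weak_derivative_def
proof (intro conjI allI impI)
  have cX: "continuous_on {0..} (\<lambda>t. X t $ i)" for i
    by (rule is_primitive_continuous[OF X])
  show "locally_integrable X" "locally_integrable X'"
    unfolding locally_integrable_def
  proof (safe)
    fix K :: "real set" assume K: "compact K" "K \<subseteq> {0<..}"
    then obtain b where b: "\<And>x. x \<in> K \<Longrightarrow> norm x \<le> b"
      using compact_imp_bounded bounded_iff by metis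
    have sub: "K \<subseteq> {0..b}"
    proof
      fix x assume "x \<in> K"
      then show "x \<in> {0..b}" using b[of x] K(2) by auto
    qed
    have Ks: "K \<in> sets lebesgue"
      using K(1) by (simp add: compact_imp_closed)
    show "X absolutely_integrable_on K"
      unfolding absolutely_integrable_on_vec_iff
    proof
      fix i
      have "(\<lambda>t. X t $ i) absolutely_integrable_on {0..b}"
        by (intro absolutely_integrable_continuous_real continuous_on_subset[OF cX]) auto
      then show "(\<lambda>t. X t $ i) absolutely_integrable_on K"
        by (rule set_integrable_subset[OF _ Ks sub])
    qed
    show "X' absolutely_integrable_on K"
      unfolding absolutely_integrable_on_vec_iff
    proof
      fix i
      have "(\<lambda>t. X' t $ i) absolutely_integrable_on {0..b}"
        by (rule is_primitive_absolutely_integrable[OF X]) simp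
      then show "(\<lambda>t. X' t $ i) absolutely_integrable_on K"
        by (rule set_integrable_subset[OF _ Ks sub])
    qed
  qed
  fix \<phi> assume \<phi>: "test_function \<phi>"
  then obtain K where K: "compact K" "K \<subseteq> {0<..}" "\<And>x. x \<notin> K \<Longrightarrow> \<phi> x = 0"
    unfolding test_function_def by blast
  have "((deriv ^^ 0) \<phi>) differentiable_on UNIV" "((deriv ^^ 1) \<phi>) differentiable_on UNIV"
    using \<phi> unfolding test_function_def by blast+
  then have diff: "\<phi> differentiable_on UNIV" "deriv \<phi> differentiable_on UNIV"
    by simp_all
  have d\<phi>: "(\<phi> has_real_derivative deriv \<phi> x) (at x)" for x
    using diff(1) by (simp add: differentiable_on_def DERIV_deriv_iff_real_differentiable)
  have c\<phi>': "continuous_on S (deriv \<phi>)" for S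
    using differentiable_imp_continuous_on[OF diff(2)] continuous_on_subset by blast
  have c\<phi>: "continuous_on S \<phi>" for S
    using differentiable_imp_continuous_on[OF diff(1)] continuous_on_subset by blast
  have z': "deriv \<phi> x = 0" if "x \<notin> K" for x
  proof -
    have "open (- K)" using K(1) by (simp add: compact_imp_closed open_Compl)
    then have "\<forall>\<^sub>F y in nhds x. \<phi> y = 0"
      using that K(3) eventually_nhds by blast
    then have "deriv \<phi> x = deriv (\<lambda>_. 0) x"
      by (rule deriv_cong_ev) simp
    then show ?thesis by simp
  qed
  obtain b0 where b0: "\<And>x. x \<in> K \<Longrightarrow> norm x \<le> b0"
    using compact_imp_bounded[OF K(1)] bounded_iff by metis
  define b where "b = \<bar>b0\<bar> + 1"
  have b: "b \<ge> 0" "b \<notin> K" "0 \<notin> K" and sub: "K \<subseteq> {0..b}"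
    using b0 K(2) by (force simp: b_def)+
  have prod: "is_primitive (\<lambda>t. complex_of_real (\<phi> t) * X t $ i)
      (\<lambda>t. complex_of_real (deriv \<phi> t) * X t $ i + complex_of_real (\<phi> t) * X' t $ i)" for i
  proof (rule is_primitive_mult[OF is_primitive_C1 X])
    show "((\<lambda>t. complex_of_real (\<phi> t)) has_vector_derivative complex_of_real (deriv \<phi> t)) (at t within {0..})" for t
      using bounded_linear.has_vector_derivative[OF bounded_linear_of_real]
        has_field_derivative_at_within[OF d\<phi>, of t "{0..}"]
      by (simp add: has_real_derivative_iff_has_vector_derivative)
    show "continuous_on {0..} (\<lambda>t. complex_of_real (deriv \<phi> t))"
      by (intro continuous_intros c\<phi>')
  qed
  let ?f = "\<lambda>t. deriv \<phi> t *\<^sub>R X t" and ?g = "\<lambda>t. \<phi> t *\<^sub>R X' t"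
  have fi: "(\<lambda>t. ?f t $ i) absolutely_integrable_on {0..b}" for i
    by (intro absolutely_integrable_continuous_real)
       (auto intro!: continuous_intros c\<phi>' continuous_on_subset[OF cX])
  have gi: "(\<lambda>t. ?g t $ i) absolutely_integrable_on {0..b}" for i
  proof -
    have "(\<lambda>t. X' t $ i * complex_of_real (\<phi> t)) absolutely_integrable_on {0..b}"
      by (intro absolutely_integrable_mult_continuous is_primitive_absolutely_integrable[OF X]
          continuous_intros c\<phi>) auto
    then show ?thesis
      by (simp only: vector_scaleR_component scaleR_conv_of_real[where 'a=complex] mult.commute)
  qed
  have f: "?f absolutely_integrable_on {0..b}" and g: "?g absolutely_integrable_on {0..b}"
    using fi gi unfolding absolutely_integrable_on_vec_iff by blast+
  have "integral {0..b} ?f $ i + integral {0..b} ?g $ i = 0" for i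
  proof -
    have "integral {0..b} ?f $ i + integral {0..b} ?g $ i =
        integral {0..b} (\<lambda>t. ?f t $ i + ?g t $ i)"
      unfolding integral_vec_nth[OF f] integral_vec_nth[OF g]
      using fi[of i] gi[of i]
      by (intro Henstock_Kurzweil_Integration.integral_add[symmetric])
         (simp_all only: absolutely_integrable_on_def)
    also have "\<dots> = integral {0..b} (\<lambda>t. complex_of_real (deriv \<phi> t) * X t $ i + complex_of_real (\<phi> t) * X' t $ i)"
      by (simp only: vector_scaleR_component scaleR_conv_of_real[where 'a=complex])
    also have "\<dots> = 0"
      using is_primitive_eq[OF prod b(1), of i] K(3)[OF b(2)] K(3)[OF b(3)] by simp
    finally show ?thesis .
  qed
  then have "integral {0..b} ?f = - integral {0..b} ?g"
    by (simp add: vec_eq_iff eq_neg_iff_add_eq_0)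
  moreover have "integral {0<..} ?f = integral {0..b} ?f"
    by (rule integral_zero_outside[OF _ K(2) sub]) (simp add: z')
  moreover have "integral {0<..} ?g = integral {0..b} ?g"
    by (rule integral_zero_outside[OF _ K(2) sub]) (simp add: K(3))
  ultimately show "integral {0<..} ?f = - integral {0<..} ?g"
    by simp
qed

context potential
begin

lemma Tcol_is_primitive:
  assumes "k \<noteq> 0" "eta c k \<le> 0"
  shows "is_primitive (\<lambda>t. Tcol {0..} c k t $ i)
     (\<lambda>t. (V t k *v Tcol {0..} c k t) $ i - expn c k $ i * Tcol {0..} c k t $ i)"
proof -
  have st: "stable 1 {0..} c k"
    using assms(2) by (rule stable_halfline) simp
  have X: "vsol (\<lambda>t. {t..}) (axis c 1) (expn c k) (Vcut {0..} k) (Tcol {0..} c k)"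
    using Tcol_props(1)[OF assms(1) st] by (simp add: solT_def)
  show ?thesis
  proof (rule is_primitive_cong[OF vsol_is_primitive[OF direction_backward X]])
    show "expn c k $ i * axis c 1 $ i = 0"
      by (cases "i = c") (auto simp: axis_def)
    fix t :: real assume "t \<ge> 0"
    then show "- 1 * (Vcut {0..} k t *v Tcol {0..} c k t) $ i - expn c k $ i * Tcol {0..} c k t $ i
      = (V t k *v Tcol {0..} c k t) $ i - expn c k $ i * Tcol {0..} c k t $ i"
      by (simp add: Vcut_def matrix_vector_mult_def sum_negf)
  qed simp
qed

lemma Ucol_is_primitive:
  assumes "k \<noteq> 0"
  shows "is_primitive (\<lambda>t. Ucol c k t $ i)
     (\<lambda>t. (V t k *v Ucol c k t) $ i - expn c k $ i * Ucol c k t $ i)"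
proof -
  have X: "vsol (\<lambda>t. {0..t}) (axis c 1) (expn c k) (\<lambda>s. V s k) (Ucol c k)"
    using Ucol_props[OF assms] by (simp add: solU_def)
  have "expn c k $ i * axis c 1 $ i = 0"
    by (cases "i = c") (auto simp: axis_def)
  from vsol_is_primitive[OF direction_forward X this] show ?thesis by simp
qed

lemma Tcol_tendsto:
  assumes "k \<noteq> 0" "eta c k \<le> 0"
  shows "((\<lambda>t. Tcol {0..} c k t $ i) \<longlongrightarrow> axis c 1 $ i) at_top"
proof -
  have "norm k > 0" using assms by simp
  then obtain C where C: "C > 0" "\<And>t j. t \<ge> 0 \<Longrightarrow> j \<le> n \<Longrightarrow> norm (Tderiv c t j k) \<le> C / (1 + t) ^ (n - j)"
    using Tderiv_bound[of "norm k"] assms by (metis order_refl)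
  have bd: "norm (Tcol {0..} c k t $ i - axis c 1 $ i) \<le> C / (1 + t)" if t: "t \<ge> 0" for t
  proof -
    have "norm ((Tcol {0..} c k t - axis c 1) $ i) \<le> C / (1 + t) ^ n"
      using C(2)[OF t, of 0] Tderiv_0[OF assms t] Finite_Cartesian_Product.norm_nth_le order_trans
      by fastforce
    also have "\<dots> \<le> C / (1 + t) ^ 1"
      using n_pos t C(1) by (intro divide_left_mono power_increasing) auto
    finally show ?thesis by simp
  qed
  have "((\<lambda>t. Tcol {0..} c k t $ i - axis c 1 $ i) \<longlongrightarrow> 0) at_top"
  proof (rule Lim_null_comparison)
    show "\<forall>\<^sub>F t in at_top. norm (Tcol {0..} c k t $ i - axis c 1 $ i) \<le> C / (1 + t)"
      using eventually_ge_at_top[of 0] by eventually_elim (rule bd)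
    have "filterlim (\<lambda>t::real. 1 + t) at_top at_top"
      by (rule filterlim_tendsto_add_at_top[OF tendsto_const filterlim_ident])
    then show "((\<lambda>t. C / (1 + t)) \<longlongrightarrow> 0) at_top"
      by (intro real_tendsto_divide_at_top[OF tendsto_const])
  qed
  then show ?thesis
    by (rule LIM_zero_cancel)
qed

lemma Tcol_det:
  assumes k: "k \<noteq> 0" "eta 1 k \<le> 0" "eta 2 k \<le> 0" and t: "t \<ge> 0"
  shows "Tcol {0..} 1 k t $ 1 * Tcol {0..} 2 k t $ 2 - Tcol {0..} 2 k t $ 1 * Tcol {0..} 1 k t $ 2 = 1"
proof -
  let ?d = "\<lambda>t. Tcol {0..} 1 k t $ 1 * Tcol {0..} 2 k t $ 2 - Tcol {0..} 2 k t $ 1 * Tcol {0..} 1 k t $ 2"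
  have const: "?d t = ?d 0" if "t \<ge> 0" for t
    by (rule wronskian_constant[OF Tcol_is_primitive[OF k(1,2)] Tcol_is_primitive[OF k(1,3)] V_trace that])
  let ?e = "\<lambda>c. axis c 1 :: complex^2"
  have "(?d \<longlongrightarrow> ?e 1 $ 1 * ?e 2 $ 2 - ?e 2 $ 1 * ?e 1 $ 2) at_top"
    by (intro tendsto_intros Tcol_tendsto k)
  then have "(?d \<longlongrightarrow> 1) at_top" by (simp add: axis_def)
  moreover have "(?d \<longlongrightarrow> ?d 0) at_top"
    by (intro tendsto_eventually eventually_mono[OF eventually_ge_at_top[of 0]] const)
  ultimately have "?d 0 = 1"
    using tendsto_unique trivial_limit_at_top_linorder by blast
  then show ?thesis using const[OF t] by simp
qed

lemma Ucol_det:
  assumes k: "k \<noteq> 0" and t: "t \<ge> 0"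
  shows "Ucol 1 k t $ 1 * Ucol 2 k t $ 2 - Ucol 2 k t $ 1 * Ucol 1 k t $ 2 = 1"
proof -
  have "Ucol c k 0 = axis c 1" for c
    using Ucol_props[OF k, of c] by (simp add: solU_def vsol_def)
  then show ?thesis
    using wronskian_constant[OF Ucol_is_primitive[OF k] Ucol_is_primitive[OF k] V_trace t]
    by (simp add: axis_def)
qed

lemma V_flip: "V s k *v flip c x = flip c (V s (- k) *v x)"
  unfolding flip_def matrix_vector_mult_def vec_eq_iff forall_2 using V_minus[of s k]
  by (simp add: sum_2 sg_def other_def algebra_simps)

lemma V_cflip: "V s k *v cflip c x = cflip c (V s (cnj k) *v x)"
  unfolding cflip_def matrix_vector_mult_def vec_eq_iff forall_2 using V_cnj[of s k]
  by (simp add: sum_2 sg_def other_def algebra_simps)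

lemma vker_flip:
  assumes "\<And>x. W s *v flip c x = flip c (W' s *v x)"
  shows "vker (expn c k) W t s (flip c x) = flip c (vker (expn (other c) (- k)) W' t s x)"
  unfolding vker_def assms by (simp add: flip_def vec_eq_iff expn_minus)

lemma vker_cflip:
  assumes "\<And>x. W s *v cflip c x = cflip c (W' s *v x)"
  shows "vker (expn c k) W t s (cflip c x) = cflip c (vker (expn (other c) (cnj k)) W' t s x)"
proof -
  have "cnj (exp (expn (other c) (cnj k) $ other i * complex_of_real r)) = exp (expn c k $ i * of_real r)" for i r
    by (simp add: exp_cnj expn_cnj)
  then show ?thesis
    unfolding vker_def assms by (simp add: cflip_def vec_eq_iff del: of_real_diff)
qed

lemma Vcut_flip: "Vcut A k s *v flip c x = flip c (Vcut A (- k) s *v x)"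
proof (cases "s \<in> A")
  case True
  then have "Vcut A k s *v flip c x = - (V s k *v flip c x)"
    by (simp add: Vcut_def vec_eq_iff matrix_vector_mult_def sum_negf)
  also have "\<dots> = flip c (Vcut A (- k) s *v x)"
    using True unfolding V_flip
    by (simp add: Vcut_def flip_def vec_eq_iff matrix_vector_mult_def sum_negf)
  finally show ?thesis .
qed (simp add: Vcut_def flip_def vec_eq_iff)

lemma Vcut_cflip: "Vcut A k s *v cflip c x = cflip c (Vcut A (cnj k) s *v x)"
proof (cases "s \<in> A")
  case True
  then have "Vcut A k s *v cflip c x = - (V s k *v cflip c x)"
    by (simp add: Vcut_def vec_eq_iff matrix_vector_mult_def sum_negf)
  also have "\<dots> = cflip c (Vcut A (cnj k) s *v x)"
    using True unfolding V_cflip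
    by (simp add: Vcut_def cflip_def vec_eq_iff matrix_vector_mult_def sum_negf)
  finally show ?thesis .
qed (simp add: Vcut_def cflip_def vec_eq_iff)

lemma Tcol_symmetry:
  assumes k: "k \<noteq> 0" "eta c k \<le> 0" and t: "t \<ge> 0"
  shows "Tcol {0..} c k t = flip c (Tcol {0..} (other c) (- k) t)"
    and "Tcol {0..} c k t = cflip c (Tcol {0..} (other c) (cnj k) t)"
proof -
  have 1: "solT {0..} (other c) (- k) (Tcol {0..} (other c) (- k))"
    using k by (intro Tcol_props(1)[OF _ stable_halfline[OF _ order_refl]]) (auto simp: eta_minus)
  have "solT {0..} c k (\<lambda>t. flip c (Tcol {0..} (other c) (- k) t))"
    unfolding solT_def
    by (rule vsol_transform[OF 1[unfolded solT_def] bounded_linear_flip flip_axis(1) vker_flip[OF Vcut_flip]])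
  from Tcol_unique[OF k this t] show "Tcol {0..} c k t = flip c (Tcol {0..} (other c) (- k) t)" by simp
  have 2: "solT {0..} (other c) (cnj k) (Tcol {0..} (other c) (cnj k))"
    using k by (intro Tcol_props(1)[OF _ stable_halfline[OF _ order_refl]]) (auto simp: eta_cnj)
  have "solT {0..} c k (\<lambda>t. cflip c (Tcol {0..} (other c) (cnj k) t))"
    unfolding solT_def
    by (rule vsol_transform[OF 2[unfolded solT_def] bounded_linear_cflip flip_axis(2) vker_cflip[OF Vcut_cflip]])
  from Tcol_unique[OF k this t] show "Tcol {0..} c k t = cflip c (Tcol {0..} (other c) (cnj k) t)" by simp
qed

lemma Ucol_symmetry:
  assumes k: "k \<noteq> 0" and t: "t \<ge> 0"
  shows "Ucol c k t = flip c (Ucol (other c) (- k) t)"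
    and "Ucol c k t = cflip c (Ucol (other c) (cnj k) t)"
proof -
  have "- k \<noteq> 0" "cnj k \<noteq> 0" using k by auto
  note U = Ucol_props[OF this(1), of "other c"] Ucol_props[OF this(2), of "other c"]
  have "solU c k (\<lambda>t. flip c (Ucol (other c) (- k) t))"
    unfolding solU_def
    by (rule vsol_transform[OF U(1)[unfolded solU_def] bounded_linear_flip flip_axis(1) vker_flip[OF V_flip]])
  from solU_unique[OF k Ucol_props[OF k] this t] show "Ucol c k t = flip c (Ucol (other c) (- k) t)" .
  have "solU c k (\<lambda>t. cflip c (Ucol (other c) (cnj k) t))"
    unfolding solU_def
    by (rule vsol_transform[OF U(2)[unfolded solU_def] bounded_linear_cflip flip_axis(2) vker_cflip[OF V_cflip]])
  from solU_unique[OF k Ucol_props[OF k] this t] show "Ucol c k t = cflip c (Ucol (other c) (cnj k) t)" .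
qed

end

section \<open>Exponentials of Pauli matrices and the potential\<close>

lemma sigma3_nth: "sigma3 $ i $ j = (if i = j then of_real (sg i) else 0)"
  using exhaust_2[of i] exhaust_2[of j] by (auto simp: sigma3_def sg_def)

lemma i_mult_i: "\<i> * x * \<i> = - x"
  by (simp add: complex_eq_iff)

lemma sigma2_conjugate: "(sigma2 ** A ** sigma2) $ i $ j = of_real (sg i * sg j) * A $ other i $ other j"
  using exhaust_2[of i] exhaust_2[of j]
  by (auto simp: sigma2_def matrix_matrix_mult_def sum_2 sg_def other_def i_mult_i)

lemma scale_mat_nth: "(a *m A) $ i $ j = a * A $ i $ j"
  by (simp add: scale_mat_def map_matrix_def)

lemma mexp_sigma3: "mexp (\<alpha> *m sigma3) $ i $ j = (if i = j then exp (\<alpha> * of_real (sg i)) else 0)"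
proof -
  let ?A = "\<alpha> *m sigma3"
  let ?D = "\<lambda>f :: 2 \<Rightarrow> complex. (\<chi> i j. if i = j then f i else 0) :: cmat2"
  have pow: "((**) ?A ^^ m) (mat 1) = ?D (\<lambda>i. (\<alpha> * of_real (sg i)) ^ m)" for m
  proof (induction m)
    case 0
    show ?case by (simp add: mat_def vec_eq_iff)
  next
    case (Suc m)
    have "((**) ?A ^^ Suc m) (mat 1) = ?A ** ((**) ?A ^^ m) (mat 1)" by simp
    also have "\<dots> = ?D (\<lambda>i. (\<alpha> * of_real (sg i)) ^ Suc m)"
      unfolding Suc
      by (simp add: vec_eq_iff forall_2 matrix_matrix_mult_def sum_2 scale_mat_nth sigma3_nth)
    finally show ?case .
  qed
  have "(\<lambda>m. (1 / fact m) *\<^sub>R (((**) ?A ^^ m) (mat 1))) sums ?D (\<lambda>i. exp (\<alpha> * of_real (sg i)))"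
    unfolding sums_def
  proof (intro vec_tendstoI)
    fix i j
    have "(\<lambda>N. \<Sum>m<N. (\<alpha> * of_real (sg i)) ^ m /\<^sub>R fact m) \<longlonglongrightarrow> exp (\<alpha> * of_real (sg i))"
      using exp_converges unfolding sums_def .
    then show "(\<lambda>N. (\<Sum>m<N. (1 / fact m) *\<^sub>R (((**) ?A ^^ m) (mat 1))) $ i $ j) \<longlonglongrightarrow>
        ?D (\<lambda>i. exp (\<alpha> * of_real (sg i))) $ i $ j"
      unfolding pow by (cases "i = j") (simp_all add: sum_component inverse_eq_divide)
  qed
  then have "mexp ?A = ?D (\<lambda>i. exp (\<alpha> * of_real (sg i)))"
    unfolding mexp_def by (rule sums_unique[symmetric])
  then show ?thesis by simp
qed

lemma exp_hat_sigma3_nth: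
  "exp_hat_sigma3 \<alpha> A $ i $ j = exp (\<alpha> * of_real (sg i - sg j)) * A $ i $ j"
proof -
  have "exp_hat_sigma3 \<alpha> A $ i $ j = exp (\<alpha> * of_real (sg i)) * A $ i $ j * exp (- \<alpha> * of_real (sg j))"
    using exhaust_2[of i] exhaust_2[of j]
    by (auto simp: exp_hat_sigma3_def matrix_matrix_mult_def sum_2 mexp_sigma3)
  also have "\<dots> = exp (\<alpha> * of_real (sg i)) * exp (- \<alpha> * of_real (sg j)) * A $ i $ j"
    by (simp add: mult_ac)
  also have "exp (\<alpha> * of_real (sg i)) * exp (- \<alpha> * of_real (sg j)) = exp (\<alpha> * of_real (sg i - sg j))"
    by (simp add: exp_add[symmetric] algebra_simps)
  finally show ?thesis .
qed

lemma column_matrix_mult: "column c (A ** B) = A *v column c B"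
  by (simp add: column_def matrix_matrix_mult_def matrix_vector_mult_def vec_eq_iff)

lemma column_volterra_integrand:
  "column c (volterra_integrand g0 g0t g1 k M t s)
     = vker (expn c k) (\<lambda>s. Vmat g0 g0t g1 s k) t s (column c (M s))"
  unfolding vker_def column_matrix_mult[symmetric]
  by (simp add: volterra_integrand_def column_def exp_hat_sigma3_nth expn_def vec_eq_iff algebra_simps)

lemma Vmat_nth:
  "Vmat g0 g0t g1 t k $ 1 $ 1 = (1 / k) * (- \<i> * of_real (cos (g0 t) - 1) / 4)"
  "Vmat g0 g0t g1 t k $ 2 $ 2 = - ((1 / k) * (- \<i> * of_real (cos (g0 t) - 1) / 4))"
  "Vmat g0 g0t g1 t k $ 1 $ 2 = - of_real (g1 t + g0t t) / 4 + (1 / k) * (- \<i> * of_real (sin (g0 t)) / 4)"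
  "Vmat g0 g0t g1 t k $ 2 $ 1 = of_real (g1 t + g0t t) / 4 + (1 / k) * (- \<i> * of_real (sin (g0 t)) / 4)"
  by (simp_all add: Vmat_def scale_mat_nth sigma1_def sigma2_def sigma3_def i_mult_i)
     (simp add: field_simps)

lemma cos_minus_one_bound: "\<bar>cos x - 1\<bar> \<le> \<bar>x::real\<bar>"
proof -
  have "cos x - 1 = - 2 * sin (x / 2) ^ 2"
    using cos_double_sin[of "x / 2"] by simp
  then have "\<bar>cos x - 1\<bar> = 2 * \<bar>sin (x / 2)\<bar> * \<bar>sin (x / 2)\<bar>"
    by (simp add: power2_eq_square abs_mult)
  also have "\<dots> \<le> 2 * \<bar>x / 2\<bar> * 1"
    by (intro mult_mono abs_sin_x_le_abs_x) auto
  finally show ?thesis by simp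
qed

lemma locally_integrable_measurable:
  fixes f :: "real \<Rightarrow> real"
  assumes "locally_integrable f"
  shows "f \<in> borel_measurable (lebesgue_on {0..})"
proof -
  let ?K = "\<lambda>m::nat. {1 / (real m + 1)..real m + 1}"
  have meas: "(\<lambda>x. indicator (?K m) x *\<^sub>R f x) \<in> borel_measurable lebesgue" for m
  proof -
    have "?K m \<subseteq> {0<..}"
      by (auto intro: less_le_trans[of 0 "1 / (real m + 1)"])
    then have "f absolutely_integrable_on ?K m"
      using assms by (simp add: locally_integrable_def)
    then show ?thesis
      unfolding set_integrable_def by (rule borel_measurable_integrable)
  qed
  have lim: "(\<lambda>m. indicator (?K m) x *\<^sub>R f x) \<longlonglongrightarrow> indicator {0<..} x *\<^sub>R f x" for x
  proof (cases "x > 0")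
    case True
    obtain N :: nat where N: "real N > max x (1 / x)"
      using reals_Archimedean2 by blast
    have "x \<in> ?K m" if "m \<ge> N" for m
    proof -
      have m: "real m > x" "real m > 1 / x"
        using N that by (auto intro: less_le_trans)
      then have "1 / (real m + 1) \<le> x"
        using True by (simp add: field_simps)
      then show ?thesis using m by simp
    qed
    then have "\<forall>\<^sub>F m in sequentially. indicator (?K m) x *\<^sub>R f x = indicator {0<..} x *\<^sub>R f x"
      using True by (auto simp: eventually_sequentially indicator_def intro!: exI[of _ N])
    then show ?thesis by (rule tendsto_eventually)
  next
    case False
    then have "indicator (?K m) x *\<^sub>R f x = indicator {0<..} x *\<^sub>R f x" for m
      using less_le_trans[of 0 "1 / (real m + 1)" x] by (auto simp: indicator_def)
    then show ?thesis by (simp only: tendsto_const)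
  qed
  have "(\<lambda>x. indicator {0<..} x *\<^sub>R f x) \<in> borel_measurable lebesgue"
    by (rule borel_measurable_LIMSEQ_real[OF lim meas])
  moreover have "(\<lambda>x. indicator {0} x * f 0) \<in> borel_measurable lebesgue"
    by (intro borel_measurable_times borel_measurable_indicator) auto
  ultimately have "(\<lambda>x. indicator {0<..} x *\<^sub>R f x + indicator {0} x * f 0) \<in> borel_measurable lebesgue"
    by (rule borel_measurable_add)
  moreover have "indicator {0<..} x *\<^sub>R f x + indicator {0} x * f 0 = indicator {0..} x *\<^sub>R f x" for x
    by (auto simp: indicator_def)
  ultimately show ?thesis
    by (simp add: borel_measurable_restrict_space_iff)
qed

lemma Vmat_potential:
  fixes n :: nat and Nt :: int
  assumes n: "n \<ge> 1"
    and g0t: "has_weak_derivative g0 g0t"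
    and g1: "g1 \<in> borel_measurable (lebesgue_on {0..})"
    and L1: "(\<lambda>t. (1 + t) ^ n * (\<bar>g0 t - 2 * pi * of_int Nt\<bar> + \<bar>g0t t\<bar> + \<bar>g1 t\<bar>))
               absolutely_integrable_on {0..}"
  shows "potential n (\<lambda>s k. Vmat g0 g0t g1 s k)
     (\<lambda>t. \<bar>g0 t - 2 * pi * of_int Nt\<bar> + \<bar>g0t t\<bar> + \<bar>g1 t\<bar>)"
proof
  have g0m: "g0 \<in> borel_measurable (lebesgue_on {0..})" "g0t \<in> borel_measurable (lebesgue_on {0..})"
    using g0t unfolding has_weak_derivative_def by (auto intro: locally_integrable_measurable)
  show "n \<ge> 1" by (rule n)
  let ?w = "\<lambda>t. \<bar>g0 t - 2 * pi * of_int Nt\<bar> + \<bar>g0t t\<bar> + \<bar>g1 t\<bar>"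
  show "?w s \<ge> 0" for s by simp
  show "?w \<in> borel_measurable (lebesgue_on {0..})"
    using g0m g1 by measurable
  show "(\<lambda>s. (1 + s) ^ n * ?w s) absolutely_integrable_on {0..}"
    by (rule L1)
  note nth = Vmat_nth[of g0 g0t g1]
  have m: "(\<lambda>t. complex_of_real (sin (g0 t))) \<in> borel_measurable (lebesgue_on {0..})"
    "(\<lambda>t. complex_of_real (cos (g0 t) - 1)) \<in> borel_measurable (lebesgue_on {0..})"
    "(\<lambda>t. complex_of_real (g1 t + g0t t)) \<in> borel_measurable (lebesgue_on {0..})"
    using g0m g1 by measurable
  show "(\<lambda>s. Vmat g0 g0t g1 s k $ i $ j) \<in> borel_measurable (lebesgue_on {0..})" for k i j
    using exhaust_2[of i] exhaust_2[of j]
    by (elim disjE; simp only: nth;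
        intro borel_measurable_times borel_measurable_add borel_measurable_uminus borel_measurable_divide
          borel_measurable_const m)
  show "(\<lambda>k. Vmat g0 g0t g1 s k $ i $ j) holomorphic_on - {0}" for s i j
    using exhaust_2[of i] exhaust_2[of j]
    by (elim disjE; simp only: nth; intro holomorphic_intros; simp)
  show "Vmat g0 g0t g1 s k $ 1 $ 1 + Vmat g0 g0t g1 s k $ 2 $ 2 = 0" for s k
    by (simp only: nth add.right_inverse)
  show "Vmat g0 g0t g1 s (- k) $ i $ j = of_real (sg i * sg j) * Vmat g0 g0t g1 s k $ other i $ other j" for s k i j
    using exhaust_2[of i] exhaust_2[of j]
    by (elim disjE; simp add: nth sg_def other_def; simp add: field_simps)
  show "cnj (Vmat g0 g0t g1 s (cnj k) $ i $ j) = of_real (sg i * sg j) * Vmat g0 g0t g1 s k $ other i $ other j" for s k i j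
    using exhaust_2[of i] exhaust_2[of j]
    by (elim disjE; simp add: nth sg_def other_def; simp add: field_simps)
  show "norm (Vmat g0 g0t g1 s k $ i $ j) \<le> (1 + 1 / norm k) * ?w s / 4" if "k \<noteq> 0" for s k i j
  proof -
    let ?p = "g0 s - 2 * pi * of_int Nt"
    have "sin ?p = sin (g0 s)" "cos ?p = cos (g0 s)"
      using sin_cos_eq_iff[of ?p "g0 s"] by (auto intro!: exI[of _ "- Nt"] simp: algebra_simps)
    then have sc: "\<bar>sin (g0 s)\<bar> \<le> \<bar>?p\<bar>" "\<bar>cos (g0 s) - 1\<bar> \<le> \<bar>?p\<bar>"
      using abs_sin_x_le_abs_x[of ?p] cos_minus_one_bound[of ?p] by simp_all
    have diag: "norm ((1 / k) * (- \<i> * of_real x / 4)) \<le> (1 / norm k) * \<bar>x\<bar> / 4" for x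
      by (simp add: norm_mult norm_divide)
    have le: "(1 / norm k) * \<bar>x\<bar> / 4 \<le> (1 / norm k) * ?w s / 4" if "\<bar>x\<bar> \<le> \<bar>?p\<bar>" for x
      using that by (intro divide_right_mono mult_left_mono) auto
    have g: "\<bar>g1 s + g0t s\<bar> / 4 \<le> ?w s / 4" by simp
    have d: "norm ((1 / k) * (- \<i> * of_real (cos (g0 s) - 1) / 4)) \<le> (1 + 1 / norm k) * ?w s / 4"
    proof -
      have "norm ((1 / k) * (- \<i> * of_real (cos (g0 s) - 1) / 4)) \<le> (1 / norm k) * ?w s / 4"
        using diag le[OF sc(2)] by (rule order_trans)
      also have "\<dots> \<le> (1 + 1 / norm k) * ?w s / 4"
        by (intro divide_right_mono mult_right_mono) auto
      finally show ?thesis .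
    qed
    have o: "norm (b + (1 / k) * (- \<i> * of_real (sin (g0 s)) / 4)) \<le> (1 + 1 / norm k) * ?w s / 4"
      if "norm b \<le> \<bar>g1 s + g0t s\<bar> / 4" for b
    proof -
      have "norm (b + (1 / k) * (- \<i> * of_real (sin (g0 s)) / 4)) \<le> ?w s / 4 + (1 / norm k) * ?w s / 4"
        by (intro order_trans[OF norm_triangle_ineq] add_mono order_trans[OF that g]
            order_trans[OF diag le[OF sc(1)]])
      also have "\<dots> = (1 + 1 / norm k) * ?w s / 4"
        by (simp only: distrib_right mult_1 add_divide_distrib)
      finally show ?thesis .
    qed
    have nb: "norm (- complex_of_real (g1 s + g0t s) / 4) \<le> \<bar>g1 s + g0t s\<bar> / 4"
      "norm (complex_of_real (g1 s + g0t s) / 4) \<le> \<bar>g1 s + g0t s\<bar> / 4"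
      by (simp_all only: norm_divide norm_minus_cancel norm_of_real norm_numeral order_refl)
    show ?thesis
      using exhaust_2[of i] exhaust_2[of j]
      by (elim disjE) (simp_all only: nth norm_minus_cancel d o nb)
  qed
qed

section \<open>The domains\<close>

lemma eta_eq:
  assumes "k \<noteq> 0"
  shows "eta c k = sg c * Im k * ((norm k)\<^sup>2 - 1) / (2 * (norm k)\<^sup>2)"
proof -
  have n: "(norm k)\<^sup>2 \<noteq> 0" using assms by simp
  have "Im (1 / k) = - Im k / (norm k)\<^sup>2"
    by (simp add: Im_divide cmod_power2)
  then have "eta c k = sg c * (Im k - Im k / (norm k)\<^sup>2) / 2"
    by (simp add: eta_def theta2_def)
  also have "\<dots> = sg c * Im k * ((norm k)\<^sup>2 - 1) / (2 * (norm k)\<^sup>2)"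
    using n by (simp add: field_simps)
  finally show ?thesis .
qed

lemma eta_nonpos_iff:
  assumes "k \<noteq> 0"
  shows "eta c k \<le> 0 \<longleftrightarrow> sg c * Im k * ((norm k)\<^sup>2 - 1) \<le> 0"
    and "eta c k \<ge> 0 \<longleftrightarrow> sg c * Im k * ((norm k)\<^sup>2 - 1) \<ge> 0"
proof -
  have "2 * (norm k)\<^sup>2 > 0" using assms by simp
  then show "eta c k \<le> 0 \<longleftrightarrow> sg c * Im k * ((norm k)\<^sup>2 - 1) \<le> 0"
     "eta c k \<ge> 0 \<longleftrightarrow> sg c * Im k * ((norm k)\<^sup>2 - 1) \<ge> 0"
    unfolding eta_eq[OF assms] by (simp_all add: divide_le_eq le_divide_eq)
qed

lemma cols_sign: "k \<in> cols Dminus Dplus c \<Longrightarrow> sg c * Im k * ((norm k)\<^sup>2 - 1) \<le> 0"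
  by (auto simp: cols_def Dminus_def Dplus_def D1_def D2_def D3_def D4_def sg_def
      mult_le_0_iff zero_le_mult_iff power_le_one_iff one_le_power split: if_splits
      intro: less_imp_le)

lemma cols_closure: "cols (closure A) (closure B) c = closure (cols A B c)"
  by (simp add: cols_def)

lemma cols_closure_eta:
  assumes "k \<in> cols (closure Dminus) (closure Dplus) c - {0}"
  shows "k \<noteq> 0" "eta c k \<le> 0"
proof -
  show k: "k \<noteq> 0" using assms by auto
  have "closed {k. sg c * Im k * ((norm k)\<^sup>2 - 1) \<le> 0}"
    by (intro closed_Collect_le continuous_intros)
  then have "closure (cols Dminus Dplus c) \<subseteq> {k. sg c * Im k * ((norm k)\<^sup>2 - 1) \<le> 0}"
    using cols_sign by (intro closure_minimal) auto
  then show "eta c k \<le> 0"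
    using assms eta_nonpos_iff(1)[OF k] unfolding cols_closure by auto
qed

lemma open_cols: "open (cols Dminus Dplus c)"
  unfolding cols_def Dminus_def Dplus_def D1_def D2_def D3_def D4_def
  by (auto intro!: open_Un open_Collect_conj open_Collect_less continuous_intros)

lemma cols_subset: "cols Dminus Dplus c \<subseteq> cols (closure Dminus) (closure Dplus) c - {0}"
proof -
  have "0 \<notin> cols Dminus Dplus c"
    by (auto simp: cols_def Dminus_def Dplus_def D1_def D2_def D3_def D4_def)
  then show ?thesis
    unfolding cols_closure using closure_subset[of "cols Dminus Dplus c"] by blast
qed

lemma closure_D1: "k \<in> closure D1 \<Longrightarrow> Im k \<ge> 0 \<and> norm k \<ge> 1"
proof -
  have "closed {k. Im k \<ge> 0 \<and> norm k \<ge> 1}"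
    by (intro closed_Collect_conj closed_Collect_le continuous_intros)
  then have "closure D1 \<subseteq> {k. Im k \<ge> 0 \<and> norm k \<ge> 1}"
    by (intro closure_minimal) (auto simp: D1_def)
  then show "k \<in> closure D1 \<Longrightarrow> Im k \<ge> 0 \<and> norm k \<ge> 1" by blast
qed

lemma closure_D4: "k \<in> closure D4 \<Longrightarrow> Im k \<le> 0 \<and> norm k \<ge> 1"
proof -
  have "closed {k. Im k \<le> 0 \<and> norm k \<ge> 1}"
    by (intro closed_Collect_conj closed_Collect_le continuous_intros)
  then have "closure D4 \<subseteq> {k. Im k \<le> 0 \<and> norm k \<ge> 1}"
    by (intro closure_minimal) (auto simp: D4_def)
  then show "k \<in> closure D4 \<Longrightarrow> Im k \<le> 0 \<and> norm k \<ge> 1" by blast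
qed

lemma cols_D4_D1:
  assumes "k \<in> cols (closure D4) (closure D1) c"
  shows "norm k \<ge> 1" "eta c k \<le> 0"
proof -
  show n: "norm k \<ge> 1"
    using assms closure_D1 closure_D4 by (auto simp: cols_def split: if_splits)
  then have "(norm k)\<^sup>2 - 1 \<ge> 0" by (simp add: one_le_power)
  moreover have "sg c * Im k \<le> 0"
    using assms closure_D1 closure_D4 by (auto simp: cols_def sg_def split: if_splits)
  ultimately have "sg c * Im k * ((norm k)\<^sup>2 - 1) \<le> 0"
    by (simp add: mult_nonpos_nonneg)
  moreover have "k \<noteq> 0" using n by auto
  ultimately show "eta c k \<le> 0" by (simp add: eta_nonpos_iff)
qed

lemma cols_D1_D4:
  assumes "k \<in> cols (closure D1) (closure D4) c"
  shows "norm k \<ge> 1" "eta c k \<ge> 0"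
proof -
  show n: "norm k \<ge> 1"
    using assms closure_D1 closure_D4 by (auto simp: cols_def split: if_splits)
  then have "(norm k)\<^sup>2 - 1 \<ge> 0" by (simp add: one_le_power)
  moreover have "sg c * Im k \<ge> 0"
    using assms closure_D1 closure_D4 by (auto simp: cols_def sg_def split: if_splits)
  ultimately have "sg c * Im k * ((norm k)\<^sup>2 - 1) \<ge> 0"
    by simp
  moreover have "k \<noteq> 0" using n by auto
  ultimately show "eta c k \<ge> 0" by (simp add: eta_nonpos_iff)
qed

lemma higher_deriv_diff_const:
  assumes "j \<ge> 1"
  shows "(deriv ^^ j) (\<lambda>z. f z - c) = (deriv ^^ j) f"
proof -
  obtain i where j: "j = Suc i" using assms by (cases j) auto
  have "((\<lambda>z. f z - c) has_field_derivative D) (at z) \<longleftrightarrow> (f has_field_derivative D) (at z)" for D z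
    using DERIV_diff[of "\<lambda>z. f z - c" D z UNIV "\<lambda>_. - c" 0] DERIV_diff[of f D z UNIV "\<lambda>_. c" 0]
    by auto
  then have "deriv (\<lambda>z. f z - c) = deriv f"
    by (simp add: deriv_def fun_eq_iff)
  then show ?thesis
    by (simp add: j funpow_Suc_right del: funpow.simps)
qed

section \<open>Translation to matrices\<close>

lemma volterra_T_iff:
  assumes "potential n (\<lambda>s k. Vmat g0 g0t g1 s k) w"
  shows "volterra_T g0 g0t g1 c k M \<longleftrightarrow>
     potential.solT (\<lambda>s k. Vmat g0 g0t g1 s k) {0..} c k (\<lambda>t. column c (M t))"
proof -
  interpret potential n "\<lambda>s k. Vmat g0 g0t g1 s k" w by (rule assms)
  let ?f = "\<lambda>t s. column c (volterra_integrand g0 g0t g1 k M t s)"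
  let ?g = "\<lambda>t s. vker (expn c k) (Vcut {0..} k) t s (column c (M s))"
  have eq: "?g t s = - ?f t s" if "0 \<le> t" "s \<in> {t..}" for t s
    using that unfolding column_volterra_integrand
    by (simp add: vker_def Vcut_def vec_eq_iff matrix_vector_mult_def sum_negf)
  have "?g t absolutely_integrable_on {t..} \<longleftrightarrow> ?f t absolutely_integrable_on {t..}" if t: "0 \<le> t" for t
  proof -
    have "?g t absolutely_integrable_on {t..} \<longleftrightarrow> (\<lambda>s. - ?f t s) absolutely_integrable_on {t..}"
      by (rule absolutely_integrable_spike_eq[of "{}"]) (use eq[OF t] in auto)
    also have "\<dots> \<longleftrightarrow> ?f t absolutely_integrable_on {t..}"
      by (simp add: set_integrable_def)
    finally show ?thesis .
  qed
  moreover have "integral {t..} (?g t) = - integral {t..} (?f t)" if t: "0 \<le> t" for t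
  proof -
    have "integral {t..} (?g t) = integral {t..} (\<lambda>s. - ?f t s)"
      by (rule integral_cong) (use eq[OF t] in auto)
    then show ?thesis by simp
  qed
  moreover have "column c (mat 1 :: cmat2) = axis c 1"
    by (simp add: column_def mat_def axis_def vec_eq_iff)
  ultimately show ?thesis
    by (simp add: volterra_T_def solT_def vsol_def)
qed

lemma volterra_U_iff:
  assumes "potential n (\<lambda>s k. Vmat g0 g0t g1 s k) w"
  shows "volterra_U g0 g0t g1 k M \<longleftrightarrow>
     (\<forall>c. potential.solU (\<lambda>s k. Vmat g0 g0t g1 s k) c k (\<lambda>t. column c (M t)))"
proof -
  interpret potential n "\<lambda>s k. Vmat g0 g0t g1 s k" w by (rule assms)
  let ?f = "volterra_integrand g0 g0t g1 k M"
  have ai: "?f t absolutely_integrable_on {0..t} \<longleftrightarrow>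
      (\<forall>c. (\<lambda>s. column c (?f t s)) absolutely_integrable_on {0..t})" for t
    unfolding absolutely_integrable_on_vec_iff by (auto simp: column_def)
  have int: "column c (integral {0..t} (?f t)) = integral {0..t} (\<lambda>s. column c (?f t s))"
    if f: "?f t absolutely_integrable_on {0..t}" for t c
  proof -
    have fi: "(\<lambda>s. ?f t s $ i) absolutely_integrable_on {0..t}" for i
      using f unfolding absolutely_integrable_on_vec_iff[where f = "?f t"] by blast
    have fc: "(\<lambda>s. column c (?f t s)) absolutely_integrable_on {0..t}"
      using f unfolding ai by blast
    show ?thesis
      using integral_vec_nth[OF fc] integral_vec_nth[OF fi] integral_vec_nth[OF f]
      by (simp add: vec_eq_iff column_def)
  qed
  have mat_eq: "A = B \<longleftrightarrow> (\<forall>c. column c A = column c B)" for A B :: cmat2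
    by (auto simp: vec_eq_iff column_def)
  have one: "column c (mat 1 :: cmat2) = axis c 1" for c
    by (simp add: column_def mat_def axis_def vec_eq_iff)
  have add: "column c (A + B) = column c A + column c B" for c and A B :: cmat2
    by (simp add: column_def vec_eq_iff)
  have "(?f t absolutely_integrable_on {0..t} \<and> M t = mat 1 + integral {0..t} (?f t)) \<longleftrightarrow>
      (\<forall>c. (\<lambda>s. column c (?f t s)) absolutely_integrable_on {0..t} \<and>
        column c (M t) = axis c 1 + integral {0..t} (\<lambda>s. column c (?f t s)))" for t
  proof (cases "?f t absolutely_integrable_on {0..t}")
    case True
    then have "\<forall>c. (\<lambda>s. column c (?f t s)) absolutely_integrable_on {0..t}"
      unfolding ai .
    then show ?thesis
      unfolding mat_eq[of "M t"] add one int[OF True] using True by blast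
  next
    case False
    then show ?thesis
      unfolding ai by blast
  qed
  then have "volterra_U g0 g0t g1 k M \<longleftrightarrow> (\<forall>t\<ge>0. \<forall>c.
      (\<lambda>s. column c (?f t s)) absolutely_integrable_on {0..t} \<and>
      column c (M t) = axis c 1 + integral {0..t} (\<lambda>s. column c (?f t s)))"
    unfolding volterra_U_def by (simp only:)
  also have "\<dots> \<longleftrightarrow> (\<forall>c. solU c k (\<lambda>t. column c (M t)))"
    unfolding solU_def vsol_def column_volterra_integrand by blast
  finally show ?thesis .
qed

lemma weak_solution_if_primitive:
  assumes M: "\<And>t. column c (M t) = X t"
    and X: "\<And>i. is_primitive (\<lambda>t. X t $ i) (\<lambda>t. (Vmat g0 g0t g1 t k *v X t) $ i - expn c k $ i * X t $ i)"
  shows "weak_solution g0 g0t g1 c k M"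
proof -
  \<comment> \<open>the equation then holds for every \<open>t\<close> by definition; what remains is that \<open>M'\<close> is the weak derivative\<close>
  define M' where "M' t = Vmat g0 g0t g1 t k ** M t - (\<i> * theta2 k) *m (sigma3 ** M t - M t ** sigma3)" for t
  have Xi: "X t $ i = M t $ i $ c" for t i
    by (simp add: M[symmetric] column_def)
  have comm: "((\<i> * theta2 k) *m (sigma3 ** M t - M t ** sigma3)) $ i $ c = expn c k $ i * X t $ i" for t i
    unfolding scale_mat_nth Xi using exhaust_2[of i] exhaust_2[of c]
    by (auto simp: expn_def matrix_matrix_mult_def sum_2 sigma3_nth algebra_simps)
  have "(Vmat g0 g0t g1 t k ** M t) $ i $ c = (Vmat g0 g0t g1 t k *v X t) $ i" for t i
    by (simp add: matrix_matrix_mult_def matrix_vector_mult_def Xi)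
  then have M'i: "column c (M' t) $ i = (Vmat g0 g0t g1 t k *v X t) $ i - expn c k $ i * X t $ i" for t i
    by (simp add: M'_def column_def comm)
  have "has_weak_derivative X (\<lambda>t. column c (M' t))"
    by (rule has_weak_derivative_if_primitive) (unfold M'i, rule X)
  then show ?thesis
    unfolding weak_solution_def M by (intro exI[of _ M']) (simp add: M'_def)
qed

theorem theorem4p1:
  fixes n :: nat and Nt :: int and g0 g0t g1 :: "real \<Rightarrow> real"
  assumes n: "n \<ge> 1"
    and g0t: "has_weak_derivative g0 g0t"
    and g1: "g1 \<in> borel_measurable (lebesgue_on {0..})"
    and L1: "(\<lambda>t. (1 + t) ^ n * (\<bar>g0 t - 2 * pi * of_int Nt\<bar> + \<bar>g0t t\<bar> + \<bar>g1 t\<bar>))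
               absolutely_integrable_on {0..}"
  shows "\<exists>T U :: real \<Rightarrow> complex \<Rightarrow> complex^2^2.
    \<comment> \<open>solutions of the Volterra equations, and their uniqueness\<close>
    (\<forall>c. \<forall>k \<in> cols (closure Dminus) (closure Dplus) c - {0}.
       volterra_T g0 g0t g1 c k (\<lambda>t. T t k) \<and>
       (\<forall>M. volterra_T g0 g0t g1 c k M \<longrightarrow> (\<forall>t\<ge>0. column c (M t) = column c (T t k)))) \<and>
    (\<forall>k \<in> - {0}.
       volterra_U g0 g0t g1 k (\<lambda>t. U t k) \<and>
       (\<forall>M. volterra_U g0 g0t g1 k M \<longrightarrow> (\<forall>t\<ge>0. M t = U t k))) \<and>
    \<comment> \<open>(a)\<close>
    (\<forall>c. \<forall>k \<in> cols (closure Dminus) (closure Dplus) c - {0}.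
       weak_solution g0 g0t g1 c k (\<lambda>t. T t k)) \<and>
    \<comment> \<open>(b)\<close>
    (\<forall>c. \<forall>k \<in> - {0}. weak_solution g0 g0t g1 c k (\<lambda>t. U t k)) \<and>
    \<comment> \<open>(c)\<close>
    (\<forall>t\<ge>0. \<forall>c.
       continuous_on (cols (closure Dminus) (closure Dplus) c - {0}) (\<lambda>k. column c (T t k)) \<and>
       col_analytic_on (T t) c (cols Dminus Dplus c)) \<and>
    \<comment> \<open>(d)\<close>
    (\<forall>t\<ge>0. \<forall>c. col_analytic_on (U t) c (- {0})) \<and>
    \<comment> \<open>(e)\<close>
    (\<forall>t\<ge>0. \<forall>j\<in>{1..n}. \<forall>c. \<exists>G.
       continuous_extension (cols Dminus Dplus c) (cols (closure Dminus) (closure Dplus) c - {0})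
         (col_deriv j (T t) c) G) \<and>
    \<comment> \<open>(f); on the boundary the derivatives of T are the continuous extensions of (e)\<close>
    (\<exists>C>0. \<forall>t\<ge>0. \<forall>j\<le>n. \<forall>c.
       (\<exists>G. continuous_extension (cols Dminus Dplus c)
              (cols (closure Dminus) (closure Dplus) c - {0})
              (col_deriv j (\<lambda>z. T t z - mat 1) c) G \<and>
            (\<forall>k \<in> cols (closure D4) (closure D1) c. norm (G k) \<le> C / (1 + t) ^ (n - j))) \<and>
       (\<forall>k \<in> cols (closure D1) (closure D4) c.
          norm (col_deriv j (\<lambda>z. U t z - mat 1) c k) \<le> C * (1 + t) ^ j) \<and>
       (\<forall>k \<in> cols (closure D4) (closure D1) c.
          norm (col_deriv j
            (\<lambda>z. (U t z - mat 1) ** mexp ((- 2 * \<i> * theta2 z * of_real t) *m sigma3)) c k)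
          \<le> C * (1 + t) ^ j)) \<and>
    \<comment> \<open>(g)\<close>
    (\<forall>t\<ge>0. \<forall>k \<in> (closure Dplus \<inter> closure Dminus) - {0}. det (T t k) = 1) \<and>
    (\<forall>t\<ge>0. \<forall>k \<in> - {0}. det (U t k) = 1) \<and>
    \<comment> \<open>(h)\<close>
    (\<forall>t\<ge>0. \<forall>c. \<forall>k \<in> cols (closure Dminus) (closure Dplus) c - {0}.
       column c (T t k) = column c (sigma2 ** T t (- k) ** sigma2) \<and>
       column c (T t k) = column c (sigma2 ** cnj_mat (T t (cnj k)) ** sigma2)) \<and>
    (\<forall>t\<ge>0. \<forall>k \<in> - {0}.
       U t k = sigma2 ** U t (- k) ** sigma2 \<and>
       U t k = sigma2 ** cnj_mat (U t (cnj k)) ** sigma2)"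
proof -
  let ?w = "\<lambda>t. \<bar>g0 t - 2 * pi * of_int Nt\<bar> + \<bar>g0t t\<bar> + \<bar>g1 t\<bar>"
  have pot: "potential n (\<lambda>s k. Vmat g0 g0t g1 s k) ?w"
    by (rule Vmat_potential[OF n g0t g1 L1])
  interpret potential n "\<lambda>s k. Vmat g0 g0t g1 s k" ?w
    by (rule pot)
  let ?S = "cols (closure Dminus) (closure Dplus)"
  define T :: "real \<Rightarrow> complex \<Rightarrow> complex^2^2" where "T t k = (\<chi> i c. Tcol {0..} c k t $ i)" for t k
  define U :: "real \<Rightarrow> complex \<Rightarrow> complex^2^2" where "U t k = (\<chi> i c. Ucol c k t $ i)" for t k
  have Tc: "column c (T t k) = Tcol {0..} c k t" for c t k
    by (simp add: T_def column_def vec_eq_iff)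
  have Uc: "column c (U t k) = Ucol c k t" for c t k
    by (simp add: U_def column_def vec_eq_iff)
  have TI: "(T t z - mat 1) $ i $ c = Tcol {0..} c z t $ i - axis c 1 $ i" for t z i c
    by (simp add: T_def mat_def axis_def)
  have UI: "(U t z - mat 1) $ i $ c = Ucol c z t $ i - axis c 1 $ i" for t z i c
    by (simp add: U_def mat_def axis_def)
  have D: "z \<noteq> 0" "eta c z \<le> 0" if "z \<in> cols Dminus Dplus c" for z c
    using cols_closure_eta[of z c] cols_subset[of c] that by auto
  have S: "?S c - {0} \<subseteq> {k. k \<noteq> 0 \<and> eta c k \<le> 0}" for c
    using cols_closure_eta by blast
  have interior: "Tderiv c t j k = col_deriv j (\<lambda>z. T t z - mat 1) c k"
    if "t \<ge> 0" "j \<le> n" "k \<in> cols Dminus Dplus c" for c t j k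
    unfolding col_deriv_def vec_eq_iff vec_lambda_beta TI
    by (intro allI Tderiv_interior[OF open_cols _ _ that(3,1,2)]) (erule D)+
  have extension: "continuous_extension (cols Dminus Dplus c) (?S c - {0})
      (col_deriv j (\<lambda>z. T t z - mat 1) c) (Tderiv c t j)" if "t \<ge> 0" "j \<le> n" for c t j
    unfolding continuous_extension_def
    using cols_subset continuous_on_subset[OF Tderiv_continuous[OF that] S] interior[OF that] by blast
  have col_deriv_T: "col_deriv j (\<lambda>z. T t z - mat 1) c = col_deriv j (T t) c" if "j \<ge> 1" for j t c
    by (rule ext) (simp add: col_deriv_def higher_deriv_diff_const[OF that])
  obtain C1 where C1: "C1 > 0" "\<And>c k t j. norm k \<ge> 1 \<Longrightarrow> eta c k \<le> 0 \<Longrightarrow> t \<ge> 0 \<Longrightarrow> j \<le> n \<Longrightarrow>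
      norm (Tderiv c t j k) \<le> C1 / (1 + t) ^ (n - j)"
    using Tderiv_bound[of 1] by auto
  obtain C2 where C2: "C2 > 0"
    "\<And>c k t i j. norm k \<ge> 1 \<Longrightarrow> eta c k \<ge> 0 \<Longrightarrow> t \<ge> 0 \<Longrightarrow> j \<le> n \<Longrightarrow>
      norm ((deriv ^^ j) (\<lambda>z. Ucol c z t $ i - axis c 1 $ i) k) \<le> C2 * (1 + t) ^ j"
    "\<And>c k t i j. norm k \<ge> 1 \<Longrightarrow> eta c k \<le> 0 \<Longrightarrow> t \<ge> 0 \<Longrightarrow> j \<le> n \<Longrightarrow>
      norm ((deriv ^^ j) (\<lambda>z. (Ucol c z t $ i - axis c 1 $ i)
        * exp (- 2 * \<i> * theta2 z * of_real t * of_real (sg c))) k) \<le> C2 * (1 + t) ^ j"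
    by (rule U_deriv_bound) (rule that)
  define C where "C = C1 + 2 * C2"
  have C: "C > 0" "C1 \<le> C" "2 * C2 \<le> C" using C1(1) C2(1) by (auto simp: C_def)
  have col_bound: "norm x \<le> C * (1 + t) ^ j"
    if "\<And>i. norm (x $ i) \<le> C2 * (1 + t) ^ j" "t \<ge> 0" for x :: "complex^2" and t j
  proof -
    have "norm x \<le> (\<Sum>i\<in>(UNIV::2 set). C2 * (1 + t) ^ j)"
      by (intro order_trans[OF norm_vec_le_sum] sum_mono that)
    also have "\<dots> = 2 * C2 * (1 + t) ^ j" by simp
    also have "\<dots> \<le> C * (1 + t) ^ j"
      using C(3) that(2) by (intro mult_right_mono) auto
    finally show ?thesis .
  qed
  have right_mult: "((U t z - mat 1) ** mexp ((- 2 * \<i> * theta2 z * of_real t) *m sigma3)) $ i $ c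
      = (Ucol c z t $ i - axis c 1 $ i) * exp (- 2 * \<i> * theta2 z * of_real t * of_real (sg c))" for t z i c
    unfolding UI[symmetric] using exhaust_2[of c]
    by (auto simp: matrix_matrix_mult_def sum_2 mexp_sigma3)
  show ?thesis
  proof (rule exI[of _ T], rule exI[of _ U], intro conjI)
    show "\<forall>c. \<forall>k \<in> ?S c - {0}. volterra_T g0 g0t g1 c k (\<lambda>t. T t k) \<and>
       (\<forall>M. volterra_T g0 g0t g1 c k M \<longrightarrow> (\<forall>t\<ge>0. column c (M t) = column c (T t k)))"
    proof (intro allI ballI conjI impI)
      fix c k assume "k \<in> ?S c - {0}"
      note k = cols_closure_eta[OF this]
      show "volterra_T g0 g0t g1 c k (\<lambda>t. T t k)"
        unfolding volterra_T_iff[OF pot] Tc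
        by (rule Tcol_props(1)[OF k(1) stable_halfline[OF k(2) order_refl] order_refl]) simp
      fix M and t :: real assume "volterra_T g0 g0t g1 c k M" "t \<ge> 0"
      then show "column c (M t) = column c (T t k)"
        unfolding volterra_T_iff[OF pot] Tc by (rule Tcol_unique[OF k])
    qed
    show "\<forall>k \<in> - {0}. volterra_U g0 g0t g1 k (\<lambda>t. U t k) \<and>
       (\<forall>M. volterra_U g0 g0t g1 k M \<longrightarrow> (\<forall>t\<ge>0. M t = U t k))"
    proof (intro ballI conjI allI impI)
      fix k :: complex assume "k \<in> - {0}"
      then have k: "k \<noteq> 0" by simp
      show "volterra_U g0 g0t g1 k (\<lambda>t. U t k)"
        unfolding volterra_U_iff[OF pot] Uc using Ucol_props[OF k] by blast
      fix M and t :: real assume M: "volterra_U g0 g0t g1 k M" and t: "t \<ge> 0"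
      have "column c (M t) = column c (U t k)" for c
        unfolding Uc using M unfolding volterra_U_iff[OF pot]
        by (intro solU_unique[OF k _ Ucol_props[OF k] t]) blast
      then show "M t = U t k"
        by (simp add: column_def vec_eq_iff)
    qed
    show "\<forall>c. \<forall>k \<in> ?S c - {0}. weak_solution g0 g0t g1 c k (\<lambda>t. T t k)"
    proof (intro allI ballI)
      fix c k assume "k \<in> ?S c - {0}"
      from weak_solution_if_primitive[OF Tc Tcol_is_primitive[OF cols_closure_eta[OF this]]]
      show "weak_solution g0 g0t g1 c k (\<lambda>t. T t k)" .
    qed
    show "\<forall>c. \<forall>k \<in> - {0}. weak_solution g0 g0t g1 c k (\<lambda>t. U t k)"
      using weak_solution_if_primitive[OF Uc Ucol_is_primitive] by blast
    show "\<forall>t\<ge>0. \<forall>c. continuous_on (?S c - {0}) (\<lambda>k. column c (T t k)) \<and>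
       col_analytic_on (T t) c (cols Dminus Dplus c)"
    proof (intro allI impI conjI)
      fix t :: real and c assume t: "t \<ge> 0"
      have "continuous_on (?S c - {0}) (\<lambda>k. Tderiv c t 0 k + axis c 1)"
        by (intro continuous_intros continuous_on_subset[OF Tderiv_continuous[OF t] S]) simp
      then show "continuous_on (?S c - {0}) (\<lambda>k. column c (T t k))"
      proof (rule continuous_on_eq)
        fix k assume "k \<in> ?S c - {0}"
        from Tderiv_0[OF cols_closure_eta[OF this] t]
        show "Tderiv c t 0 k + axis c 1 = column c (T t k)" by (simp add: Tc)
      qed
      show "col_analytic_on (T t) c (cols Dminus Dplus c)"
        unfolding col_analytic_on_def T_def vec_lambda_beta
        by (intro allI Tcol_analytic[OF open_cols _ _ t]) (erule D)+
    qed
    show "\<forall>t\<ge>0. \<forall>c. col_analytic_on (U t) c (- {0})"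
      unfolding col_analytic_on_def U_def using Ucol_analytic by simp
    show "\<forall>t\<ge>0. \<forall>j\<in>{1..n}. \<forall>c. \<exists>G. continuous_extension (cols Dminus Dplus c) (?S c - {0})
         (col_deriv j (T t) c) G"
      using extension col_deriv_T by (metis atLeastAtMost_iff)
    show "\<exists>C>0. \<forall>t\<ge>0. \<forall>j\<le>n. \<forall>c.
       (\<exists>G. continuous_extension (cols Dminus Dplus c) (?S c - {0})
              (col_deriv j (\<lambda>z. T t z - mat 1) c) G \<and>
            (\<forall>k \<in> cols (closure D4) (closure D1) c. norm (G k) \<le> C / (1 + t) ^ (n - j))) \<and>
       (\<forall>k \<in> cols (closure D1) (closure D4) c.
          norm (col_deriv j (\<lambda>z. U t z - mat 1) c k) \<le> C * (1 + t) ^ j) \<and>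
       (\<forall>k \<in> cols (closure D4) (closure D1) c.
          norm (col_deriv j
            (\<lambda>z. (U t z - mat 1) ** mexp ((- 2 * \<i> * theta2 z * of_real t) *m sigma3)) c k)
          \<le> C * (1 + t) ^ j)"
    proof (intro exI[of _ C] conjI C(1) allI impI ballI)
      fix t :: real and j c assume t: "t \<ge> 0" and j: "j \<le> n"
      show "\<exists>G. continuous_extension (cols Dminus Dplus c) (?S c - {0})
              (col_deriv j (\<lambda>z. T t z - mat 1) c) G \<and>
            (\<forall>k \<in> cols (closure D4) (closure D1) c. norm (G k) \<le> C / (1 + t) ^ (n - j))"
      proof (intro exI[of _ "Tderiv c t j"] conjI ballI extension[OF t j])
        fix k assume k: "k \<in> cols (closure D4) (closure D1) c"
        have "norm (Tderiv c t j k) \<le> C1 / (1 + t) ^ (n - j)"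
          by (rule C1(2)[OF cols_D4_D1[OF k] t j])
        also have "\<dots> \<le> C / (1 + t) ^ (n - j)"
          using C(2) t by (intro divide_right_mono) auto
        finally show "norm (Tderiv c t j k) \<le> C / (1 + t) ^ (n - j)" .
      qed
      show "norm (col_deriv j (\<lambda>z. U t z - mat 1) c k) \<le> C * (1 + t) ^ j"
        if "k \<in> cols (closure D1) (closure D4) c" for k
        unfolding col_deriv_def UI
        by (rule col_bound[OF _ t]) (simp only: vec_lambda_beta C2(2)[OF cols_D1_D4[OF that] t j])
      show "norm (col_deriv j
            (\<lambda>z. (U t z - mat 1) ** mexp ((- 2 * \<i> * theta2 z * of_real t) *m sigma3)) c k)
          \<le> C * (1 + t) ^ j" if "k \<in> cols (closure D4) (closure D1) c" for k
        unfolding col_deriv_def right_mult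
        by (rule col_bound[OF _ t]) (simp only: vec_lambda_beta C2(3)[OF cols_D4_D1[OF that] t j])
    qed
    show "\<forall>t\<ge>0. \<forall>k \<in> (closure Dplus \<inter> closure Dminus) - {0}. det (T t k) = 1"
    proof (intro allI impI ballI)
      fix t :: real and k assume t: "t \<ge> 0" and k: "k \<in> (closure Dplus \<inter> closure Dminus) - {0}"
      have "k \<in> ?S 1 - {0}" "k \<in> ?S 2 - {0}" using k by (auto simp: cols_def)
      from Tcol_det[OF cols_closure_eta[OF this(1)] cols_closure_eta(2)[OF this(2)] t]
      show "det (T t k) = 1"
        by (simp add: det_2 T_def)
    qed
    show "\<forall>t\<ge>0. \<forall>k \<in> - {0}. det (U t k) = 1"
      using Ucol_det by (simp add: det_2 U_def)
    show "\<forall>t\<ge>0. \<forall>c. \<forall>k \<in> ?S c - {0}.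
       column c (T t k) = column c (sigma2 ** T t (- k) ** sigma2) \<and>
       column c (T t k) = column c (sigma2 ** cnj_mat (T t (cnj k)) ** sigma2)"
    proof (intro allI impI ballI)
      fix t :: real and c k assume t: "t \<ge> 0" and "k \<in> ?S c - {0}"
      note sym = Tcol_symmetry[OF cols_closure_eta[OF this(2)] t]
      have "column c (sigma2 ** T t (- k) ** sigma2) = flip c (Tcol {0..} (other c) (- k) t)"
        "column c (sigma2 ** cnj_mat (T t (cnj k)) ** sigma2) = cflip c (Tcol {0..} (other c) (cnj k) t)"
        by (simp_all add: column_def sigma2_conjugate T_def flip_def cflip_def cnj_mat_def map_matrix_def)
      then show "column c (T t k) = column c (sigma2 ** T t (- k) ** sigma2) \<and>
         column c (T t k) = column c (sigma2 ** cnj_mat (T t (cnj k)) ** sigma2)"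
        unfolding Tc using sym by simp
    qed
    show "\<forall>t\<ge>0. \<forall>k \<in> - {0}. U t k = sigma2 ** U t (- k) ** sigma2 \<and>
       U t k = sigma2 ** cnj_mat (U t (cnj k)) ** sigma2"
    proof (intro allI impI ballI)
      fix t :: real and k :: complex assume t: "t \<ge> 0" and "k \<in> - {0}"
      then have k: "k \<noteq> 0" by simp
      have "U t k $ i $ c = (sigma2 ** U t (- k) ** sigma2) $ i $ c"
        "U t k $ i $ c = (sigma2 ** cnj_mat (U t (cnj k)) ** sigma2) $ i $ c" for i c
        using arg_cong[OF Ucol_symmetry(1)[OF k t, of c], of "\<lambda>x. x $ i"]
          arg_cong[OF Ucol_symmetry(2)[OF k t, of c], of "\<lambda>x. x $ i"]
        by (simp_all add: sigma2_conjugate U_def flip_def cflip_def cnj_mat_def map_matrix_def)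
      then show "U t k = sigma2 ** U t (- k) ** sigma2 \<and>
         U t k = sigma2 ** cnj_mat (U t (cnj k)) ** sigma2"
        by (simp add: vec_eq_iff)
    qed
  qed
qed

end
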